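(* If $\sigma_k>\sigma_{k+1}$, then the error exponent $\mathrm{E}_k$ satisfies $$\mathrm{E}_k=-\lim_{\epsilon\to0^+}\frac1\epsilon\lim_{n\to\infty}\frac1n\log\mathbb P_n\left\{\|\tilde{\mathbf B}\mathbf\Phi_k\|_{\mathrm F}^2-\|\tilde{\mathbf B}\hat{\mathbf\Phi}_k\|_{\mathrm F}^2>\epsilon\right\}=\frac{1}{2\alpha_k}.$$
   Context: Setting. Let $\mathcal X=\{1,\dots,|\mathcal X|\}$ and $\mathcal Y=\{1,\dots,|\mathcal Y|\}$ be finite alphabets and $P_{XY}$ a joint probability distribution on $\mathcal X\times\mathcal Y$ whose marginals satisfy $P_X(x)>0$, $P_Y(y)>0$ for all $x,y$. Let $d=|\mathcal X|$. The matrix $\tilde{\mathbf B}\in\mathbb R^{|\mathcal Y|\times|\mathcal X|}$ has entries $\tilde B(y,x)=\frac{P_{XY}(x,y)-P_X(x)P_Y(y)}{\sqrt{P_X(x)P_Y(y)}}$. Let $\sigma_1\ge\dots\ge\sigma_d\ge0$ be its singular values ($\sigma_i=0$ for $i>|\mathcal Y|$) and $\boldsymbol\phi_1,\dots,\boldsymbol\phi_d\in\mathbb R^d$ corresponding orthonormal right singular vectors (so $\tilde{\mathbf B}^{\mathrm T}\tilde{\mathbf B}\boldsymbol\phi_i=\sigma_i^2\boldsymbol\phi_i$). Let $k\in\{1,\dots,d-1\}$ and $\mathbf\Phi_k=[\boldsymbol\phi_1,\dots,\boldsymbol\phi_k]$. $\|\cdot\|_{\mathrm F}$ is the Frobenius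 norm; logarithms are natural. Estimation. Given $n$ i.i.d. samples $(x_i,y_i)$ from $P_{XY}$ (probability $\mathbb P_n$), let $\hat P_{XY}$ be their empirical joint distribution with marginals $\hat P_X,\hat P_Y$, let $\hat{\mathbf B}\in\mathbb R^{|\mathcal Y|\times|\mathcal X|}$ have entries $\hat B(y,x)=\frac{\hat P_{XY}(x,y)}{\sqrt{\hat P_X(x)\hat P_Y(y)}}-\sqrt{\hat P_X(x)\hat P_Y(y)}$, and let $\hat{\mathbf\Phi}_k\in\mathbb R^{d\times k}$ be the matrix whose orthonormal columns are right singular vectors of $\hat{\mathbf B}$ for its $k$ largest singular values. (An arbitrary fixed convention is used when a denominator vanishes or singular values tie.) Definition of $\alpha_k$. Let $\mathbf L$ be the $(|\mathcal X||\mathcal Y|)\times(|\mathcal X||\mathcal Y|)$ matrix whose entry in row $(x-1)|\mathcal Y|+y$ and column $(x'-1)|\mathcal Y|+y'$ is $$\sqrt{\frac{P_{XY}(x',y')}{P_X(x)P_Y(y)}}\left[\delta_{xx'}\delta_{yy'}-\frac12\left(\frac{\delta_{xx'}}{P_X(x)}+\frac{\delta_{yy'}}{P_Y(y)}\right)\left(P_{XY}(x,y)+P_X(x)P_Y(y)\right)\right].$$ Let $\boldsymbol\theta_{ij}=\boldsymbol\phi_j\otimes(\tilde{\mathbf B}\boldsymbol\phi_i)+\boldsymbol\phi_i\otimes(\tilde{\mathbf B}\boldsymbol\phi_j)$ (Kronecker products). Then $$\mathbf G_k=\mathbf L^{\mathrm T}\left(\sum_{i=1}^k\sum_{j=k+1}^d\frac{\boldsymbol\theta_{ij}\boldsymbol\theta_{ij}^{\mathrm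 T}}{\sigma_i^2-\sigma_j^2}\right)\mathbf L$$ and $\alpha_k$ is the spectral norm of $\mathbf G_k$. *)

theory Defs
  imports "HOL-Probability.Probability"
begin

text \<open>
  The alphabets are finite types \<open>'x\<close>, \<open>'y\<close>, so a matrix with rows indexed by \<open>'y\<close> and columns
  by \<open>'x\<close> has type \<open>real^'x^'y\<close>. Singular values and singular vectors are indexed by the numbers
  \<open>1, \<dots>, CARD('x)\<close>; values at other indices are irrelevant.
\<close>

abbreviation pX :: "('x::finite \<times> 'y::finite) pmf \<Rightarrow> 'x \<Rightarrow> real" where
  "pX P x \<equiv> pmf (map_pmf fst P) x"

abbreviation pY :: "('x::finite \<times> 'y::finite) pmf \<Rightarrow> 'y \<Rightarrow> real" where
  "pY P y \<equiv> pmf (map_pmf snd P) y"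

definition B_tilde :: "('x::finite \<times> 'y::finite) pmf \<Rightarrow> real^'x^'y" where
  "B_tilde P = (\<chi> y x. (pmf P (x, y) - pX P x * pY P y) / sqrt (pX P x * pY P y))"

text \<open>
  \<open>\<sigma>\<close> lists all \<open>CARD('x)\<close> singular values of \<open>M\<close> in nonincreasing order, and \<open>\<phi>\<close> is a corresponding
  orthonormal family of right singular vectors. That \<open>\<sigma> i = 0\<close> for \<open>i > CARD('y)\<close> follows, because
  the rank of \<open>transpose M ** M\<close> is at most \<open>CARD('y)\<close>.
\<close>
definition right_singular_system ::
    "real^'x^'y \<Rightarrow> (nat \<Rightarrow> real) \<Rightarrow> (nat \<Rightarrow> real^'x) \<Rightarrow> bool" where
  "right_singular_system M \<sigma> \<phi> \<longleftrightarrow>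
     (\<forall>i\<in>{1..CARD('x)}. 0 \<le> \<sigma> i) \<and>
     (\<forall>i\<in>{1..CARD('x)}. \<forall>j\<in>{1..CARD('x)}. i \<le> j \<longrightarrow> \<sigma> j \<le> \<sigma> i) \<and>
     (\<forall>i\<in>{1..CARD('x)}. \<forall>j\<in>{1..CARD('x)}. \<phi> i \<bullet> \<phi> j = (if i = j then 1 else 0)) \<and>
     (\<forall>i\<in>{1..CARD('x)}. (transpose M ** M) *v \<phi> i = (\<sigma> i)\<^sup>2 *\<^sub>R \<phi> i)"

definition top_right_singular_vectors :: "nat \<Rightarrow> real^'x^'y \<Rightarrow> (nat \<Rightarrow> real^'x) \<Rightarrow> bool" where
  "top_right_singular_vectors k M \<psi> \<longleftrightarrow>
     (\<exists>\<sigma> \<phi>. right_singular_system M \<sigma> \<phi> \<and> (\<forall>i\<in>{1..k}. \<psi> i = \<phi> i))"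

definition frobenius_norm :: "'r set \<Rightarrow> 'c set \<Rightarrow> ('r \<Rightarrow> 'c \<Rightarrow> real) \<Rightarrow> real" where
  "frobenius_norm R C A = sqrt (\<Sum>i\<in>R. \<Sum>j\<in>C. (A i j)\<^sup>2)"

text \<open>
  The Frobenius norm of the product of \<open>M\<close> with the matrix whose columns are
  \<open>\<phi> 1, \<dots>, \<phi> k\<close>; column \<open>i\<close> of that product is \<open>M *v \<phi> i\<close>.
\<close>
definition frobenius_cols :: "real^'x^'y \<Rightarrow> nat \<Rightarrow> (nat \<Rightarrow> real^'x) \<Rightarrow> real" where
  "frobenius_cols M k \<phi> = frobenius_norm UNIV {1..k} (\<lambda>y i. (M *v \<phi> i) $ y)"

text \<open>The empirical distribution of a sample; only meaningful for nonempty samples.\<close>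
definition empirical :: "'a list \<Rightarrow> 'a pmf" where
  "empirical xs = pmf_of_multiset (mset xs)"

text \<open>\<open>c\<close> is the convention for the entries with a vanishing denominator.\<close>
definition B_hat :: "(('x::finite \<times> 'y::finite) pmf \<Rightarrow> real^'x^'y) \<Rightarrow> ('x \<times> 'y) pmf \<Rightarrow> real^'x^'y" where
  "B_hat c Q = (\<chi> y x.
     if pX Q x * pY Q y = 0 then c Q $ y $ x
     else pmf Q (x, y) / sqrt (pX Q x * pY Q y) - sqrt (pX Q x * pY Q y))"

definition kron_vec :: "real^'a \<Rightarrow> real^'b \<Rightarrow> real^('a \<times> 'b)" where
  "kron_vec u v = (\<chi> p. u $ fst p * v $ snd p)"

definition L_matrix :: "('x::finite \<times> 'y::finite) pmf \<Rightarrow> real^('x \<times> 'y)^('x \<times> 'y)" where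
  "L_matrix P = (\<chi> p q. case p of (x, y) \<Rightarrow> case q of (x', y') \<Rightarrow>
     sqrt (pmf P (x', y') / (pX P x * pY P y)) *
     (of_bool (x = x') * of_bool (y = y')
      - 1 / 2 * (of_bool (x = x') / pX P x + of_bool (y = y') / pY P y)
          * (pmf P (x, y) + pX P x * pY P y)))"

definition theta ::
    "('x::finite \<times> 'y::finite) pmf \<Rightarrow> (nat \<Rightarrow> real^'x) \<Rightarrow> nat \<Rightarrow> nat \<Rightarrow> real^('x \<times> 'y)" where
  "theta P \<phi> i j =
     kron_vec (\<phi> j) (B_tilde P *v \<phi> i) + kron_vec (\<phi> i) (B_tilde P *v \<phi> j)"

definition G_matrix ::
    "('x::finite \<times> 'y::finite) pmf \<Rightarrow> (nat \<Rightarrow> real) \<Rightarrow> (nat \<Rightarrow> real^'x) \<Rightarrow> nat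
      \<Rightarrow> real^('x \<times> 'y)^('x \<times> 'y)" where
  "G_matrix P \<sigma> \<phi> k =
     transpose (L_matrix P) **
     (\<Sum>i\<in>{1..k}. \<Sum>j\<in>{k+1..CARD('x)}.
        (1 / ((\<sigma> i)\<^sup>2 - (\<sigma> j)\<^sup>2)) *\<^sub>R (\<chi> p q. theta P \<phi> i j $ p * theta P \<phi> i j $ q)) **
     L_matrix P"

definition alpha ::
    "('x::finite \<times> 'y::finite) pmf \<Rightarrow> (nat \<Rightarrow> real) \<Rightarrow> (nat \<Rightarrow> real^'x) \<Rightarrow> nat \<Rightarrow> real" where
  "alpha P \<sigma> \<phi> k = onorm (\<lambda>v. G_matrix P \<sigma> \<phi> k *v v)"

text \<open>
  \<open>V\<close> is the rule selecting the right singular vectors of the estimated matrix, and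
  \<open>replicate_pmf n P\<close> is the law of \<open>n\<close> i.i.d. samples.
\<close>
definition loss_prob ::
    "('x::finite \<times> 'y::finite) pmf \<Rightarrow> (nat \<Rightarrow> real^'x) \<Rightarrow> nat
      \<Rightarrow> (('x \<times> 'y) pmf \<Rightarrow> real^'x^'y) \<Rightarrow> (real^'x^'y \<Rightarrow> nat \<Rightarrow> real^'x) \<Rightarrow> nat \<Rightarrow> real \<Rightarrow> real" where
  "loss_prob P \<phi> k c V n \<epsilon> =
     measure_pmf.prob (replicate_pmf n P)
       {xs. (frobenius_cols (B_tilde P) k \<phi>)\<^sup>2
            - (frobenius_cols (B_tilde P) k (V (B_hat c (empirical xs))))\<^sup>2 > \<epsilon>}"

text \<open>Logarithm of a probability, with \<open>log 0 = -\<infinity>\<close>.\<close>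
definition ln_prob :: "real \<Rightarrow> ereal" where
  "ln_prob p = (if p = 0 then -\<infinity> else ereal (ln p))"

text \<open>
  \<open>E = - lim\<^bsub>\<epsilon>\<rightarrow>0+\<^esub> (1/\<epsilon>) lim\<^bsub>n\<rightarrow>\<infinity>\<^esub> (1/n) log (p n \<epsilon>)\<close>: the inner limit \<open>r \<epsilon>\<close> must exist for all
  sufficiently small \<open>\<epsilon> > 0\<close>, which is all the outer limit depends on.
\<close>
definition has_error_exponent :: "(nat \<Rightarrow> real \<Rightarrow> real) \<Rightarrow> ereal \<Rightarrow> bool" where
  "has_error_exponent p E \<longleftrightarrow>
     (\<exists>r :: real \<Rightarrow> ereal.
        (\<forall>\<^sub>F \<epsilon> in at_right 0. (\<lambda>n. ln_prob (p n \<epsilon>) / ereal (real n)) \<longlonglongrightarrow> r \<epsilon>) \<and>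
        ((\<lambda>\<epsilon>. - (r \<epsilon> / ereal \<epsilon>)) \<longlongrightarrow> E) (at_right 0))"

end

theory Submission
  imports Defs "HOL-Real_Asymp.Real_Asymp"
begin

text \<open>
  Let \<open>loss Q\<close> be the loss incurred when the empirical distribution is \<open>Q\<close>, so that the inner
  probability is that of \<open>loss Q > \<epsilon>\<close>. The set \<open>{Q. loss Q > \<epsilon>}\<close> is open near \<open>P\<close>, because the top
  singular projection is continuous wherever there is a gap. The method of types bounds the
  probability from above by the infimum of the relative entropy over this very set (no closure is
  taken), and a change of measure bounds it from below by the same infimum at interior points; hence
  the inner limit exists and equals \<open>- rate \<epsilon>\<close>, where far-away \<open>Q\<close> do not matter since \<open>rate \<epsilon> \<rightarrow> 0\<close>.

  With \<open>v = (Q - P) / sqrt P\<close>, second-order perturbation theory gives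
  \<open>loss Q = v \<bullet> G v + o(\<parallel>v\<parallel>\<^sup>2)\<close>, while the relative entropy is \<open>\<parallel>v\<parallel>\<^sup>2 / 2 + o(\<parallel>v\<parallel>\<^sup>2)\<close>. Maximising the
  quadratic form on the sphere gives \<open>rate \<epsilon> / \<epsilon> \<rightarrow> 1 / (2 \<alpha>)\<close>. A maximiser is an eigenvector of \<open>G\<close>
  for \<open>\<alpha> > 0\<close>, hence orthogonal to the kernel of \<open>G\<close>, and therefore an admissible direction: it is
  orthogonal to \<open>sqrt P\<close> and vanishes off the support of \<open>P\<close>.
\<close>

subsection \<open>Large deviations of empirical distributions\<close>

text \<open>Individual singular vectors need not converge: singular values may tie inside each
  block, and the rule \<open>V\<close> is arbitrary. Everything is therefore expressed through the
  projection \<open>proj k\<close> onto the top block; the squared Frobenius norm is linear in it,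
  and the gap at \<open>k\<close> alone pins it down. Its perturbation is not found by
  differentiating eigenvectors but from two algebraic facts. The new projection is idempotent, which
  makes the diagonal blocks of its increment quadratically small. It commutes with the new Gram
  matrix, which determines the off-diagonal block to first order.

  The other obstacle is \<alpha> > 0: for a vanishing \<open>G\<close> the top eigenvector could not
  be shown to be an admissible direction. Positivity comes from a special feature of the problem:
  the square roots of the marginals are null vectors of the matrix, and they move with the
  distribution.

  Relative entropy is computed with \<open>ln 0 = 0\<close> and so stays finite off the support of
  \<open>P\<close>; hence the inclusion of supports is carried along explicitly.\<close>

definition rel_entropy :: "('a::finite) pmf \<Rightarrow> 'a pmf \<Rightarrow> real" where
  "rel_entropy Q P = (\<Sum>a\<in>UNIV. pmf Q a * ln (pmf Q a / pmf P a))"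

lemma pmf_replicate_pmf:
  "length xs = n \<Longrightarrow> pmf (replicate_pmf n P) xs = prod_list (map (pmf P) xs)"
proof (induction xs arbitrary: n)
  case Nil
  then show ?case by simp
next
  case (Cons x xs)
  then obtain m where m: "n = Suc m" "length xs = m" by auto
  have eq: "replicate_pmf (Suc m) P = map_pmf (\<lambda>(x, xs). x # xs) (pair_pmf P (replicate_pmf m P))"
    by (simp add: pair_pmf_def map_bind_pmf)
  have inj: "inj (\<lambda>(x, xs). x # xs)" by (auto simp: inj_def)
  have "pmf (replicate_pmf (Suc m) P) (x # xs) = pmf (pair_pmf P (replicate_pmf m P)) (x, xs)"
    unfolding eq using pmf_map_inj'[OF inj, of _ "(x, xs)"] by simp
  with Cons.IH[of m] m show ?case by (simp add: pmf_pair)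
qed

lemma prod_list_map_eq_prod_count:
  fixes f :: "'a::finite \<Rightarrow> real"
  shows "prod_list (map f xs) = (\<Prod>a\<in>UNIV. f a ^ count (mset xs) a)"
proof (induction xs)
  case (Cons x xs)
  have "(\<Prod>a\<in>UNIV. f a ^ count (mset (x # xs)) a)
      = (\<Prod>a\<in>UNIV. (if a = x then f a else 1) * f a ^ count (mset xs) a)"
    by (intro prod.cong) auto
  also have "\<dots> = f x * (\<Prod>a\<in>UNIV. f a ^ count (mset xs) a)"
    by (simp add: prod.distrib)
  finally show ?case using Cons by simp
qed simp

lemma pmf_empirical:
  "xs \<noteq> [] \<Longrightarrow> pmf (empirical xs) a = count (mset xs) a / length xs"
  by (simp add: empirical_def)

lemma set_pmf_empirical: "xs \<noteq> [] \<Longrightarrow> set_pmf (empirical xs) = set xs"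
  by (simp add: empirical_def)

text \<open>The likelihood ratio depends on a string only through its type. For \<open>Q\<close>
  equal to that type the exponent is the relative entropy, which gives the upper bound; for a fixed
  \<open>Q\<close> and strings typical of it the exponent is nearly the relative entropy, which
  gives the lower bound.\<close>

lemma change_of_measure:
  fixes P Q :: "'a::finite pmf"
  assumes len: "length xs = n" "n > 0" and sub: "set xs \<subseteq> set_pmf P" "set xs \<subseteq> set_pmf Q"
  shows "pmf (replicate_pmf n P) xs = pmf (replicate_pmf n Q) xs *
    exp (- real n * (\<Sum>a\<in>UNIV. pmf (empirical xs) a * ln (pmf Q a / pmf P a)))"
proof -
  have ne: "xs \<noteq> []" using len by auto
  let ?c = "\<lambda>a. count (mset xs) a"
  have "pmf P a ^ ?c a = pmf Q a ^ ?c a * exp (- (?c a * ln (pmf Q a / pmf P a)))" for a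
  \<comment> \<open>A letter that does not occur may have probability zero under \<open>P\<close> or
    \<open>Q\<close>; its factor is then a zeroth power.\<close>
  proof (cases "?c a = 0")
    case False
    then have "a \<in> set xs" by (metis count_eq_zero_iff set_mset_mset)
    then have "pmf P a > 0" "pmf Q a > 0" using sub by (auto simp: pmf_positive)
    then have "exp (- (?c a * ln (pmf Q a / pmf P a))) = (pmf P a / pmf Q a) ^ ?c a"
      by (simp add: exp_minus exp_of_nat_mult power_divide)
    with \<open>pmf Q a > 0\<close> show ?thesis by (simp add: power_divide)
  next
    case True
    show ?thesis unfolding True by simp
  qed
  then have "(\<Prod>a\<in>UNIV. pmf P a ^ ?c a) = 
      (\<Prod>a\<in>UNIV. pmf Q a ^ ?c a) * exp (\<Sum>a\<in>UNIV. - (?c a * ln (pmf Q a / pmf P a)))"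
    by (simp add: exp_sum prod.distrib)
  moreover have "(\<Sum>a\<in>UNIV. - (?c a * ln (pmf Q a / pmf P a)))
      = - real n * (\<Sum>a\<in>UNIV. pmf (empirical xs) a * ln (pmf Q a / pmf P a))"
    using len by (simp add: pmf_empirical[OF ne] sum_distrib_left sum_negf)
  ultimately show ?thesis
    using len by (simp add: pmf_replicate_pmf prod_list_map_eq_prod_count)
qed

lemma finite_lists_of_length: "finite {xs :: 'a::finite list. length xs = n}"
  using finite_lists_length_eq[of "UNIV :: 'a set" n] by simp

lemma prob_replicate_pmf:
  fixes P :: "'a::finite pmf"
  shows "measure_pmf.prob (replicate_pmf n P) A
    = (\<Sum>xs\<in>{xs. length xs = n \<and> set xs \<subseteq> set_pmf P \<and> xs \<in> A}. pmf (replicate_pmf n P) xs)"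
proof -
  let ?S = "{xs. length xs = n \<and> set xs \<subseteq> set_pmf P \<and> xs \<in> A}"
  have fin: "finite ?S" by (rule finite_subset[OF _ finite_lists_of_length[of n]]) auto
  have "measure_pmf.prob (replicate_pmf n P) A
      = measure_pmf.prob (replicate_pmf n P) (A \<inter> set_pmf (replicate_pmf n P))"
    by (simp add: measure_Int_set_pmf)
  also have "A \<inter> set_pmf (replicate_pmf n P) = ?S"
    by (auto simp: set_replicate_pmf)
  finally show ?thesis using fin by (simp add: measure_measure_pmf_finite)
qed

text \<open>A type is determined by its letter counts, each between 0 and \<open>n\<close>.
  Polynomially many types make a union bound harmless on the exponential scale.\<close>

lemma card_empirical_image:
  "card (empirical ` {xs :: 'a::finite list. length xs = n}) \<le> (n + 1) ^ CARD('a)"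
proof -
  let ?F = "PiE (UNIV :: 'a set) (\<lambda>_. {..n})"
  have "empirical ` {xs :: 'a list. length xs = n}
      \<subseteq> (\<lambda>f. pmf_of_multiset (Abs_multiset f)) ` ?F"
  proof (rule image_subsetI)
    fix xs :: "'a list" assume xs: "xs \<in> {xs. length xs = n}"
    have "count (mset xs) a \<le> n" for a
      using xs count_le_length[of xs a] by (simp add: count_mset)
    then have "count (mset xs) \<in> ?F" by (auto simp: PiE_def extensional_def)
    moreover have "empirical xs = pmf_of_multiset (Abs_multiset (count (mset xs)))"
      by (simp add: empirical_def count_inverse)
    ultimately show "empirical xs \<in> (\<lambda>f. pmf_of_multiset (Abs_multiset f)) ` ?F" by blast
  qed
  then have "card (empirical ` {xs :: 'a list. length xs = n}) \<le> card ?F"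
    by (meson card_image_le card_mono finite_PiE finite_atMost finite_code finite_imageI le_trans)
  then show ?thesis by (simp add: card_PiE)
qed

text \<open>Strings are grouped by type. On the class of type \<open>Q\<close>, changing the measure
  to \<open>Q\<close> itself turns the \<open>P\<close>-mass into
  \<open>exp (- n * rel_entropy Q P)\<close> times a \<open>Q\<close>-probability, which is at most
  1.\<close>

lemma sanov_upper:
  fixes P :: "'a::finite pmf" and E :: "'a pmf \<Rightarrow> bool"
  assumes n: "n > 0"
    and c: "\<And>Q. E Q \<Longrightarrow> set_pmf Q \<subseteq> set_pmf P \<Longrightarrow> c \<le> rel_entropy Q P"
  shows "measure_pmf.prob (replicate_pmf n P) {xs. E (empirical xs)}
     \<le> real (n + 1) ^ CARD('a) * exp (- real n * c)"
proof -
  let ?S = "{xs. length xs = n \<and> set xs \<subseteq> set_pmf P \<and> E (empirical xs)}"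
  have fin: "finite ?S" by (rule finite_subset[OF _ finite_lists_of_length[of n]]) auto
  have "measure_pmf.prob (replicate_pmf n P) {xs. E (empirical xs)}
      = (\<Sum>xs\<in>?S. pmf (replicate_pmf n P) xs)"
    by (simp add: prob_replicate_pmf)
  also have "\<dots> = (\<Sum>Q\<in>empirical ` ?S. \<Sum>xs\<in>{xs\<in>?S. empirical xs = Q}. pmf (replicate_pmf n P) xs)"
    by (rule sum.image_gen[OF fin])
  also have "\<dots> \<le> (\<Sum>Q\<in>empirical ` ?S. exp (- real n * c))"
  proof (rule sum_mono)
    fix Q assume "Q \<in> empirical ` ?S"
    let ?T = "{xs\<in>?S. empirical xs = Q}"
    have finT: "finite ?T" by (rule finite_subset[OF _ fin]) auto
    have "pmf (replicate_pmf n P) xs \<le> exp (- real n * c) * pmf (replicate_pmf n Q) xs" if "xs \<in> ?T" for xs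
    proof -
      have ne: "xs \<noteq> []" using that n by auto
      have Q: "set_pmf Q = set xs" using that set_pmf_empirical[OF ne] by auto
      have "pmf (replicate_pmf n P) xs = pmf (replicate_pmf n Q) xs * exp (- real n * rel_entropy Q P)"
        using change_of_measure[of xs n P Q] that n Q by (simp add: rel_entropy_def)
      moreover have "c \<le> rel_entropy Q P" using that Q by (intro c) auto
      then have "exp (- real n * rel_entropy Q P) \<le> exp (- real n * c)" using n by simp
      ultimately show ?thesis
        by (metis mult.commute mult_right_mono pmf_nonneg)
    qed
    then have "(\<Sum>xs\<in>?T. pmf (replicate_pmf n P) xs)
        \<le> (\<Sum>xs\<in>?T. exp (- real n * c) * pmf (replicate_pmf n Q) xs)"
      by (rule sum_mono)
    also have "\<dots> = exp (- real n * c) * measure_pmf.prob (replicate_pmf n Q) ?T"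
      unfolding measure_measure_pmf_finite[OF finT] sum_distrib_left[symmetric] ..
    also have "\<dots> \<le> exp (- real n * c)" by (simp add: mult_left_le)
    finally show "(\<Sum>xs\<in>?T. pmf (replicate_pmf n P) xs) \<le> exp (- real n * c)" .
  qed
  also have "\<dots> = card (empirical ` ?S) * exp (- real n * c)" by simp
  also have "\<dots> \<le> real (n + 1) ^ CARD('a) * exp (- real n * c)"
  proof (rule mult_right_mono)
    have "card (empirical ` ?S) \<le> card (empirical ` {xs :: 'a list. length xs = n})"
      by (intro card_mono finite_imageI finite_lists_of_length) auto
    also have "\<dots> \<le> (n + 1) ^ CARD('a)" by (rule card_empirical_image)
    finally have "real (card (empirical ` ?S)) \<le> real ((n + 1) ^ CARD('a))"
      by (rule of_nat_mono)
    then show "real (card (empirical ` ?S)) \<le> real (n + 1) ^ CARD('a)"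
      unfolding of_nat_power .
  qed simp
  finally show ?thesis .
qed

lemma map_pmf_count_replicate_pmf:
  "map_pmf (\<lambda>xs. count (mset xs) a) (replicate_pmf n Q) = binomial_pmf n (pmf Q a)"
proof (induction n)
  case 0
  then show ?case by (simp add: binomial_pmf_0 pmf_le_1)
next
  case (Suc n)
  have b: "bernoulli_pmf (pmf Q a) = map_pmf (\<lambda>x. x = a) Q"
  proof (rule pmf_eqI)
    fix i
    have *: "pmf (map_pmf (\<lambda>x. x = a) Q) True = pmf Q a"
      by (simp add: pmf_map vimage_def pmf.rep_eq)
    have **: "pmf (map_pmf (\<lambda>x. x = a) Q) False = 1 - pmf Q a"
      using * pmf_False_conv_True by metis
    show "pmf (bernoulli_pmf (pmf Q a)) i = pmf (map_pmf (\<lambda>x. x = a) Q) i"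
      using * ** by (cases i) (simp_all add: pmf_le_1)
  qed
  show ?case
    by (simp add: binomial_pmf_Suc pmf_le_1 b Suc[symmetric] map_bind_pmf bind_map_pmf)
      (intro bind_pmf_cong refl; auto)
qed

text \<open>Each letter count is binomial, so Hoeffding's inequality applies letter by letter,
  followed by a union bound over the alphabet.\<close>

lemma prob_empirical_dev:
  fixes Q :: "'a::finite pmf"
  assumes "n > 0" "\<delta> \<ge> 0"
  shows "measure_pmf.prob (replicate_pmf n Q) {xs. \<exists>a. \<bar>count (mset xs) a / n - pmf Q a\<bar> \<ge> \<delta>}
    \<le> CARD('a) * (2 * exp (- 2 * real n * \<delta>\<^sup>2))"
proof -
  let ?M = "measure_pmf.prob (replicate_pmf n Q)"
  have "?M {xs. \<exists>a. \<bar>count (mset xs) a / n - pmf Q a\<bar> \<ge> \<delta>}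
      = ?M (\<Union>a\<in>UNIV. {xs. \<bar>count (mset xs) a / n - pmf Q a\<bar> \<ge> \<delta>})"
    by (intro arg_cong[where f = ?M]) auto
  also have "\<dots> \<le> (\<Sum>a\<in>UNIV. ?M {xs. \<bar>count (mset xs) a / n - pmf Q a\<bar> \<ge> \<delta>})"
    by (intro measure_pmf.finite_measure_subadditive_finite) auto
  also have "\<dots> \<le> (\<Sum>a\<in>(UNIV :: 'a set). 2 * exp (- 2 * real n * \<delta>\<^sup>2))"
  proof (rule sum_mono)
    fix a :: 'a
    interpret binomial_distribution n "pmf Q a"
      by unfold_locales (simp add: pmf_le_1)
    have "?M {xs. \<bar>count (mset xs) a / n - pmf Q a\<bar> \<ge> \<delta>}
      = measure_pmf.prob (map_pmf (\<lambda>xs. count (mset xs) a) (replicate_pmf n Q))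
          {x. \<bar>x / n - pmf Q a\<bar> \<ge> \<delta>}"
      by (simp add: vimage_def)
    also have "\<dots> \<le> 2 * exp (- 2 * real n * \<delta>\<^sup>2)"
      unfolding map_pmf_count_replicate_pmf using prob_abs_ge'[of \<delta>] assms by simp
    finally show "?M {xs. \<bar>count (mset xs) a / n - pmf Q a\<bar> \<ge> \<delta>} \<le> 2 * exp (- 2 * real n * \<delta>\<^sup>2)" .
  qed
  also have "\<dots> = CARD('a) * (2 * exp (- 2 * real n * \<delta>\<^sup>2))" by simp
  finally show ?thesis .
qed

text \<open>Under \<open>Q\<close>, strings of type close to \<open>Q\<close> have probability at
  least 1/2. On them the change of measure costs at most \<open>rel_entropy Q P + \<eta> / 2\<close>
  per sample, and the other half of \<eta> absorbs the factor 1/2.\<close>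

lemma sanov_lower:
  fixes P Q :: "'a::finite pmf" and E :: "'a pmf \<Rightarrow> bool"
  assumes sub: "set_pmf Q \<subseteq> set_pmf P" and \<delta>: "\<delta> > 0"
    and E: "\<And>R. set_pmf R \<subseteq> set_pmf P \<Longrightarrow> (\<And>a. \<bar>pmf R a - pmf Q a\<bar> < \<delta>) \<Longrightarrow> E R"
    and \<eta>: "\<eta> > 0"
  shows "\<forall>\<^sub>F n in sequentially. exp (- real n * (rel_entropy Q P + \<eta>))
      \<le> measure_pmf.prob (replicate_pmf n P) {xs. E (empirical xs)}"
proof -
  \<comment> \<open>\<open>K\<close> bounds the effect of a unit error in the type on the exponent;
    the summand 1 keeps it positive when all log-ratios vanish. The tolerance \<open>d\<close> below
    stays within \<delta> and costs at most \<open>\<eta> / 2\<close>.\<close>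
  define K where "K = (\<Sum>a\<in>UNIV. \<bar>ln (pmf Q a / pmf P a)\<bar>) + 1"
  have K: "K > 0" unfolding K_def by (intro add_nonneg_pos sum_nonneg) auto
  define d where "d = min \<delta> (\<eta> / (2 * K))"
  have d: "d > 0" "d \<le> \<delta>" "d * K \<le> \<eta> / 2"
    using \<delta> \<eta> K by (auto simp: d_def min_def field_simps)
  have "(\<lambda>n. exp (-2 * d\<^sup>2 * real n)) \<longlonglongrightarrow> 0"
    using d(1)
    by (intro filterlim_compose[OF exp_at_bot] filterlim_tendsto_neg_mult_at_bot[OF tendsto_const]
        filterlim_real_sequentially) auto
  then have "(\<lambda>n. CARD('a) * (2 * exp (-2 * d\<^sup>2 * real n))) \<longlonglongrightarrow> real CARD('a) * (2 * 0)"
    by (intro tendsto_intros)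
  then have ev1: "\<forall>\<^sub>F n in sequentially. CARD('a) * (2 * exp (-2 * d\<^sup>2 * real n)) < 1 / 2"
    by (rule order_tendstoD) simp
  have "(\<lambda>n. exp (- (\<eta> / 2) * real n)) \<longlonglongrightarrow> 0"
    using \<eta>
    by (intro filterlim_compose[OF exp_at_bot] filterlim_tendsto_neg_mult_at_bot[OF tendsto_const]
        filterlim_real_sequentially) auto
  then have ev2: "\<forall>\<^sub>F n in sequentially. exp (- (\<eta> / 2) * real n) < 1 / 2"
    by (rule order_tendstoD) simp
  show ?thesis
    using ev1 ev2 eventually_gt_at_top[of 0]
  proof eventually_elim
    case (elim n)
    let ?D = "rel_entropy Q P"
    define T where "T = {xs. length xs = n \<and> set xs \<subseteq> set_pmf Q \<and>
        xs \<in> {xs. \<forall>a. \<bar>count (mset xs) a / n - pmf Q a\<bar> < d}}"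
    have fin: "finite T" unfolding T_def
      by (rule finite_subset[OF _ finite_lists_of_length[of n]]) auto
    have "measure_pmf.prob (replicate_pmf n Q) {xs. \<forall>a. \<bar>count (mset xs) a / n - pmf Q a\<bar> < d}
       = 1 - measure_pmf.prob (replicate_pmf n Q) {xs. \<exists>a. \<bar>count (mset xs) a / n - pmf Q a\<bar> \<ge> d}"
      using measure_pmf.prob_compl[of "{xs. \<exists>a. \<bar>count (mset xs) a / n - pmf Q a\<bar> \<ge> d}" "replicate_pmf n Q"]
      by (simp add: Collect_neg_eq[symmetric] not_le Compl_eq_Diff_UNIV[symmetric])
    with prob_empirical_dev[of n d Q] elim d(1)
    have "1 / 2 \<le> measure_pmf.prob (replicate_pmf n Q) {xs. \<forall>a. \<bar>count (mset xs) a / n - pmf Q a\<bar> < d}"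
      by (simp add: mult_ac)
    then have half: "1 / 2 \<le> (\<Sum>xs\<in>T. pmf (replicate_pmf n Q) xs)"
      unfolding T_def prob_replicate_pmf .
    have "exp (- real n * (?D + \<eta>)) = exp (- real n * (?D + \<eta> / 2)) * exp (- (\<eta> / 2) * real n)"
      by (simp add: exp_add[symmetric] field_simps)
    also have "\<dots> \<le> exp (- real n * (?D + \<eta> / 2)) * (\<Sum>xs\<in>T. pmf (replicate_pmf n Q) xs)"
      using half elim by (intro mult_left_mono) auto
    also have "\<dots> = (\<Sum>xs\<in>T. pmf (replicate_pmf n Q) xs * exp (- real n * (?D + \<eta> / 2)))"
      by (subst mult.commute) (rule sum_distrib_right)
    also have "\<dots> \<le> (\<Sum>xs\<in>T. pmf (replicate_pmf n P) xs)"
    proof (rule sum_mono)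
      fix xs assume xs: "xs \<in> T"
      then have ne: "xs \<noteq> []" using elim by (auto simp: T_def)
      have len: "length xs = n" using xs by (simp add: T_def)
      let ?l = "\<lambda>a. ln (pmf Q a / pmf P a)"
      have "(\<Sum>a\<in>UNIV. pmf (empirical xs) a * ?l a) - ?D
          = (\<Sum>a\<in>UNIV. (pmf (empirical xs) a - pmf Q a) * ?l a)"
        by (simp add: rel_entropy_def algebra_simps sum_subtractf)
      also have "\<dots> \<le> (\<Sum>a\<in>UNIV. d * \<bar>?l a\<bar>)"
      proof (rule sum_mono)
        fix a
        have "\<bar>pmf (empirical xs) a - pmf Q a\<bar> \<le> d"
          using xs by (auto simp: T_def pmf_empirical[OF ne] less_imp_le)
        then have "\<bar>(pmf (empirical xs) a - pmf Q a) * ?l a\<bar> \<le> d * \<bar>?l a\<bar>"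
          unfolding abs_mult by (rule mult_right_mono) simp
        then show "(pmf (empirical xs) a - pmf Q a) * ?l a \<le> d * \<bar>?l a\<bar>"
          by linarith
      qed
      also have "\<dots> \<le> \<eta> / 2"
        using d K unfolding K_def by (simp add: sum_distrib_left[symmetric] algebra_simps)
      finally have "exp (- real n * (?D + \<eta> / 2)) \<le> exp (- real n * (\<Sum>a\<in>UNIV. pmf (empirical xs) a * ?l a))"
        by (simp add: mult_left_mono)
      then have "pmf (replicate_pmf n Q) xs * exp (- real n * (?D + \<eta> / 2))
        \<le> pmf (replicate_pmf n Q) xs * exp (- real n * (\<Sum>a\<in>UNIV. pmf (empirical xs) a * ?l a))"
        by (simp add: mult_left_mono)
      also have "\<dots> = pmf (replicate_pmf n P) xs"
        using change_of_measure[of xs n P Q] xs elim sub by (auto simp: T_def)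
      finally show "pmf (replicate_pmf n Q) xs * exp (- real n * (?D + \<eta> / 2)) \<le> pmf (replicate_pmf n P) xs" .
    qed
    also have "\<dots> \<le> (\<Sum>xs\<in>{xs. length xs = n \<and> set xs \<subseteq> set_pmf P \<and> xs \<in> {xs. E (empirical xs)}}.
        pmf (replicate_pmf n P) xs)"
    proof (rule sum_mono2)
      show "finite {xs. length xs = n \<and> set xs \<subseteq> set_pmf P \<and> xs \<in> {xs. E (empirical xs)}}"
        by (rule finite_subset[OF _ finite_lists_of_length[of n]]) auto
      show "T \<subseteq> {xs. length xs = n \<and> set xs \<subseteq> set_pmf P \<and> xs \<in> {xs. E (empirical xs)}}"
      proof
        fix xs assume xs: "xs \<in> T"
        then have ne: "xs \<noteq> []" using elim by (auto simp: T_def)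
        have "E (empirical xs)"
        proof (rule E)
          show "set_pmf (empirical xs) \<subseteq> set_pmf P"
            using xs sub by (auto simp: set_pmf_empirical[OF ne] T_def)
          show "\<bar>pmf (empirical xs) a - pmf Q a\<bar> < \<delta>" for a
            using xs d(2) by (auto simp: T_def pmf_empirical[OF ne] intro: less_le_trans)
        qed
        then show "xs \<in> {xs. length xs = n \<and> set xs \<subseteq> set_pmf P \<and> xs \<in> {xs. E (empirical xs)}}"
          using xs sub by (auto simp: T_def)
      qed
    qed simp
    also have "\<dots> = measure_pmf.prob (replicate_pmf n P) {xs. E (empirical xs)}"
      by (simp add: prob_replicate_pmf)
    finally show ?case by simp
  qed
qed

subsection \<open>Quadratic behaviour of the relative entropy\<close>

definition prob_vec :: "('a::finite) pmf \<Rightarrow> real^'a" where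
  "prob_vec Q = (\<chi> a. pmf Q a)"

definition normalized_dev :: "('a::finite) pmf \<Rightarrow> 'a pmf \<Rightarrow> real^'a" where
  "normalized_dev P Q = (\<chi> a. (pmf Q a - pmf P a) / sqrt (pmf P a))"

lemma norm_vec_squared: "(norm (v :: real^'n))\<^sup>2 = (\<Sum>a\<in>UNIV. (v $ a)\<^sup>2)"
  unfolding power2_norm_eq_inner by (simp add: inner_vec_def power2_eq_square)

text \<open>The added terms sum to zero, since both distributions have mass one. They make every
  summand nonnegative and quadratic near ratio 1, so that bounds can be proved letter by
  letter.\<close>

lemma rel_entropy_alt:
  fixes P Q :: "'a::finite pmf"
  assumes "set_pmf Q \<subseteq> set_pmf P"
  shows "rel_entropy Q P = (\<Sum>a\<in>UNIV. pmf P a *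
    (pmf Q a / pmf P a * ln (pmf Q a / pmf P a) - pmf Q a / pmf P a + 1))"
proof -
  have z: "pmf Q a = 0" if "pmf P a = 0" for a
    using assms that by (auto simp: set_pmf_iff)
  have "rel_entropy Q P = (\<Sum>a\<in>UNIV. pmf Q a * ln (pmf Q a / pmf P a)) - (\<Sum>a\<in>UNIV. pmf Q a) + (\<Sum>a\<in>UNIV. pmf P a)"
    by (simp add: rel_entropy_def sum_pmf_eq_1)
  also have "\<dots> = (\<Sum>a\<in>UNIV. pmf Q a * ln (pmf Q a / pmf P a) - pmf Q a + pmf P a)"
    by (simp add: sum.distrib sum_subtractf)
  also have "\<dots> = (\<Sum>a\<in>UNIV. pmf P a *
    (pmf Q a / pmf P a * ln (pmf Q a / pmf P a) - pmf Q a / pmf P a + 1))"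
    by (intro sum.cong refl) (use z in \<open>auto simp: algebra_simps\<close>)
  finally show ?thesis .
qed

text \<open>This is \<open>ln u \<le> u - 1\<close> at \<open>u = 1 / sqrt t\<close>. Averaged over
  \<open>P\<close>, it bounds the relative entropy below by the squared Hellinger distance.\<close>

lemma entropy_kernel_ge:
  fixes t :: real
  assumes "t \<ge> 0"
  shows "(sqrt t - 1)\<^sup>2 \<le> t * ln t - t + 1"
proof (cases "t = 0")
  case False
  with assms have t: "t > 0" by simp
  have "ln (1 / sqrt t) \<le> 1 / sqrt t - 1" using t by (intro ln_le_minus_one) simp
  then have "- (ln t / 2) \<le> 1 / sqrt t - 1" using t by (simp add: ln_div ln_sqrt)
  then have "t * (2 - 2 / sqrt t) \<le> t * ln t" using t by (intro mult_left_mono) auto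
  moreover have "t * (2 - 2 / sqrt t) = 2 * t - 2 * (t / sqrt t)"
    by (simp add: algebra_simps)
  then have "t * (2 - 2 / sqrt t) = 2 * t - 2 * sqrt t"
    using t by (simp only: real_div_sqrt)
  ultimately show ?thesis using t by (simp add: power2_diff)
qed simp

text \<open>A weak form of Pinsker's inequality, obtained through the Hellinger distance:
  \<open>sqrt q + sqrt p \<le> 2\<close> gives the constant 1/4. It serves to localise: small
  relative entropy forces \<open>Q\<close> close to \<open>P\<close>.\<close>

lemma rel_entropy_ge_dist:
  fixes P Q :: "'a::finite pmf"
  assumes "set_pmf Q \<subseteq> set_pmf P"
  shows "(norm (prob_vec Q - prob_vec P))\<^sup>2 / 4 \<le> rel_entropy Q P"
proof -
  have "(pmf Q a - pmf P a)\<^sup>2 / 4 \<le> pmf P a *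
    (pmf Q a / pmf P a * ln (pmf Q a / pmf P a) - pmf Q a / pmf P a + 1)" for a
  proof (cases "pmf P a = 0")
    case True
    then have "pmf Q a = 0" using assms by (auto simp: set_pmf_iff)
    with True show ?thesis by simp
  next
    case False
    then have p: "pmf P a > 0" by (simp add: pmf_positive set_pmf_iff)
    let ?p = "pmf P a" and ?q = "pmf Q a"
    have "(?q - ?p)\<^sup>2 = ((sqrt ?q - sqrt ?p) * (sqrt ?q + sqrt ?p))\<^sup>2"
      by (simp add: algebra_simps)
    also have "\<dots> = (sqrt ?q - sqrt ?p)\<^sup>2 * (sqrt ?q + sqrt ?p)\<^sup>2"
      by (simp add: power_mult_distrib)
    also have "\<dots> \<le> (sqrt ?q - sqrt ?p)\<^sup>2 * 2\<^sup>2"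
    proof (intro mult_left_mono power_mono)
      show "sqrt ?q + sqrt ?p \<le> 2"
        using real_sqrt_le_mono[OF pmf_le_1[of Q a]] real_sqrt_le_mono[OF pmf_le_1[of P a]]
        unfolding real_sqrt_one by linarith
    qed auto
    also have "(sqrt ?q - sqrt ?p)\<^sup>2 = ?p * (sqrt (?q / ?p) - 1)\<^sup>2"
    proof -
      have "sqrt ?q - sqrt ?p = sqrt ?p * (sqrt (?q / ?p) - 1)"
        using p by (simp add: real_sqrt_divide algebra_simps)
      then show ?thesis using p by (simp add: power_mult_distrib)
    qed
    also have "?p * (sqrt (?q / ?p) - 1)\<^sup>2 * 2\<^sup>2 \<le> ?p * (?q / ?p * ln (?q / ?p) - ?q / ?p + 1) * 2\<^sup>2"
      by (intro mult_right_mono mult_left_mono entropy_kernel_ge) auto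
    finally show ?thesis by simp
  qed
  then show ?thesis
    unfolding rel_entropy_alt[OF assms] norm_vec_squared sum_divide_distrib
    by (intro sum_mono) (simp add: prob_vec_def)
qed

lemma entropy_kernel_local:
  fixes \<eta> :: real
  assumes "\<eta> > 0"
  obtains r where "r > 0" "\<And>s. \<bar>s\<bar> < r \<Longrightarrow> \<bar>((1 + s) * ln (1 + s) - (1 + s) + 1) - s\<^sup>2 / 2\<bar> \<le> \<eta> * s\<^sup>2"
proof -
  have "((\<lambda>s::real. ((1 + s) * ln (1 + s) - (1 + s) + 1) / s\<^sup>2) \<longlongrightarrow> 1 / 2) (at 0)"
    by real_asymp
  then have "\<forall>\<^sub>F s::real in at 0. dist (((1 + s) * ln (1 + s) - (1 + s) + 1) / s\<^sup>2) (1 / 2) < \<eta>"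
    using assms by (rule tendstoD)
  then obtain r where r: "r > 0" "\<And>s. s \<noteq> 0 \<Longrightarrow> \<bar>s\<bar> < r \<Longrightarrow>
      \<bar>((1 + s) * ln (1 + s) - (1 + s) + 1) / s\<^sup>2 - 1 / 2\<bar> < \<eta>"
    by (auto simp: eventually_at dist_real_def)
  have "\<bar>((1 + s) * ln (1 + s) - (1 + s) + 1) - s\<^sup>2 / 2\<bar> \<le> \<eta> * s\<^sup>2" if "\<bar>s\<bar> < r" for s
  proof (cases "s = 0")
    case False
    let ?k = "(1 + s) * ln (1 + s) - (1 + s) + 1"
    have "?k - s\<^sup>2 / 2 = (?k / s\<^sup>2 - 1 / 2) * s\<^sup>2"
      using False by (simp add: field_simps)
    then have "\<bar>?k - s\<^sup>2 / 2\<bar> = \<bar>?k / s\<^sup>2 - 1 / 2\<bar> * s\<^sup>2" by (simp add: abs_mult)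
    also have "\<dots> \<le> \<eta> * s\<^sup>2" using r(2)[OF False that] by (intro mult_right_mono) auto
    finally show ?thesis .
  qed simp
  with r(1) that show ?thesis by blast
qed

lemma sqrt_pmf_bounded_below:
  fixes P :: "'a::finite pmf"
  obtains m where "m > 0" "\<And>a. a \<in> set_pmf P \<Longrightarrow> m \<le> sqrt (pmf P a)"
proof
  show "Min ((\<lambda>a. sqrt (pmf P a)) ` set_pmf P) > 0"
    by (auto simp: set_pmf_not_empty pmf_positive)
  show "Min ((\<lambda>a. sqrt (pmf P a)) ` set_pmf P) \<le> sqrt (pmf P a)" if "a \<in> set_pmf P" for a
    using that by (intro Min_le) auto
qed

lemma rel_entropy_local:
  fixes P :: "'a::finite pmf"
  assumes "\<eta> > 0"
  obtains \<rho> where "\<rho> > 0"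
    "\<And>Q. set_pmf Q \<subseteq> set_pmf P \<Longrightarrow> norm (normalized_dev P Q) < \<rho> \<Longrightarrow>
      \<bar>rel_entropy Q P - (norm (normalized_dev P Q))\<^sup>2 / 2\<bar> \<le> \<eta> * (norm (normalized_dev P Q))\<^sup>2"
proof -
  obtain r where r: "r > 0" "\<And>s. \<bar>s\<bar> < r \<Longrightarrow>
      \<bar>((1 + s) * ln (1 + s) - (1 + s) + 1) - s\<^sup>2 / 2\<bar> \<le> \<eta> * s\<^sup>2"
    using entropy_kernel_local[OF assms] by blast
  obtain m where m: "m > 0" and m_le: "\<And>a. a \<in> set_pmf P \<Longrightarrow> m \<le> sqrt (pmf P a)"
    using sqrt_pmf_bounded_below by blast
  show ?thesis
  \<comment> \<open>The kernel is evaluated at \<open>1 + s\<close> with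
    \<open>s = v $ a / sqrt (pmf P a)\<close>; norm below \<open>r * m\<close> keeps every such
    \<open>s\<close> below \<open>r\<close> in absolute value.\<close>
  proof (rule that[of "r * m"])
    fix Q assume Q: "set_pmf Q \<subseteq> set_pmf P" and n: "norm (normalized_dev P Q) < r * m"
    let ?v = "normalized_dev P Q"
    have "\<bar>pmf P a * (pmf Q a / pmf P a * ln (pmf Q a / pmf P a) - pmf Q a / pmf P a + 1) - (?v $ a)\<^sup>2 / 2\<bar>
       \<le> \<eta> * (?v $ a)\<^sup>2" for a
    proof (cases "a \<in> set_pmf P")
      case False
      then have "pmf Q a = 0" "pmf P a = 0" using Q by (auto simp: set_pmf_iff)
      then show ?thesis by (simp add: normalized_dev_def)
    next
      case True
      then have p: "pmf P a > 0" by (simp add: pmf_positive)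
      define s where "s = ?v $ a / sqrt (pmf P a)"
      have q: "pmf Q a / pmf P a = 1 + s"
        using p by (simp add: s_def normalized_dev_def field_simps)
      have v2: "(?v $ a)\<^sup>2 = pmf P a * s\<^sup>2" using p by (simp add: s_def power_divide)
      have "\<bar>?v $ a\<bar> < r * m" using component_le_norm_cart[of ?v a] n by simp
      also have "r * m \<le> r * sqrt (pmf P a)" using r m_le[OF True] by simp
      finally have "\<bar>s\<bar> < r" using p by (simp add: s_def field_simps)
      from r(2)[OF this] have "pmf P a * \<bar>((1 + s) * ln (1 + s) - (1 + s) + 1) - s\<^sup>2 / 2\<bar> \<le> pmf P a * (\<eta> * s\<^sup>2)"
        by (rule mult_left_mono) simp
      moreover have "pmf P a * ((1 + s) * ln (1 + s) - (1 + s) + 1) - pmf P a * s\<^sup>2 / 2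
        = pmf P a * (((1 + s) * ln (1 + s) - (1 + s) + 1) - s\<^sup>2 / 2)"
        by (simp only: right_diff_distrib times_divide_eq_right)
      then have "\<bar>pmf P a * ((1 + s) * ln (1 + s) - (1 + s) + 1) - pmf P a * s\<^sup>2 / 2\<bar>
        = pmf P a * \<bar>((1 + s) * ln (1 + s) - (1 + s) + 1) - s\<^sup>2 / 2\<bar>"
        by (simp only: abs_mult abs_of_nonneg pmf_nonneg)
      ultimately show ?thesis unfolding q v2 by (simp only: mult.left_commute)
    qed
    then have "(\<Sum>a\<in>UNIV. \<bar>pmf P a * (pmf Q a / pmf P a * ln (pmf Q a / pmf P a) - pmf Q a / pmf P a + 1) - (?v $ a)\<^sup>2 / 2\<bar>)
       \<le> (\<Sum>a\<in>UNIV. \<eta> * (?v $ a)\<^sup>2)"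
      by (rule sum_mono)
    then have "\<bar>\<Sum>a\<in>UNIV. pmf P a * (pmf Q a / pmf P a * ln (pmf Q a / pmf P a) - pmf Q a / pmf P a + 1) - (?v $ a)\<^sup>2 / 2\<bar>
       \<le> (\<Sum>a\<in>UNIV. \<eta> * (?v $ a)\<^sup>2)"
      by (rule order_trans[OF sum_abs])
    then show "\<bar>rel_entropy Q P - (norm ?v)\<^sup>2 / 2\<bar> \<le> \<eta> * (norm ?v)\<^sup>2"
      unfolding rel_entropy_alt[OF Q] norm_vec_squared
      by (simp only: sum_subtractf sum_distrib_left sum_divide_distrib)
  qed (use r m in auto)
qed

section \<open>From exponential bounds to the limit of normalised logarithms\<close>

lemma ln_prob_limit:
  fixes p :: "nat \<Rightarrow> real" and I :: real and m :: nat
  assumes ub: "\<And>n. n > 0 \<Longrightarrow> p n \<le> real (n + 1) ^ m * exp (- real n * I)"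
    and lb: "\<And>\<eta>. \<eta> > 0 \<Longrightarrow> \<forall>\<^sub>F n in sequentially. exp (- real n * (I + \<eta>)) \<le> p n"
  shows "(\<lambda>n. ln_prob (p n) / ereal (real n)) \<longlonglongrightarrow> ereal (- I)"
proof -
  \<comment> \<open>Eventual positivity lets \<open>ln_prob\<close> be replaced by the real
    logarithm.\<close>
  have ev: "\<forall>\<^sub>F n in sequentially. 0 < n \<and> 0 < p n"
    using lb[of 1, OF zero_less_one] eventually_gt_at_top[of 0]
    by eventually_elim (use exp_gt_zero less_le_trans in blast)
  have "(\<lambda>n. ln (p n) / real n) \<longlonglongrightarrow> - I"
  proof (rule tendstoI)
    fix e :: real assume e: "e > 0"
    have "(\<lambda>n. real m * ln (real (n + 1)) / real n) \<longlonglongrightarrow> 0" by real_asymp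
    then have "\<forall>\<^sub>F n in sequentially. real m * ln (real (n + 1)) / real n < e"
      using e by (rule order_tendstoD)
    moreover have "\<forall>\<^sub>F n in sequentially. exp (- real n * (I + e / 2)) \<le> p n"
      using e by (intro lb) simp
    ultimately show "\<forall>\<^sub>F n in sequentially. dist (ln (p n) / real n) (- I) < e"
      using ev
    proof eventually_elim
      case (elim n)
      then have n: "real n > 0" and p: "p n > 0" by auto
      have "- real n * (I + e / 2) \<le> ln (p n)"
        using elim p by (simp add: ln_ge_iff)
      then have "- (I + e / 2) \<le> ln (p n) / real n"
        unfolding pos_le_divide_eq[OF n] by (simp add: algebra_simps)
      moreover have "ln (p n) \<le> ln (real (n + 1) ^ m * exp (- real n * I))"
        using ub[of n] elim p by (intro ln_mono) auto
      then have "ln (p n) \<le> real m * ln (real (n + 1)) - real n * I"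
        by (simp add: ln_mult ln_realpow)
      then have "ln (p n) / real n \<le> (real m * ln (real (n + 1)) - real n * I) / real n"
        using n by (intro divide_right_mono) auto
      then have "ln (p n) / real n \<le> real m * ln (real (n + 1)) / real n - I"
        using n by (simp add: diff_divide_distrib)
      ultimately show ?case using elim(1) e unfolding dist_real_def by linarith
    qed
  qed
  then have "(\<lambda>n. ereal (ln (p n) / real n)) \<longlonglongrightarrow> ereal (- I)" by simp
  then show ?thesis
  proof (rule Lim_transform_eventually)
    show "\<forall>\<^sub>F n in sequentially. ereal (ln (p n) / real n) = ln_prob (p n) / ereal (real n)"
      using ev by eventually_elim (simp add: ln_prob_def)
  qed
qed

text \<open>Openness is available only near \<open>P\<close>. The point \<open>Q\<^sub>0\<close>
  makes the infimum smaller than \<open>\<rho>\<^sup>2 / 4\<close>, so by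
  \<open>rel_entropy_ge_dist\<close> near-minimisers lie in the ball of radius \<rho>, where the
  lower bound applies. It also makes the infimum one over a nonempty set.\<close>

lemma sanov_limit:
  fixes P :: "'a::finite pmf" and E :: "'a pmf \<Rightarrow> bool" and \<rho> :: real
  assumes "\<rho> > 0"
    and opn: "\<And>Q. E Q \<Longrightarrow> norm (prob_vec Q - prob_vec P) < \<rho> \<Longrightarrow>
       \<exists>\<delta>>0. \<forall>R. (\<forall>a. \<bar>pmf R a - pmf Q a\<bar> < \<delta>) \<longrightarrow> E R"
    and Q\<^sub>0: "E Q\<^sub>0" "set_pmf Q\<^sub>0 \<subseteq> set_pmf P" "rel_entropy Q\<^sub>0 P < \<rho>\<^sup>2 / 4"
  shows "(\<lambda>n. ln_prob (measure_pmf.prob (replicate_pmf n P) {xs. E (empirical xs)}) / ereal (real n))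
     \<longlonglongrightarrow> ereal (- (INF Q\<in>{Q. E Q \<and> set_pmf Q \<subseteq> set_pmf P}. rel_entropy Q P))"
proof (rule ln_prob_limit)
  let ?S = "{Q. E Q \<and> set_pmf Q \<subseteq> set_pmf P}"
  let ?I = "INF Q\<in>?S. rel_entropy Q P"
  have nonneg: "0 \<le> rel_entropy Q P" if "set_pmf Q \<subseteq> set_pmf P" for Q
    using rel_entropy_ge_dist[OF that] by (rule order_trans[rotated]) simp
  have bdd: "bdd_below ((\<lambda>Q. rel_entropy Q P) ` ?S)"
    using nonneg by (intro bdd_belowI2[of _ 0]) auto
  show "measure_pmf.prob (replicate_pmf n P) {xs. E (empirical xs)}
      \<le> real (n + 1) ^ CARD('a) * exp (- real n * ?I)" if "n > 0" for n
    by (rule sanov_upper[OF that]) (intro cINF_lower bdd, simp)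
  fix \<eta> :: real assume \<eta>: "\<eta> > 0"
  have "?I \<le> rel_entropy Q\<^sub>0 P" using Q\<^sub>0 by (intro cINF_lower bdd) simp
  then have "?I < min (?I + \<eta> / 2) (\<rho>\<^sup>2 / 4)" using Q\<^sub>0 \<eta> by simp
  moreover have "?S \<noteq> {}" using Q\<^sub>0 by auto
  ultimately obtain Q where Q: "Q \<in> ?S" "rel_entropy Q P < min (?I + \<eta> / 2) (\<rho>\<^sup>2 / 4)"
    using cINF_less_iff[OF _ bdd] by blast
  then have sub: "set_pmf Q \<subseteq> set_pmf P" by simp
  have "(norm (prob_vec Q - prob_vec P))\<^sup>2 < \<rho>\<^sup>2"
    using rel_entropy_ge_dist[OF sub] Q by simp
  then have "norm (prob_vec Q - prob_vec P) < \<rho>"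
    using \<open>\<rho> > 0\<close> by (simp add: power_less_imp_less_base)
  then obtain \<delta> where \<delta>: "\<delta> > 0" "\<And>R. (\<forall>a. \<bar>pmf R a - pmf Q a\<bar> < \<delta>) \<Longrightarrow> E R"
    using opn[of Q] Q by auto
  have "\<forall>\<^sub>F n in sequentially. exp (- real n * (rel_entropy Q P + \<eta> / 2))
      \<le> measure_pmf.prob (replicate_pmf n P) {xs. E (empirical xs)}"
    using \<delta> \<eta> by (intro sanov_lower[OF sub \<delta>(1)]) auto
  then show "\<forall>\<^sub>F n in sequentially. exp (- real n * (?I + \<eta>))
      \<le> measure_pmf.prob (replicate_pmf n P) {xs. E (empirical xs)}"
  proof eventually_elim
    case (elim n)
    have "rel_entropy Q P + \<eta> / 2 \<le> ?I + \<eta>" using Q by simp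
    then have "real n * (rel_entropy Q P + \<eta> / 2) \<le> real n * (?I + \<eta>)" by (rule mult_left_mono) simp
    then have "exp (- real n * (?I + \<eta>)) \<le> exp (- real n * (rel_entropy Q P + \<eta> / 2))" by simp
    with elim show ?case by linarith
  qed
qed

subsection \<open>Spectral projections of symmetric matrices\<close>

definition outer :: "real^'n \<Rightarrow> real^'m \<Rightarrow> real^'m^'n" where
  "outer u v = (\<chi> a b. u $ a * v $ b)"

definition orthonormal_family :: "(nat \<Rightarrow> real^'n) \<Rightarrow> bool" where
  "orthonormal_family \<phi> \<longleftrightarrow>
    (\<forall>i\<in>{1..CARD('n)}. \<forall>j\<in>{1..CARD('n)}. \<phi> i \<bullet> \<phi> j = (if i = j then 1 else 0))"

text \<open>Symmetry of \<open>A\<close> is a consequence of the orthonormal eigenbasis, see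
  \<open>eigen_system_sym\<close>. Eigenvalues may be tied, and their eigenvectors are any fixed
  choice.\<close>

definition eigen_system :: "real^'n^'n \<Rightarrow> (nat \<Rightarrow> real) \<Rightarrow> (nat \<Rightarrow> real^'n) \<Rightarrow> bool" where
  "eigen_system A \<kappa> \<phi> \<longleftrightarrow> orthonormal_family \<phi> \<and>
    (\<forall>i\<in>{1..CARD('n)}. \<forall>j\<in>{1..CARD('n)}. i \<le> j \<longrightarrow> \<kappa> j \<le> \<kappa> i) \<and>
    (\<forall>i\<in>{1..CARD('n)}. A *v \<phi> i = \<kappa> i *\<^sub>R \<phi> i)"

text \<open>For orthonormal vectors this is the orthogonal projection onto their span, hence
  insensitive to signs and to rotations inside a tied block.\<close>

definition proj :: "nat \<Rightarrow> (nat \<Rightarrow> real^'n) \<Rightarrow> real^'n^'n" where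
  "proj k \<phi> = (\<Sum>i\<in>{1..k}. outer (\<phi> i) (\<phi> i))"

text \<open>The inner product of nested vectors is the trace inner product and \<open>norm\<close>
  the Frobenius norm, so \<open>A \<bullet> proj k \<phi>\<close> is the trace of \<open>A\<close>
  against the projection.\<close>

lemma inner_outer: "A \<bullet> outer u v = u \<bullet> (A *v v)"
  by (simp add: inner_vec_def outer_def matrix_vector_mult_def sum_distrib_left mult_ac)

lemma outer_mult_vec: "outer u v *v w = (v \<bullet> w) *\<^sub>R u"
  by (simp add: vec_eq_iff outer_def matrix_vector_mult_def inner_vec_def sum_distrib_right sum_distrib_left mult_ac)

lemma sum_mult_vec: "(\<Sum>i\<in>I. A i) *v (w :: real^'n) = (\<Sum>i\<in>I. A i *v w)"
  by (induction I rule: infinite_finite_induct) (auto simp: matrix_vector_mult_add_rdistrib)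

lemma proj_mult_vec: "proj k \<phi> *v w = (\<Sum>i\<in>{1..k}. (\<phi> i \<bullet> w) *\<^sub>R \<phi> i)"
  by (simp add: proj_def sum_mult_vec outer_mult_vec)

lemma inner_proj: "A \<bullet> proj k \<phi> = (\<Sum>i\<in>{1..k}. \<phi> i \<bullet> (A *v \<phi> i))"
  by (simp add: proj_def inner_sum_right inner_outer)

lemma norm_outer: "norm (outer u v) = norm u * norm v"
proof -
  have "outer u v \<bullet> outer u v = (u \<bullet> u) * (v \<bullet> v)"
    by (simp add: inner_outer outer_mult_vec)
  then show ?thesis
    by (simp add: norm_eq_sqrt_inner real_sqrt_mult)
qed

lemma norm_mult_vec_le: "norm (A *v v) \<le> norm A * norm (v :: real^'n)"
proof (cases "A *v v = 0")
  case False
  have "(norm (A *v v))\<^sup>2 = A \<bullet> outer (A *v v) v"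
    by (simp add: inner_outer power2_norm_eq_inner)
  also have "\<dots> \<le> norm A * (norm (A *v v) * norm v)"
    by (metis norm_cauchy_schwarz norm_outer)
  finally have "norm (A *v v) * norm (A *v v) \<le> norm (A *v v) * (norm A * norm v)"
    by (simp add: power2_eq_square mult_ac)
  with False show ?thesis by simp
qed simp

text \<open>The family spans by cardinality. The residual is orthogonal to the family, hence to
  itself.\<close>

lemma orthonormal_expand:
  fixes \<phi> :: "nat \<Rightarrow> real^'n"
  assumes "orthonormal_family \<phi>"
  shows "(\<Sum>i\<in>{1..CARD('n)}. (\<phi> i \<bullet> u) *\<^sub>R \<phi> i) = u"
proof -
  let ?I = "{1..CARD('n)}"
  have on: "\<phi> i \<bullet> \<phi> j = (if i = j then 1 else 0)" if "i \<in> ?I" "j \<in> ?I" for i j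
    using assms that by (auto simp: orthonormal_family_def)
  have inj: "inj_on \<phi> ?I"
  proof (rule inj_onI)
    fix i j assume "i \<in> ?I" "j \<in> ?I" "\<phi> i = \<phi> j"
    then show "i = j" using on[of i j] on[of i i] by (auto split: if_splits)
  qed
  have "independent (\<phi> ` ?I)"
  proof (rule pairwise_orthogonal_independent)
    show "pairwise orthogonal (\<phi> ` ?I)"
      by (auto simp: pairwise_def orthogonal_def on)
    show "0 \<notin> \<phi> ` ?I" using on by fastforce
  qed
  moreover have "card (\<phi> ` ?I) = DIM(real^'n)" using inj by (simp add: card_image)
  ultimately have "span (\<phi> ` ?I) = UNIV"
    using card_eq_dim[of "\<phi> ` ?I" UNIV] by (auto simp: dim_UNIV)
  then have sp: "w \<in> span (\<phi> ` ?I)" for w by simp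
  define w where "w = u - (\<Sum>i\<in>?I. (\<phi> i \<bullet> u) *\<^sub>R \<phi> i)"
  have "w \<bullet> \<phi> j = 0" if "j \<in> ?I" for j
  proof -
    have "(\<Sum>i\<in>?I. (\<phi> i \<bullet> u) * (\<phi> i \<bullet> \<phi> j)) = (\<Sum>i\<in>?I. (if i = j then \<phi> i \<bullet> u else 0))"
      using that by (intro sum.cong) (auto simp: on)
    then show ?thesis using that
      by (simp add: w_def inner_diff_left inner_sum_left inner_commute[of "\<phi> j" u] del: One_nat_def)
  qed
  then have "orthogonal w x" if "x \<in> \<phi> ` ?I" for x
    using that by (auto simp: orthogonal_def)
  then have "orthogonal w w" using sp[of w] orthogonal_to_span by blast
  then show ?thesis by (simp add: orthogonal_def w_def)
qed

lemma parseval: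
  fixes \<phi> :: "nat \<Rightarrow> real^'n"
  assumes "orthonormal_family \<phi>"
  shows "(\<Sum>i\<in>{1..CARD('n)}. (\<phi> i \<bullet> u) * (\<phi> i \<bullet> v)) = u \<bullet> v"
proof -
  have "(\<Sum>i\<in>{1..CARD('n)}. (\<phi> i \<bullet> u) *\<^sub>R \<phi> i) \<bullet> v = u \<bullet> v"
    by (simp only: orthonormal_expand[OF assms])
  then show ?thesis by (simp add: inner_sum_left)
qed

lemma orthonormalD:
  fixes \<phi> :: "nat \<Rightarrow> real^'n"
  assumes "orthonormal_family \<phi>" "i \<in> {1..CARD('n)}" "j \<in> {1..CARD('n)}"
  shows "\<phi> i \<bullet> \<phi> j = (if i = j then 1 else 0)"
  using assms by (auto simp: orthonormal_family_def)

lemma eigen_system_mult_vec: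
  fixes A :: "real^'n^'n"
  assumes "eigen_system A \<kappa> \<phi>"
  shows "A *v v = (\<Sum>a\<in>{1..CARD('n)}. (\<kappa> a * (\<phi> a \<bullet> v)) *\<^sub>R \<phi> a)"
proof -
  have "A *v v = A *v (\<Sum>a\<in>{1..CARD('n)}. (\<phi> a \<bullet> v) *\<^sub>R \<phi> a)"
    using assms by (simp add: eigen_system_def orthonormal_expand del: One_nat_def)
  also have "\<dots> = (\<Sum>a\<in>{1..CARD('n)}. (\<phi> a \<bullet> v) *\<^sub>R (A *v \<phi> a))"
    by (simp add: linear_sum matrix_vector_mult_scaleR)
  also have "\<dots> = (\<Sum>a\<in>{1..CARD('n)}. (\<kappa> a * (\<phi> a \<bullet> v)) *\<^sub>R \<phi> a)"
    using assms by (intro sum.cong) (auto simp: eigen_system_def mult.commute)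
  finally show ?thesis .
qed

lemma eigen_system_inner:
  fixes A :: "real^'n^'n"
  assumes "eigen_system A \<kappa> \<phi>"
  shows "u \<bullet> (A *v v) = (\<Sum>a\<in>{1..CARD('n)}. \<kappa> a * (\<phi> a \<bullet> u) * (\<phi> a \<bullet> v))"
  by (simp add: eigen_system_mult_vec[OF assms] inner_sum_right inner_commute mult_ac)

lemma eigen_system_sym:
  assumes "eigen_system A \<kappa> \<phi>"
  shows "u \<bullet> (A *v v) = (A *v u) \<bullet> v"
  by (subst inner_commute[of "A *v u"]) (simp add: eigen_system_inner[OF assms] mult_ac)

section \<open>Ky Fan's maximum principle with quadratic growth, and perturbation bounds\<close>

lemma proj_inner_proj: "proj m \<phi> \<bullet> proj m \<psi> = (\<Sum>a\<in>{1..m}. \<Sum>i\<in>{1..m}. (\<phi> a \<bullet> \<psi> i)\<^sup>2)"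
  by (subst sum.swap)
    (simp add: inner_proj proj_mult_vec inner_sum_right power2_eq_square inner_commute)

lemma proj_self:
  fixes \<phi> :: "nat \<Rightarrow> real^'n"
  assumes "orthonormal_family \<phi>" "m \<le> CARD('n)"
  shows "proj m \<phi> \<bullet> proj m \<phi> = m"
proof -
  have "proj m \<phi> \<bullet> proj m \<phi> = (\<Sum>a\<in>{1..m}. \<Sum>i\<in>{1..m}. if a = i then 1 else 0)"
    unfolding proj_inner_proj using assms(2)
    by (intro sum.cong) (auto simp: orthonormalD[OF assms(1)])
  then show ?thesis by simp
qed

lemma norm_proj:
  fixes \<phi> :: "nat \<Rightarrow> real^'n"
  assumes "orthonormal_family \<phi>" "m \<le> CARD('n)"
  shows "norm (proj m \<phi>) \<le> CARD('n)"
proof -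
  have "norm (proj m \<phi>) = sqrt m"
    by (simp add: norm_eq_sqrt_inner proj_self[OF assms])
  also have "\<dots> \<le> sqrt ((real CARD('n))\<^sup>2)"
  proof (rule real_sqrt_le_mono)
    have "real m \<le> real CARD('n)" using assms by simp
    also have "\<dots> \<le> (real CARD('n))\<^sup>2"
      by (rule self_le_power) (simp_all add: Suc_le_eq)
    finally show "real m \<le> (real CARD('n))\<^sup>2" .
  qed
  finally show ?thesis by simp
qed

text \<open>Let \<open>w a\<close> be the share of \<open>\<phi> a\<close> captured by the
  \<psi>-block; it lies in [0,1] and the shares sum to \<open>m\<close>. The mass lost on the top
  indices equals the mass gained on the others, and both are half the squared distance of the
  projections. Lost mass costs at least \<open>s\<close> per unit, gained mass returns at most
  \<open>t\<close>.\<close>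

lemma ky_fan_gap:
  fixes A :: "real^'n^'n"
  assumes A: "eigen_system A \<kappa> \<phi>" and \<psi>: "orthonormal_family \<psi>" and m: "m \<le> CARD('n)"
    and s: "\<And>i. i \<in> {1..m} \<Longrightarrow> s \<le> \<kappa> i" and t: "\<And>j. j \<in> {m+1..CARD('n)} \<Longrightarrow> \<kappa> j \<le> t"
  shows "(s - t) / 2 * (norm (proj m \<phi> - proj m \<psi>))\<^sup>2 \<le> A \<bullet> (proj m \<phi> - proj m \<psi>)"
proof -
  let ?d = "CARD('n)"
  have on: "orthonormal_family \<phi>" using A by (simp add: eigen_system_def)
  define w where "w a = (\<Sum>i\<in>{1..m}. (\<phi> a \<bullet> \<psi> i)\<^sup>2)" for a
  have split: "(\<Sum>a\<in>{1..?d}. f a) = (\<Sum>a\<in>{1..m}. f a) + (\<Sum>a\<in>{m+1..?d}. f a)" for f :: "nat \<Rightarrow> real"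
    using m by (subst sum.union_disjoint[symmetric]) (auto intro!: sum.cong)
  have w0: "w a \<ge> 0" for a by (simp add: w_def sum_nonneg)
  have w1: "w a \<le> 1" if "a \<in> {1..?d}" for a
  proof -
    have "w a \<le> (\<Sum>i\<in>{1..?d}. (\<phi> a \<bullet> \<psi> i)\<^sup>2)"
      unfolding w_def using m by (intro sum_mono2) auto
    also have "\<dots> = \<phi> a \<bullet> \<phi> a"
      using parseval[OF \<psi>, of "\<phi> a" "\<phi> a"] by (simp add: power2_eq_square inner_commute)
    finally show ?thesis using orthonormalD[OF on that that] by simp
  qed
  have wsum: "(\<Sum>a\<in>{1..?d}. w a) = m"
  proof -
    have "(\<Sum>a\<in>{1..?d}. w a) = (\<Sum>i\<in>{1..m}. \<psi> i \<bullet> \<psi> i)"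
      unfolding w_def
      by (subst sum.swap) (intro sum.cong refl, simp add: power2_eq_square parseval[OF on] del: One_nat_def)
    also have "\<dots> = (\<Sum>i\<in>{1..m}. 1)"
      using m by (intro sum.cong) (auto simp: orthonormalD[OF \<psi>])
    finally show ?thesis by simp
  qed
  have A\<phi>: "A \<bullet> proj m \<phi> = (\<Sum>a\<in>{1..m}. \<kappa> a)"
    unfolding inner_proj using m A
    by (intro sum.cong) (auto simp: eigen_system_def orthonormal_family_def)
  have A\<psi>: "A \<bullet> proj m \<psi> = (\<Sum>a\<in>{1..?d}. \<kappa> a * w a)"
    unfolding inner_proj eigen_system_inner[OF A] w_def sum_distrib_left
    by (subst sum.swap) (simp add: power2_eq_square mult_ac)
  have nrm: "(norm (proj m \<phi> - proj m \<psi>))\<^sup>2 = 2 * (\<Sum>a\<in>{1..m}. 1 - w a)"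
  proof -
    have "(norm (proj m \<phi> - proj m \<psi>))\<^sup>2 = real m + real m - 2 * (proj m \<phi> \<bullet> proj m \<psi>)"
      by (simp add: power2_norm_eq_inner inner_diff_left inner_diff_right inner_commute
          proj_self[OF on m] proj_self[OF \<psi> m])
    also have "\<dots> = 2 * (\<Sum>a\<in>{1..m}. 1 - w a)"
      unfolding w_def sum_subtractf by (simp add: proj_inner_proj)
    finally show ?thesis .
  qed
  have eq: "(\<Sum>a\<in>{1..m}. 1 - w a) = (\<Sum>a\<in>{m+1..?d}. w a)"
    using wsum split[of w] by (simp add: sum_subtractf)
  have "(s - t) / 2 * (norm (proj m \<phi> - proj m \<psi>))\<^sup>2
      = s * (\<Sum>a\<in>{1..m}. 1 - w a) - t * (\<Sum>a\<in>{m+1..?d}. w a)"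
    unfolding nrm eq by (simp add: field_simps)
  also have "\<dots> = (\<Sum>a\<in>{1..m}. s * (1 - w a)) - (\<Sum>a\<in>{m+1..?d}. t * w a)"
    by (simp only: sum_distrib_left)
  also have "\<dots> \<le> (\<Sum>a\<in>{1..m}. \<kappa> a * (1 - w a)) - (\<Sum>a\<in>{m+1..?d}. \<kappa> a * w a)"
    using w0 w1 m s t by (intro diff_mono sum_mono mult_right_mono) auto
  also have "\<dots> = A \<bullet> (proj m \<phi> - proj m \<psi>)"
    unfolding inner_diff_right A\<phi> A\<psi> split[of "\<lambda>a. \<kappa> a * w a"]
    by (simp add: right_diff_distrib sum_subtractf)
  finally show ?thesis .
qed

lemma ky_fan:
  fixes A :: "real^'n^'n"
  assumes A: "eigen_system A \<kappa> \<phi>" and \<psi>: "orthonormal_family \<psi>" and m: "m \<le> CARD('n)"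
  shows "A \<bullet> proj m \<psi> \<le> A \<bullet> proj m \<phi>"
proof (cases "m = 0")
  case False
  \<comment> \<open>With both thresholds at \<open>\<kappa> m\<close> the growth term vanishes and
    plain optimality remains.\<close>
  have "(\<kappa> m - \<kappa> m) / 2 * (norm (proj m \<phi> - proj m \<psi>))\<^sup>2 \<le> A \<bullet> (proj m \<phi> - proj m \<psi>)"
    using A m False by (intro ky_fan_gap[OF A \<psi> m]) (auto simp: eigen_system_def)
  then show ?thesis by (simp add: inner_diff_right)
qed (simp add: proj_def)

context
  fixes A A' :: "real^'n^'n" and \<kappa> \<mu> :: "nat \<Rightarrow> real" and \<phi> \<psi> :: "nat \<Rightarrow> real^'n"
  assumes A: "eigen_system A \<kappa> \<phi>" and A': "eigen_system A' \<mu> \<psi>"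
begin

lemma orthonormal_left: "orthonormal_family \<phi>" and orthonormal_right: "orthonormal_family \<psi>"
  using A A' by (auto simp: eigen_system_def)

text \<open>The block \<psi> is optimal for \<open>A'\<close>, so what it loses for \<open>A\<close>
  is at most what the difference of the two forms contributes.\<close>

lemma loss_le: 
  assumes m: "m \<le> CARD('n)"
  shows "A \<bullet> (proj m \<phi> - proj m \<psi>) \<le> norm (A' - A) * norm (proj m \<phi> - proj m \<psi>)"
proof -
  have "A \<bullet> (proj m \<phi> - proj m \<psi>) = (A' \<bullet> proj m \<phi> - A' \<bullet> proj m \<psi>) - (A' - A) \<bullet> (proj m \<phi> - proj m \<psi>)"
    by (simp add: inner_diff_left inner_diff_right)
  also have "\<dots> \<le> - (A' - A) \<bullet> (proj m \<phi> - proj m \<psi>)"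
    using ky_fan[OF A' orthonormal_left m] by (simp add: inner_diff_left)
  also have "\<dots> \<le> norm (- (A' - A)) * norm (proj m \<phi> - proj m \<psi>)"
    by (rule norm_cauchy_schwarz)
  finally show ?thesis by (simp add: norm_minus_commute)
qed

text \<open>The loss grows quadratically in the distance of the projections by
  \<open>ky_fan_gap\<close> and is at most linear in it by \<open>loss_le\<close>; one factor
  cancels. The gap is required of one matrix only.\<close>

lemma davis_kahan:
  assumes k: "1 \<le> k" "k < CARD('n)" and gap: "\<kappa> (k + 1) < \<kappa> k"
  shows "norm (proj k \<phi> - proj k \<psi>) \<le> 2 / (\<kappa> k - \<kappa> (k + 1)) * norm (A' - A)"
proof -
  let ?N = "norm (proj k \<phi> - proj k \<psi>)" and ?g = "\<kappa> k - \<kappa> (k + 1)"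
  have "?g / 2 * ?N\<^sup>2 \<le> A \<bullet> (proj k \<phi> - proj k \<psi>)"
    using A k by (intro ky_fan_gap[OF A orthonormal_right]) (auto simp: eigen_system_def)
  also have "\<dots> \<le> norm (A' - A) * ?N" using k by (intro loss_le) simp
  finally have *: "?N * (?g / 2 * ?N) \<le> ?N * norm (A' - A)"
    by (simp add: power2_eq_square mult_ac)
  show ?thesis
  proof (cases "?N = 0")
    case False
    with * have "?g / 2 * ?N \<le> norm (A' - A)" by simp
    then show ?thesis using gap by (simp add: field_simps)
  qed (use gap in simp)
qed

text \<open>Sums of leading eigenvalues are maxima of functionals linear in the matrix, hence
  Lipschitz; Ky Fan's principle is used once in each direction.\<close>

lemma eigen_sum_dist_le:
  assumes m: "m \<le> CARD('n)"
  shows "\<bar>(\<Sum>i\<in>{1..m}. \<mu> i) - (\<Sum>i\<in>{1..m}. \<kappa> i)\<bar> \<le> CARD('n) * norm (A' - A)"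
proof -
  have 1: "A \<bullet> proj m \<phi> = (\<Sum>i\<in>{1..m}. \<kappa> i)"
    unfolding inner_proj using m A
    by (intro sum.cong) (auto simp: eigen_system_def orthonormal_family_def)
  have 2: "A' \<bullet> proj m \<psi> = (\<Sum>i\<in>{1..m}. \<mu> i)"
    unfolding inner_proj using m A'
    by (intro sum.cong) (auto simp: eigen_system_def orthonormal_family_def)
  have 3: "\<bar>(A' - A) \<bullet> proj m \<xi>\<bar> \<le> CARD('n) * norm (A' - A)" if "orthonormal_family \<xi>" for \<xi>
  proof -
    have "\<bar>(A' - A) \<bullet> proj m \<xi>\<bar> \<le> norm (A' - A) * norm (proj m \<xi>)"
      by (rule Cauchy_Schwarz_ineq2)
    also have "\<dots> \<le> norm (A' - A) * CARD('n)"
      by (intro mult_left_mono norm_proj that m) simp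
    finally show ?thesis by (simp add: mult.commute)
  qed
  show ?thesis
    using 3[OF orthonormal_left] 3[OF orthonormal_right]
      ky_fan[OF A orthonormal_right m] ky_fan[OF A' orthonormal_left m]
    unfolding 1[symmetric] 2[symmetric] inner_diff_left by linarith
qed

text \<open>A crude Weyl inequality: one eigenvalue is the difference of two consecutive leading
  sums, whence the factor 2.\<close>

lemma eigenvalue_dist_le:
  assumes m: "m \<in> {1..CARD('n)}"
  shows "\<bar>\<mu> m - \<kappa> m\<bar> \<le> 2 * CARD('n) * norm (A' - A)"
proof -
  obtain l where l: "m = Suc l" using m by (cases m) auto
  show ?thesis
    using eigen_sum_dist_le[of m] eigen_sum_dist_le[of l] m
    unfolding l by (simp add: algebra_simps)
qed

end

subsection \<open>Second-order expansion of the loss\<close>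

context
  fixes A A' :: "real^'n^'n" and \<kappa> \<mu> :: "nat \<Rightarrow> real" and \<phi> \<psi> :: "nat \<Rightarrow> real^'n" and k :: nat
  assumes A: "eigen_system A \<kappa> \<phi>" and A': "eigen_system A' \<mu> \<psi>" and k: "k < CARD('n)"
begin

private abbreviation "R \<equiv> proj k \<psi>"
private abbreviation "D \<equiv> proj k \<psi> - proj k \<phi>"
private abbreviation "E \<equiv> A' - A"

private lemma on: "orthonormal_family \<phi>" "orthonormal_family \<psi>"
  using A A' by (auto simp: eigen_system_def)

private lemma proj_sym: "u \<bullet> (proj k \<psi> *v v) = (proj k \<psi> *v u) \<bullet> v"
  by (simp add: proj_mult_vec inner_sum_right inner_sum_left inner_commute mult_ac)

private lemma proj_idem: "(proj k \<psi> *v u) \<bullet> (proj k \<psi> *v v) = u \<bullet> (proj k \<psi> *v v)"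
proof -
  have "\<psi> i \<bullet> (R *v v) = \<psi> i \<bullet> v" if "i \<in> {1..k}" for i
  proof -
    have "\<psi> i \<bullet> (R *v v) = (\<Sum>j\<in>{1..k}. (\<psi> j \<bullet> v) * (\<psi> i \<bullet> \<psi> j))"
      by (simp add: proj_mult_vec inner_sum_right)
    also have "\<dots> = (\<Sum>j\<in>{1..k}. if j = i then \<psi> j \<bullet> v else 0)"
      using k that by (intro sum.cong) (auto simp: orthonormalD[OF on(2)])
    also have "\<dots> = \<psi> i \<bullet> v" using that by simp
    finally show ?thesis .
  qed
  then have "(\<Sum>i\<in>{1..k}. (\<psi> i \<bullet> u) * (\<psi> i \<bullet> (R *v v))) = (\<Sum>i\<in>{1..k}. (\<psi> i \<bullet> u) * (\<psi> i \<bullet> v))"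
    by simp
  then show ?thesis
    by (simp add: proj_mult_vec[of k \<psi> u] inner_sum_left) (simp add: proj_mult_vec inner_sum_right inner_commute mult_ac)
qed

private lemma proj_phi: "a \<in> {1..CARD('n)} \<Longrightarrow> proj k \<phi> *v \<phi> a = (if a \<le> k then \<phi> a else 0)"
proof -
  assume a: "a \<in> {1..CARD('n)}"
  have "proj k \<phi> *v \<phi> a = (\<Sum>i\<in>{1..k}. if i = a then \<phi> i else 0)"
    unfolding proj_mult_vec using a k by (intro sum.cong) (auto simp: orthonormalD[OF on(1)])
  then show ?thesis using a by auto
qed

private lemma D_phi: "a \<in> {1..CARD('n)} \<Longrightarrow> D *v \<phi> a = R *v \<phi> a - (if a \<le> k then \<phi> a else 0)"
  by (simp add: proj_phi matrix_vector_mult_diff_rdistrib del: One_nat_def)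

text \<open>Idempotence of both projections: compressed to the range of the old projection, their
  difference \<open>D\<close> equals minus the compression of its square; on the complement it
  equals plus that compression. So diagonal blocks are of second order.\<close>

private lemma D_same_block:
  assumes "a \<in> {1..CARD('n)}" "b \<in> {1..CARD('n)}" "a \<le> k \<longleftrightarrow> b \<le> k"
  shows "\<phi> b \<bullet> (D *v \<phi> a) = (if a \<le> k then - 1 else 1) * ((D *v \<phi> b) \<bullet> (D *v \<phi> a))"
proof (cases "a \<le> k")
  case True
  then have b: "b \<le> k" using assms by simp
  have "(D *v \<phi> b) \<bullet> (D *v \<phi> a) = (R *v \<phi> b - \<phi> b) \<bullet> (R *v \<phi> a - \<phi> a)"
    using D_phi[OF assms(1)] D_phi[OF assms(2)] True b by simp
  also have "\<dots> = \<phi> b \<bullet> \<phi> a - \<phi> b \<bullet> (R *v \<phi> a)"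
    by (simp add: inner_diff_left inner_diff_right proj_idem proj_sym[of "\<phi> b" "\<phi> a", symmetric])
  finally show ?thesis
    using D_phi[OF assms(1)] True by (simp add: inner_diff_right)
next
  case False
  then have b: "\<not> b \<le> k" using assms by simp
  show ?thesis
    using D_phi[OF assms(1)] D_phi[OF assms(2)] False b by (simp add: proj_idem)
qed

private lemma norm_phi: "a \<in> {1..CARD('n)} \<Longrightarrow> norm (\<phi> a) = 1"
  using orthonormalD[OF on(1), of a a] by (simp add: norm_eq_sqrt_inner)

private lemma D_phi_le: "a \<in> {1..CARD('n)} \<Longrightarrow> norm (D *v \<phi> a) \<le> norm D"
  using norm_mult_vec_le[of D "\<phi> a"] norm_phi[of a] by simp

private lemma E_phi_le: "a \<in> {1..CARD('n)} \<Longrightarrow> norm (E *v \<phi> a) \<le> norm E"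
  using norm_mult_vec_le[of E "\<phi> a"] norm_phi[of a] by simp

text \<open>The new matrix commutes with its own spectral projection, stated as an identity of
  bilinear forms.\<close>

private lemma commute: "(A' *v u) \<bullet> (R *v v) = (R *v u) \<bullet> (A' *v v)"
proof -
  have "(A' *v u) \<bullet> \<psi> i = \<mu> i * (u \<bullet> \<psi> i)" if "i \<in> {1..k}" for u i
  proof -
    have "(A' *v u) \<bullet> \<psi> i = u \<bullet> (A' *v \<psi> i)"
      by (simp add: eigen_system_sym[OF A'])
    then show ?thesis using A' k that by (simp add: eigen_system_def)
  qed
  then show ?thesis
    unfolding proj_mult_vec inner_sum_right inner_sum_left
    by (intro sum.cong refl) (simp add: inner_commute[of "\<psi> _"])
qed

text \<open>The commutation relation is read between \<open>\<phi> j\<close> and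
  \<open>\<phi> i\<close>. The zeroth-order parts leave the eigenvalue difference times the entry of
  \<open>D\<close>; the linear part in \<open>E\<close> is the entry of \<open>E\<close>, and two
  mixed products of \<open>E\<close> and \<open>D\<close> remain as error.\<close>

private lemma off_block:
  assumes i: "i \<in> {1..k}" and j: "j \<in> {k+1..CARD('n)}"
  shows "\<bar>(\<kappa> i - \<kappa> j) * (\<phi> j \<bullet> (D *v \<phi> i)) - \<phi> i \<bullet> (E *v \<phi> j)\<bar> \<le> 2 * norm E * norm D"
proof -
  have ij: "i \<in> {1..CARD('n)}" "j \<in> {1..CARD('n)}" "i \<le> k" "\<not> j \<le> k" using i j k by auto
  have Ai: "A' *v \<phi> i = \<kappa> i *\<^sub>R \<phi> i + E *v \<phi> i" and Aj: "A' *v \<phi> j = \<kappa> j *\<^sub>R \<phi> j + E *v \<phi> j"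
    using A ij by (simp_all add: eigen_system_def matrix_vector_mult_diff_rdistrib)
  have E_sym: "u \<bullet> (E *v v) = (E *v u) \<bullet> v" for u v
    by (simp add: matrix_vector_mult_diff_rdistrib inner_diff_left inner_diff_right
      eigen_system_sym[OF A] eigen_system_sym[OF A'])
  have Pi: "R *v \<phi> i = \<phi> i + D *v \<phi> i" and Pj: "R *v \<phi> j = D *v \<phi> j"
    using D_phi[OF ij(1)] D_phi[OF ij(2)] ij by simp_all
  have z: "\<phi> j \<bullet> \<phi> i = 0" using orthonormalD[OF on(1) ij(2,1)] ij by auto
  have "(A' *v \<phi> j) \<bullet> (R *v \<phi> i) = \<kappa> j * (\<phi> j \<bullet> (D *v \<phi> i)) + (E *v \<phi> j) \<bullet> \<phi> i + (E *v \<phi> j) \<bullet> (D *v \<phi> i)"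
    unfolding Aj Pi by (simp add: inner_add_left inner_add_right z)
  moreover have "(R *v \<phi> j) \<bullet> (A' *v \<phi> i) = \<kappa> i * (\<phi> j \<bullet> (D *v \<phi> i)) + (D *v \<phi> j) \<bullet> (E *v \<phi> i)"
  proof -
    have "(D *v \<phi> j) \<bullet> \<phi> i = \<phi> j \<bullet> (R *v \<phi> i)" unfolding Pj[symmetric] by (simp add: proj_sym)
    also have "\<dots> = \<phi> j \<bullet> (D *v \<phi> i)" unfolding Pi by (simp add: inner_add_right z)
    finally show ?thesis unfolding Ai Pj by (simp add: inner_add_right)
  qed
  ultimately have "(\<kappa> i - \<kappa> j) * (\<phi> j \<bullet> (D *v \<phi> i)) - \<phi> i \<bullet> (E *v \<phi> j)
      = (E *v \<phi> j) \<bullet> (D *v \<phi> i) - (D *v \<phi> j) \<bullet> (E *v \<phi> i)"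
    using commute[of "\<phi> j" "\<phi> i"] by (simp add: algebra_simps inner_commute)
  moreover have "\<bar>(E *v \<phi> j) \<bullet> (D *v \<phi> i)\<bar> \<le> norm E * norm D"
    by (rule order_trans[OF Cauchy_Schwarz_ineq2]) (intro mult_mono E_phi_le D_phi_le ij; simp)
  moreover have "\<bar>(D *v \<phi> j) \<bullet> (E *v \<phi> i)\<bar> \<le> norm D * norm E"
    by (rule order_trans[OF Cauchy_Schwarz_ineq2]) (intro mult_mono E_phi_le D_phi_le ij; simp)
  ultimately show ?thesis by (simp add: mult.commute)
qed

private lemma same_block_le:
  assumes "a \<in> {1..CARD('n)}" "b \<in> {1..CARD('n)}" "a \<le> k \<longleftrightarrow> b \<le> k"
  shows "(\<phi> b \<bullet> (D *v \<phi> a))\<^sup>2 \<le> norm D ^ 4"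
proof -
  have "\<bar>\<phi> b \<bullet> (D *v \<phi> a)\<bar> \<le> norm D * norm D"
    unfolding D_same_block[OF assms] using Cauchy_Schwarz_ineq2[of "D *v \<phi> b" "D *v \<phi> a"]
      mult_mono[OF D_phi_le[OF assms(2)] D_phi_le[OF assms(1)]]
    by (simp add: abs_mult)
  then have "\<bar>\<phi> b \<bullet> (D *v \<phi> a)\<bar>\<^sup>2 \<le> (norm D * norm D)\<^sup>2"
    by (intro power_mono) auto
  then show ?thesis by (simp add: power2_eq_square power4_eq_xxxx mult_ac)
qed

private lemma inner_proj_diff: "A \<bullet> proj k \<xi> = (\<Sum>a\<in>{1..CARD('n)}. \<kappa> a * (\<phi> a \<bullet> (proj k \<xi> *v \<phi> a)))"
proof -
  have "A \<bullet> proj k \<xi> = (\<Sum>i\<in>{1..k}. \<Sum>a\<in>{1..CARD('n)}. \<kappa> a * (\<phi> a \<bullet> \<xi> i) * (\<phi> a \<bullet> \<xi> i))"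
    unfolding inner_proj eigen_system_inner[OF A] ..
  also have "\<dots> = (\<Sum>a\<in>{1..CARD('n)}. \<kappa> a * (\<phi> a \<bullet> (proj k \<xi> *v \<phi> a)))"
    by (subst sum.swap) (simp add: proj_mult_vec inner_sum_right sum_distrib_left inner_commute mult_ac)
  finally show ?thesis .
qed

text \<open>An exact identity. In the trace only diagonal entries of \<open>D\<close> occur; by
  \<open>D_same_block\<close> they are squared lengths up to sign, which Parseval splits over both
  blocks. Cross terms appear once with \<open>\<kappa> i\<close> and once with
  \<open>- \<kappa> j\<close>, hence the difference.\<close>

private lemma loss_eq:
  "A \<bullet> (proj k \<phi> - proj k \<psi>) = (\<Sum>i\<in>{1..k}. \<Sum>j\<in>{k+1..CARD('n)}. (\<kappa> i - \<kappa> j) * (\<phi> j \<bullet> (D *v \<phi> i))\<^sup>2)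
    + (\<Sum>i\<in>{1..k}. \<Sum>b\<in>{1..k}. \<kappa> i * (\<phi> b \<bullet> (D *v \<phi> i))\<^sup>2)
    - (\<Sum>j\<in>{k+1..CARD('n)}. \<Sum>b\<in>{k+1..CARD('n)}. \<kappa> j * (\<phi> b \<bullet> (D *v \<phi> j))\<^sup>2)"
proof -
  let ?d = "CARD('n)"
  have split: "(\<Sum>a\<in>{1..?d}. f a) = (\<Sum>a\<in>{1..k}. f a) + (\<Sum>a\<in>{k+1..?d}. f a)" for f :: "nat \<Rightarrow> real"
    using k by (subst sum.union_disjoint[symmetric]) (auto intro!: sum.cong)
  have sym: "\<phi> a \<bullet> (D *v \<phi> b) = \<phi> b \<bullet> (D *v \<phi> a)" for a b
    by (simp add: proj_mult_vec matrix_vector_mult_diff_rdistrib inner_diff_right inner_sum_right inner_commute mult_ac)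
  have nrm: "(D *v \<phi> a) \<bullet> (D *v \<phi> a) = (\<Sum>b\<in>{1..k}. (\<phi> b \<bullet> (D *v \<phi> a))\<^sup>2) + (\<Sum>b\<in>{k+1..?d}. (\<phi> b \<bullet> (D *v \<phi> a))\<^sup>2)" for a
    unfolding split[symmetric] power2_eq_square by (simp only: parseval[OF on(1)])
  have "A \<bullet> (proj k \<phi> - proj k \<psi>) = - (\<Sum>a\<in>{1..?d}. \<kappa> a * (\<phi> a \<bullet> (D *v \<phi> a)))"
    by (simp add: inner_diff_right inner_proj_diff matrix_vector_mult_diff_rdistrib right_diff_distrib sum_subtractf del: One_nat_def)
  also have "(\<Sum>a\<in>{1..?d}. \<kappa> a * (\<phi> a \<bullet> (D *v \<phi> a)))
    = (\<Sum>i\<in>{1..k}. \<kappa> i * (- ((D *v \<phi> i) \<bullet> (D *v \<phi> i)))) + (\<Sum>j\<in>{k+1..?d}. \<kappa> j * ((D *v \<phi> j) \<bullet> (D *v \<phi> j)))"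
    unfolding split
  proof (intro arg_cong2[where f = "(+)"] sum.cong refl)
    fix a assume a: "a \<in> {1..k}"
    then have "a \<in> {1..?d}" using k by auto
    from D_same_block[OF this this] a
    show "\<kappa> a * (\<phi> a \<bullet> (D *v \<phi> a)) = \<kappa> a * (- ((D *v \<phi> a) \<bullet> (D *v \<phi> a)))" by simp
  next
    fix a assume a: "a \<in> {k+1..?d}"
    then have "a \<in> {1..?d}" using k by auto
    from D_same_block[OF this this] a
    show "\<kappa> a * (\<phi> a \<bullet> (D *v \<phi> a)) = \<kappa> a * ((D *v \<phi> a) \<bullet> (D *v \<phi> a))" by simp
  qed
  also have "- \<dots> = (\<Sum>i\<in>{1..k}. \<Sum>b\<in>{1..k}. \<kappa> i * (\<phi> b \<bullet> (D *v \<phi> i))\<^sup>2)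
     + (\<Sum>i\<in>{1..k}. \<Sum>b\<in>{k+1..?d}. \<kappa> i * (\<phi> b \<bullet> (D *v \<phi> i))\<^sup>2)
     - (\<Sum>j\<in>{k+1..?d}. \<Sum>b\<in>{1..k}. \<kappa> j * (\<phi> b \<bullet> (D *v \<phi> j))\<^sup>2)
     - (\<Sum>j\<in>{k+1..?d}. \<Sum>b\<in>{k+1..?d}. \<kappa> j * (\<phi> b \<bullet> (D *v \<phi> j))\<^sup>2)"
    unfolding nrm by (simp only: distrib_left sum.distrib sum_distrib_left sum_negf mult_minus_right)
  also have "(\<Sum>j\<in>{k+1..?d}. \<Sum>b\<in>{1..k}. \<kappa> j * (\<phi> b \<bullet> (D *v \<phi> j))\<^sup>2)
     = (\<Sum>i\<in>{1..k}. \<Sum>j\<in>{k+1..?d}. \<kappa> j * (\<phi> j \<bullet> (D *v \<phi> i))\<^sup>2)"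
    by (subst sum.swap) (intro sum.cong refl; metis sym)
  finally show ?thesis by (simp add: left_diff_distrib sum_subtractf)
qed

text \<open>Since \<open>D\<close> is of the order of \<open>E\<close> by
  \<open>davis_kahan\<close>, the diagonal blocks contribute at fourth order, reduced to third by
  \<open>norm E \<le> 1\<close>. In the cross terms \<open>off_block\<close> replaces the entries of
  \<open>D\<close> by those of \<open>E\<close>, with a cubic error.\<close>

lemma loss_expansion:
  fixes g K :: real
  assumes k1: "1 \<le> k" and gap: "\<kappa> (k + 1) < \<kappa> k" and E1: "norm (A' - A) \<le> 1"
  defines "g \<equiv> \<kappa> k - \<kappa> (k + 1)"
  defines "K \<equiv> (\<Sum>a\<in>{1..CARD('n)}. \<bar>\<kappa> a\<bar>)"
  shows "\<bar>A \<bullet> (proj k \<phi> - proj k \<psi>)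
     - (\<Sum>i\<in>{1..k}. \<Sum>j\<in>{k+1..CARD('n)}. (\<phi> i \<bullet> ((A' - A) *v \<phi> j))\<^sup>2 / (\<kappa> i - \<kappa> j))\<bar>
     \<le> (k * CARD('n) * (4 / g * (2 + 4 / g) / g) + 2 * CARD('n) * K * (2 / g) ^ 4) * norm (A' - A) ^ 3"
proof -
  let ?d = "CARD('n)" and ?e = "norm E" and ?N = "norm D"
  let ?w = "\<lambda>i j. \<phi> j \<bullet> (D *v \<phi> i)" and ?x = "\<lambda>i j. \<phi> i \<bullet> (E *v \<phi> j)"
  have g: "g > 0" using gap by (simp add: g_def)
  have N: "?N \<le> 2 / g * ?e"
    using davis_kahan[OF A A' k1 k gap] by (simp add: g_def norm_minus_commute)
  have pw: "?e ^ 4 \<le> ?e ^ 3"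
    using power_decreasing[of 3 4 ?e] E1 by simp
  have off: "\<bar>(\<kappa> i - \<kappa> j) * (?w i j)\<^sup>2 - (?x i j)\<^sup>2 / (\<kappa> i - \<kappa> j)\<bar> \<le> 4 / g * (2 + 4 / g) / g * ?e ^ 3"
    if i: "i \<in> {1..k}" and j: "j \<in> {k+1..?d}" for i j
  proof -
    have gij: "g \<le> \<kappa> i - \<kappa> j"
    proof -
      have "\<kappa> k \<le> \<kappa> i" "\<kappa> j \<le> \<kappa> (k + 1)"
        using A k i j k1 by (auto simp: eigen_system_def)
      then show ?thesis by (simp add: g_def)
    qed
    then have gij0: "\<kappa> i - \<kappa> j > 0" using g by simp
    \<comment> \<open>The cross term equals \<open>?y\<^sup>2 / (\<kappa> i - \<kappa> j)\<close>,
      so it remains to compare the squares of \<open>?y\<close> and \<open>?x i j\<close>, factored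
      as difference times sum.\<close>
    let ?y = "(\<kappa> i - \<kappa> j) * ?w i j"
    have "\<bar>?y - ?x i j\<bar> \<le> 2 * ?e * ?N" by (rule off_block[OF i j])
    also have "\<dots> \<le> 2 * ?e * (2 / g * ?e)" using N by (intro mult_left_mono) auto
    finally have 1: "\<bar>?y - ?x i j\<bar> \<le> 4 / g * ?e\<^sup>2" by (simp add: power2_eq_square mult_ac)
    have ij: "i \<in> {1..?d}" "j \<in> {1..?d}" using i j k by auto
    have x: "\<bar>?x i j\<bar> \<le> ?e"
      using Cauchy_Schwarz_ineq2[of "\<phi> i" "E *v \<phi> j"] E_phi_le[OF ij(2)] norm_phi[OF ij(1)] by simp
    have "?e\<^sup>2 \<le> ?e" using power_decreasing[of 1 2 ?e] E1 by simp
    then have "4 / g * ?e\<^sup>2 \<le> 4 / g * ?e" using g by (intro mult_left_mono) auto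
    then have "\<bar>?y + ?x i j\<bar> \<le> (2 + 4 / g) * ?e"
      using 1 x unfolding distrib_right by linarith
    then have "\<bar>?y - ?x i j\<bar> * \<bar>?y + ?x i j\<bar> \<le> (4 / g * ?e\<^sup>2) * ((2 + 4 / g) * ?e)"
      using 1 g by (intro mult_mono) auto
    moreover have "?y\<^sup>2 - (?x i j)\<^sup>2 = (?y - ?x i j) * (?y + ?x i j)"
      by (simp add: power2_eq_square algebra_simps)
    ultimately have 2: "\<bar>?y\<^sup>2 - (?x i j)\<^sup>2\<bar> \<le> 4 / g * (2 + 4 / g) * ?e ^ 3"
      by (simp only: abs_mult power2_eq_square power3_eq_cube mult_ac)
    have "(\<kappa> i - \<kappa> j) * (?w i j)\<^sup>2 - (?x i j)\<^sup>2 / (\<kappa> i - \<kappa> j) = (?y\<^sup>2 - (?x i j)\<^sup>2) / (\<kappa> i - \<kappa> j)"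
      using gij0 by (simp add: diff_divide_distrib power2_eq_square)
    then have "\<bar>(\<kappa> i - \<kappa> j) * (?w i j)\<^sup>2 - (?x i j)\<^sup>2 / (\<kappa> i - \<kappa> j)\<bar> = \<bar>?y\<^sup>2 - (?x i j)\<^sup>2\<bar> / (\<kappa> i - \<kappa> j)"
      using gij0 by simp
    also have "\<dots> \<le> (4 / g * (2 + 4 / g) * ?e ^ 3) / g"
      using 2 gij g by (intro frac_le) auto
    finally show ?thesis by simp
  qed
  define S1 where "S1 = (\<Sum>i\<in>{1..k}. \<Sum>j\<in>{k+1..?d}. (\<kappa> i - \<kappa> j) * (?w i j)\<^sup>2 - (?x i j)\<^sup>2 / (\<kappa> i - \<kappa> j))"
  define S2 where "S2 = (\<Sum>i\<in>{1..k}. \<Sum>b\<in>{1..k}. \<kappa> i * (\<phi> b \<bullet> (D *v \<phi> i))\<^sup>2)"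
  define S3 where "S3 = (\<Sum>j\<in>{k+1..?d}. \<Sum>b\<in>{k+1..?d}. \<kappa> j * (\<phi> b \<bullet> (D *v \<phi> j))\<^sup>2)"
  have "\<bar>S1\<bar> \<le> (\<Sum>i\<in>{1..k}. \<Sum>j\<in>{k+1..?d}. 4 / g * (2 + 4 / g) / g * ?e ^ 3)"
    unfolding S1_def by (intro order_trans[OF sum_abs] sum_mono off)
  also have "\<dots> \<le> (k * ?d) * (4 / g * (2 + 4 / g) / g * ?e ^ 3)"
  proof -
    have "real (?d - k) \<le> real ?d" by simp
    then have "real k * real (?d - k) * (4 / g * (2 + 4 / g) / g * ?e ^ 3) \<le> real k * real ?d * (4 / g * (2 + 4 / g) / g * ?e ^ 3)"
      using g by (intro mult_right_mono mult_left_mono) auto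
    then show ?thesis by simp
  qed
  finally have b1: "\<bar>S1\<bar> \<le> (k * ?d) * (4 / g * (2 + 4 / g) / g * ?e ^ 3)" .
  have blk: "\<bar>\<Sum>a\<in>I. \<Sum>b\<in>I. \<kappa> a * (\<phi> b \<bullet> (D *v \<phi> a))\<^sup>2\<bar> \<le> ?d * K * (2 / g) ^ 4 * ?e ^ 3"
    if I: "I \<subseteq> {1..?d}" "\<And>a b. a \<in> I \<Longrightarrow> b \<in> I \<Longrightarrow> a \<le> k \<longleftrightarrow> b \<le> k" for I
  proof -
    have N4: "?N ^ 4 \<le> (2 / g) ^ 4 * ?e ^ 3"
    proof -
      have "?N ^ 4 \<le> (2 / g * ?e) ^ 4" using N by (intro power_mono) auto
      also have "\<dots> = (2 / g) ^ 4 * ?e ^ 4" by (rule power_mult_distrib)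
      also have "\<dots> \<le> (2 / g) ^ 4 * ?e ^ 3" using pw by (intro mult_left_mono) auto
      finally show ?thesis .
    qed
    have fin: "finite I" using I(1) finite_subset by blast
    have cI: "card I \<le> ?d" using card_mono[OF _ I(1)] by simp
    have "\<bar>\<Sum>a\<in>I. \<Sum>b\<in>I. \<kappa> a * (\<phi> b \<bullet> (D *v \<phi> a))\<^sup>2\<bar> \<le> (\<Sum>a\<in>I. \<Sum>b\<in>I. \<bar>\<kappa> a\<bar> * ?N ^ 4)"
    proof (intro order_trans[OF sum_abs] sum_mono)
      fix a b assume ab: "a \<in> I" "b \<in> I"
      have "(\<phi> b \<bullet> (D *v \<phi> a))\<^sup>2 \<le> ?N ^ 4"
        using ab I(1) by (intro same_block_le I(2)) auto
      then show "\<bar>\<kappa> a * (\<phi> b \<bullet> (D *v \<phi> a))\<^sup>2\<bar> \<le> \<bar>\<kappa> a\<bar> * ?N ^ 4"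
        unfolding abs_mult by (intro mult_left_mono) auto
    qed
    also have "\<dots> = card I * (\<Sum>a\<in>I. \<bar>\<kappa> a\<bar>) * ?N ^ 4"
      by (simp add: sum_distrib_left[symmetric] sum_distrib_right[symmetric])
    also have "\<dots> \<le> ?d * K * ((2 / g) ^ 4 * ?e ^ 3)"
    proof -
      have "(\<Sum>a\<in>I. \<bar>\<kappa> a\<bar>) \<le> K" unfolding K_def using I(1) by (intro sum_mono2) auto
      moreover have "K \<ge> 0" by (simp add: K_def sum_nonneg)
      ultimately have "card I * (\<Sum>a\<in>I. \<bar>\<kappa> a\<bar>) \<le> ?d * K" "?d * K \<ge> 0"
        using cI by (auto intro!: mult_mono sum_nonneg)
      from mult_mono[OF this(1) N4 this(2)] show ?thesis by simp
    qed
    finally show ?thesis by (simp add: mult_ac)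
  qed
  have b2: "\<bar>S2\<bar> \<le> ?d * K * (2 / g) ^ 4 * ?e ^ 3" unfolding S2_def using k by (intro blk) auto
  have b3: "\<bar>S3\<bar> \<le> ?d * K * (2 / g) ^ 4 * ?e ^ 3" unfolding S3_def using k by (intro blk) auto
  have "A \<bullet> (proj k \<phi> - proj k \<psi>)
     - (\<Sum>i\<in>{1..k}. \<Sum>j\<in>{k+1..CARD('n)}. (\<phi> i \<bullet> ((A' - A) *v \<phi> j))\<^sup>2 / (\<kappa> i - \<kappa> j)) = S1 + S2 - S3"
    unfolding loss_eq S1_def S2_def S3_def by (simp add: sum_subtractf)
  also have "\<bar>S1 + S2 - S3\<bar> \<le> (k * ?d) * (4 / g * (2 + 4 / g) / g * ?e ^ 3)
      + 2 * (?d * K * (2 / g) ^ 4 * ?e ^ 3)"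
    using b1 b2 b3 by linarith
  finally show ?thesis by (simp only: distrib_right distrib_left mult_ac of_nat_mult of_nat_numeral)
qed

end

subsection \<open>Positive semidefinite forms\<close>

text \<open>The form may be degenerate, so the usual division is replaced by nonnegativity of a
  binary quadratic form; if \<open>b y y = 0\<close>, a nonzero mixed term would make it
  negative.\<close>

lemma psd_cauchy_schwarz:
  fixes b :: "'v::real_vector \<Rightarrow> 'v \<Rightarrow> real"
  assumes b: "bilinear b" and sym: "\<And>x y. b x y = b y x" and psd: "\<And>x. b x x \<ge> 0"
  shows "(b x y)\<^sup>2 \<le> b x x * b y y"
proof -
  have exp: "b (s *\<^sub>R x + t *\<^sub>R y) (s *\<^sub>R x + t *\<^sub>R y) = s\<^sup>2 * b x x + 2 * s * t * b x y + t\<^sup>2 * b y y" for s t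
    using b by (simp add: bilinear_ladd bilinear_radd bilinear_lmul bilinear_rmul sym[of y x] power2_eq_square algebra_simps)
  have ge: "0 \<le> s\<^sup>2 * b x x + 2 * s * t * b x y + t\<^sup>2 * b y y" for s t
    using psd[of "s *\<^sub>R x + t *\<^sub>R y"] by (simp only: exp)
  show ?thesis
  proof (cases "b y y = 0")
    case False
    then have pos: "b y y > 0" using psd[of y] by simp
    have "0 \<le> b y y * (b x x * b y y - (b x y)\<^sup>2)"
      \<comment> \<open>The minimising coefficients with the denominator cleared.\<close>
      using ge[of "b y y" "- b x y"] by (simp add: power2_eq_square algebra_simps)
    then show ?thesis using pos by (simp add: zero_le_mult_iff)
  next
    case True
    have "b x y = 0"
    proof (rule ccontr)
      assume nz: "b x y \<noteq> 0"
      have "0 \<le> b x x + 2 * (- (b x x + 1) / (2 * b x y)) * b x y"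
        using ge[of 1 "- (b x x + 1) / (2 * b x y)"] True by simp
      also have "\<dots> = - 1" using nz by (simp add: field_simps)
      finally show False by simp
    qed
    then show ?thesis using True by simp
  qed
qed

text \<open>Cauchy-Schwarz for the form, applied to \<open>G *v v\<close> and \<open>v\<close>,
  shows that the maximum \<beta> on the sphere also bounds the operator norm. At a maximiser the
  squared norm of \<open>G *v v - \<beta> *\<^sub>R v\<close> is then at most zero, so it is an
  eigenvector.\<close>

lemma psd_top_eigenvector:
  fixes G :: "real^'n^'n"
  assumes sym: "\<And>u v. u \<bullet> (G *v v) = v \<bullet> (G *v u)" and psd: "\<And>v. 0 \<le> v \<bullet> (G *v v)"
  defines "\<alpha> \<equiv> onorm (\<lambda>v. G *v v)"
  obtains v\<^sub>0 where "norm v\<^sub>0 = 1" "G *v v\<^sub>0 = \<alpha> *\<^sub>R v\<^sub>0" "\<And>v. v \<bullet> (G *v v) \<le> \<alpha> * (norm v)\<^sup>2"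
proof -
  have bl: "bounded_linear (\<lambda>v. G *v v)" by simp
  have cont: "continuous_on (sphere 0 1) (\<lambda>v. v \<bullet> (G *v v))"
    by (intro continuous_intros)
  have ne: "sphere (0 :: real^'n) 1 \<noteq> {}" by simp
  obtain v\<^sub>0 where v\<^sub>0: "v\<^sub>0 \<in> sphere 0 1" "\<And>v. v \<in> sphere 0 1 \<Longrightarrow> v \<bullet> (G *v v) \<le> v\<^sub>0 \<bullet> (G *v v\<^sub>0)"
    using continuous_attains_sup[OF compact_sphere ne cont] by blast
  define \<beta> where "\<beta> = v\<^sub>0 \<bullet> (G *v v\<^sub>0)"
  have n0: "norm v\<^sub>0 = 1" using v\<^sub>0 by simp
  have \<beta>0: "\<beta> \<ge> 0" unfolding \<beta>_def by (rule psd)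
  have max: "v \<bullet> (G *v v) \<le> \<beta> * (norm v)\<^sup>2" for v
  proof (cases "v = 0")
    case False
    have "(v /\<^sub>R norm v) \<bullet> (G *v (v /\<^sub>R norm v)) \<le> \<beta>"
      unfolding \<beta>_def using False by (intro v\<^sub>0) simp
    moreover have "(v /\<^sub>R norm v) \<bullet> (G *v (v /\<^sub>R norm v)) = (v \<bullet> (G *v v)) / (norm v)\<^sup>2"
      by (simp add: matrix_vector_mult_scaleR power2_eq_square divide_inverse mult_ac)
    ultimately have "(v \<bullet> (G *v v)) / (norm v)\<^sup>2 \<le> \<beta>" by (simp only:)
    then show ?thesis using False by (simp add: pos_divide_le_eq)
  qed simp
  have bil: "bilinear (\<lambda>u v. u \<bullet> (G *v v))"
    by (auto simp: bilinear_def intro!: linearI simp: inner_add_left matrix_vector_right_distrib inner_add_right matrix_vector_mult_scaleR)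
  have bound: "norm (G *v v) \<le> \<beta> * norm v" for v
  proof (cases "G *v v = 0")
    case False
    let ?w = "G *v v"
    have "(?w \<bullet> (G *v v))\<^sup>2 \<le> (?w \<bullet> (G *v ?w)) * (v \<bullet> (G *v v))"
      by (rule psd_cauchy_schwarz[OF bil sym psd])
    also have "\<dots> \<le> (\<beta> * (norm ?w)\<^sup>2) * (\<beta> * (norm v)\<^sup>2)"
      using \<beta>0 by (intro mult_mono max psd) auto
    finally have "(norm ?w)\<^sup>2 * (norm ?w)\<^sup>2 \<le> (norm ?w)\<^sup>2 * (\<beta> * norm v)\<^sup>2"
      by (simp add: power2_norm_eq_inner[symmetric] power2_eq_square mult_ac)
    then have "(norm ?w)\<^sup>2 \<le> (\<beta> * norm v)\<^sup>2"
      by (rule mult_left_le_imp_le) (use False in simp)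
    then show ?thesis using \<beta>0 by (simp add: power2_le_iff_abs_le abs_mult)
  qed (use \<beta>0 in simp)
  have "\<alpha> = \<beta>"
  proof (rule antisym)
    show "\<alpha> \<le> \<beta>" unfolding \<alpha>_def by (rule onorm_bound[OF \<beta>0 bound])
    have "\<beta> \<le> norm v\<^sub>0 * norm (G *v v\<^sub>0)" unfolding \<beta>_def by (rule norm_cauchy_schwarz)
    also have "\<dots> \<le> \<alpha>" using onorm[OF bl, of v\<^sub>0] n0 by (simp add: \<alpha>_def)
    finally show "\<beta> \<le> \<alpha>" .
  qed
  have nn: "v\<^sub>0 \<bullet> v\<^sub>0 = 1" using n0 by (simp add: norm_eq_1)
  have "(norm (G *v v\<^sub>0 - \<beta> *\<^sub>R v\<^sub>0))\<^sup>2 = (norm (G *v v\<^sub>0))\<^sup>2 - \<beta>\<^sup>2"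
    unfolding power2_norm_eq_inner
    by (simp add: inner_diff_left inner_diff_right \<beta>_def[symmetric] nn
        inner_commute[of "G *v v\<^sub>0" v\<^sub>0] power2_eq_square)
  also have "\<dots> \<le> 0" using power_mono[OF bound[of v\<^sub>0] norm_ge_zero, of 2] n0 by simp
  finally have "G *v v\<^sub>0 = \<beta> *\<^sub>R v\<^sub>0" by simp
  with n0 max \<open>\<alpha> = \<beta>\<close> show ?thesis using that by blast
qed

subsection \<open>Differentiating the normalized joint distribution\<close>

lemma has_derivative_vec_lambda:
  fixes f :: "'b::real_normed_vector \<Rightarrow> 'n::finite \<Rightarrow> 'c::euclidean_space"
  assumes "\<And>i. ((\<lambda>z. f z i) has_derivative (\<lambda>h. f' h i)) (at a)"
  shows "((\<lambda>z. \<chi> i. f z i) has_derivative (\<lambda>h. \<chi> i. f' h i)) (at a)"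
proof (rule iffD2[OF has_derivative_componentwise_within], rule ballI)
  fix b :: "'c^'n" assume "b \<in> Basis"
  then obtain i u where b: "b = axis i u" by (auto simp: Basis_vec_def)
  show "((\<lambda>z. (\<chi> i. f z i) \<bullet> b) has_derivative (\<lambda>h. (\<chi> i. f' h i) \<bullet> b)) (at a)"
    unfolding b inner_axis using assms[of i] by (auto intro: has_derivative_inner_left)
qed

definition marg_X :: "real^('x::finite \<times> 'y::finite) \<Rightarrow> 'x \<Rightarrow> real" where
  "marg_X z x = (\<Sum>y\<in>UNIV. z $ (x, y))"

definition marg_Y :: "real^('x::finite \<times> 'y::finite) \<Rightarrow> 'y \<Rightarrow> real" where
  "marg_Y z y = (\<Sum>x\<in>UNIV. z $ (x, y))"

text \<open>Defined on the whole space instead of the simplex, so that ordinary derivatives exist in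
  every direction, also in those changing the total mass.\<close>

definition B_vec :: "real^('x::finite \<times> 'y::finite) \<Rightarrow> real^'x^'y" where
  "B_vec z = (\<chi> y x. z $ (x, y) / sqrt (marg_X z x * marg_Y z y) - sqrt (marg_X z x * marg_Y z y))"

definition dB :: "real^('x::finite \<times> 'y::finite) \<Rightarrow> real^('x \<times> 'y) \<Rightarrow> real^'x^'y" where
  "dB z h = (\<chi> y x. 1 / sqrt (marg_X z x * marg_Y z y) *
     (h $ (x, y) - 1 / 2 * (marg_X h x / marg_X z x + marg_Y h y / marg_Y z y)
        * (z $ (x, y) + marg_X z x * marg_Y z y)))"

definition gram :: "real^'x^'y \<Rightarrow> real^'x^'x" where
  "gram M = transpose M ** M"

definition dgram :: "real^'x^'y \<Rightarrow> real^'x^'y \<Rightarrow> real^'x^'x" where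
  "dgram M H = transpose H ** M + transpose M ** H"

lemma marg_X_prob_vec: "marg_X (prob_vec Q) x = pX Q x"
proof -
  have "pX Q x = measure_pmf.prob Q {p. fst p = x}"
    by (simp add: pmf_map vimage_def)
  also have "{p. fst p = x} = (\<lambda>y. (x, y)) ` UNIV" by auto
  also have "measure_pmf.prob Q \<dots> = (\<Sum>y\<in>UNIV. pmf Q (x, y))"
    by (subst measure_measure_pmf_finite) (auto simp: sum.reindex inj_on_def)
  finally show ?thesis by (simp add: marg_X_def prob_vec_def)
qed

lemma marg_Y_prob_vec: "marg_Y (prob_vec Q) y = pY Q y"
proof -
  have "pY Q y = measure_pmf.prob Q {p. snd p = y}"
    by (simp add: pmf_map vimage_def)
  also have "{p. snd p = y} = (\<lambda>x. (x, y)) ` UNIV" by auto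
  also have "measure_pmf.prob Q \<dots> = (\<Sum>x\<in>UNIV. pmf Q (x, y))"
    by (subst measure_measure_pmf_finite) (auto simp: sum.reindex inj_on_def)
  finally show ?thesis by (simp add: marg_Y_def prob_vec_def)
qed

lemma B_tilde_eq:
  assumes "\<And>x. pX P x > 0" "\<And>y. pY P y > 0"
  shows "B_tilde P = B_vec (prob_vec P)"
proof -
  have "(pmf P (x, y) - pX P x * pY P y) / sqrt (pX P x * pY P y)
     = pmf P (x, y) / sqrt (pX P x * pY P y) - sqrt (pX P x * pY P y)" for x y
    using assms(1)[of x] assms(2)[of y] by (simp only: diff_divide_distrib real_div_sqrt mult_nonneg_nonneg less_imp_le)
  then show ?thesis
    by (simp add: vec_eq_iff B_tilde_def B_vec_def marg_X_prob_vec marg_Y_prob_vec) (simp add: prob_vec_def)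
qed

lemma B_hat_eq:
  assumes "\<And>x. pX Q x > 0" "\<And>y. pY Q y > 0"
  shows "B_hat c Q = B_vec (prob_vec Q)"
proof -
  have "pX Q x \<noteq> 0" "pY Q y \<noteq> 0" for x y
    using assms(1)[of x] assms(2)[of y] by simp_all
  then show ?thesis
    by (simp add: vec_eq_iff B_hat_def B_vec_def marg_X_prob_vec marg_Y_prob_vec) (simp add: prob_vec_def)
qed

lemma has_derivative_marg_X: "((\<lambda>z. marg_X z x) has_derivative (\<lambda>h. marg_X h x)) (at z)"
  unfolding marg_X_def by (intro has_derivative_sum bounded_linear_imp_has_derivative bounded_linear_vec_nth)

lemma has_derivative_marg_Y: "((\<lambda>z. marg_Y z y) has_derivative (\<lambda>h. marg_Y h y)) (at z)"
  unfolding marg_Y_def by (intro has_derivative_sum bounded_linear_imp_has_derivative bounded_linear_vec_nth)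

lemma has_derivative_B_vec:
  fixes z :: "real^('x::finite \<times> 'y::finite)"
  assumes "\<And>x. marg_X z x > 0" "\<And>y. marg_Y z y > 0"
  shows "(B_vec has_derivative dB z) (at z)"
  unfolding B_vec_def[abs_def] dB_def[abs_def]
proof (intro has_derivative_vec_lambda)
  fix x y
  let ?a = "marg_X z x" and ?b = "marg_Y z y"
  define s where "s = sqrt (?a * ?b)"
  have pos: "?a > 0" "?b > 0" using assms by auto
  have s: "s > 0" "s * s = ?a * ?b" using pos by (auto simp: s_def)
  have ds: "((\<lambda>z. sqrt (marg_X z x * marg_Y z y)) has_derivative
      (\<lambda>h. (?a * marg_Y h y + marg_X h x * ?b) * (inverse s / 2))) (at z)"
    unfolding s_def using pos
    by (auto intro!: derivative_eq_intros has_derivative_marg_X has_derivative_marg_Y simp: field_simps)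
  have "((\<lambda>z. z $ (x, y) / sqrt (marg_X z x * marg_Y z y) - sqrt (marg_X z x * marg_Y z y)) has_derivative
     (\<lambda>h. (h $ (x, y) * s - z $ (x, y) * ((?a * marg_Y h y + marg_X h x * ?b) * (inverse s / 2))) / (s * s)
       - (?a * marg_Y h y + marg_X h x * ?b) * (inverse s / 2))) (at z)"
    using has_derivative_diff[OF has_derivative_divide'[OF bounded_linear_imp_has_derivative[OF bounded_linear_vec_nth] ds] ds, of "(x, y)"] s pos
    unfolding s_def by simp
  also have "(\<lambda>h. (h $ (x, y) * s - z $ (x, y) * ((?a * marg_Y h y + marg_X h x * ?b) * (inverse s / 2))) / (s * s)
       - (?a * marg_Y h y + marg_X h x * ?b) * (inverse s / 2))
     = (\<lambda>h. 1 / s * (h $ (x, y) - 1 / 2 * (marg_X h x / ?a + marg_Y h y / ?b) * (z $ (x, y) + ?a * ?b)))"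
  proof
    fix h
    \<comment> \<open>In terms of \<open>t\<close> and \<open>s * s\<close> no square root is left
      and the claim is a rational identity.\<close>
    define t where "t = ?a * marg_Y h y + marg_X h x * ?b"
    have eq: "marg_X h x / ?a + marg_Y h y / ?b = t / (s * s)"
      unfolding s(2) t_def using pos by (simp add: field_simps)
    show "(h $ (x, y) * s - z $ (x, y) * ((?a * marg_Y h y + marg_X h x * ?b) * (inverse s / 2))) / (s * s)
        - (?a * marg_Y h y + marg_X h x * ?b) * (inverse s / 2)
      = 1 / s * (h $ (x, y) - 1 / 2 * (marg_X h x / ?a + marg_Y h y / ?b) * (z $ (x, y) + ?a * ?b))"
      unfolding eq t_def[symmetric] s(2)[symmetric] using s(1) by (simp add: field_simps)
  qed
  finally show "((\<lambda>z. z $ (x, y) / sqrt (marg_X z x * marg_Y z y) - sqrt (marg_X z x * marg_Y z y)) has_derivative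
     (\<lambda>h. 1 / sqrt (?a * ?b) * (h $ (x, y) - 1 / 2 * (marg_X h x / ?a + marg_Y h y / ?b) * (z $ (x, y) + ?a * ?b)))) (at z)"
    unfolding s_def .
qed

lemma gram_nth: "gram M $ a $ b = (\<Sum>y\<in>UNIV. M $ y $ a * M $ y $ b)"
  by (simp add: gram_def matrix_matrix_mult_def transpose_def)

lemma dgram_nth: "dgram M H $ a $ b = (\<Sum>y\<in>UNIV. M $ y $ a * H $ y $ b + H $ y $ a * M $ y $ b)"
  by (simp add: dgram_def matrix_matrix_mult_def transpose_def sum.distrib)

lemma has_derivative_gram:
  fixes f :: "'a::real_normed_vector \<Rightarrow> real^'n^'m"
  assumes "(f has_derivative f') (at z)"
  shows "((\<lambda>z. gram (f z)) has_derivative (\<lambda>h. dgram (f z) (f' h))) (at z)"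
proof -
  have nth: "((\<lambda>z. f z $ y $ a) has_derivative (\<lambda>h. f' h $ y $ a)) (at z)" for y a
    by (intro bounded_linear.has_derivative[OF bounded_linear_vec_nth] assms)
  have "((\<lambda>z. \<chi> a b. \<Sum>y\<in>UNIV. f z $ y $ a * f z $ y $ b) has_derivative
     (\<lambda>h. \<chi> a b. \<Sum>y\<in>UNIV. f z $ y $ a * f' h $ y $ b + f' h $ y $ a * f z $ y $ b)) (at z)"
    by (intro has_derivative_vec_lambda has_derivative_sum has_derivative_mult nth)
  moreover have "(\<chi> a b. \<Sum>y\<in>UNIV. M $ y $ a * M $ y $ b) = gram M" for M :: "real^'n^'m"
    by (simp add: vec_eq_iff gram_nth)
  moreover have "(\<chi> a b. \<Sum>y\<in>UNIV. M $ y $ a * H $ y $ b + H $ y $ a * M $ y $ b) = dgram M H" for M H :: "real^'n^'m"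
    by (simp add: vec_eq_iff dgram_nth)
  ultimately show ?thesis by simp
qed

lemma inner_transpose: "u \<bullet> (transpose M *v w) = (M *v u) \<bullet> (w :: real^'m)"
  by (metis dot_lmul_matrix inner_commute transpose_matrix_vector)

lemma inner_dgram: "u \<bullet> (dgram M H *v v) = (H *v u) \<bullet> (M *v v) + (M *v u) \<bullet> (H *v v)"
  by (simp add: dgram_def matrix_vector_mult_add_rdistrib inner_add_right
      matrix_vector_mul_assoc[symmetric] inner_transpose del: transpose_matrix_vector)

lemma inner_gram: "u \<bullet> (gram M *v v) = (M *v u) \<bullet> (M *v v)"
  by (simp add: gram_def matrix_vector_mul_assoc[symmetric] inner_transpose del: transpose_matrix_vector)

section \<open>The matrix \<open>L\<close> and the vectors theta as derivatives\<close>

definition weighted :: "('a::finite) pmf \<Rightarrow> real^'a \<Rightarrow> real^'a" where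
  "weighted P v = (\<chi> a. sqrt (pmf P a) * v $ a)"

lemma sum_prod_UNIV: "(\<Sum>q\<in>UNIV. f q) = (\<Sum>x\<in>UNIV. \<Sum>y\<in>UNIV. f (x, y))"
  by (simp add: UNIV_Times_UNIV[symmetric] sum.cartesian_product del: UNIV_Times_UNIV)

text \<open>This explains \<open>L_matrix\<close>: it is the Jacobian of \<open>B_vec\<close> at
  \<open>P\<close> after \<open>weighted P\<close>, which turns a normalised deviation into a
  displacement of the distribution. Rows are indexed by \<open>(x, y)\<close>, the derivative matrix
  by \<open>y\<close>, then \<open>x\<close>.\<close>

lemma L_matrix_mult:
  fixes P :: "('x::finite \<times> 'y::finite) pmf"
  shows "(L_matrix P *v v) $ (x, y) = dB (prob_vec P) (weighted P v) $ y $ x"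
proof -
  let ?h = "weighted P v"
  let ?c = "1 / 2 * (pmf P (x, y) + pX P x * pY P y)"
  have "(L_matrix P *v v) $ (x, y) = (\<Sum>x'\<in>UNIV. \<Sum>y'\<in>UNIV.
     1 / sqrt (pX P x * pY P y) * (?h $ (x', y') * (of_bool (x = x') * of_bool (y = y'))
      - ?c * (?h $ (x', y') * of_bool (x = x')) / pX P x - ?c * (?h $ (x', y') * of_bool (y = y')) / pY P y))"
    unfolding matrix_vector_mult_def L_matrix_def
    by (simp add: sum_prod_UNIV weighted_def real_sqrt_divide)
      (intro sum.cong refl, simp add: algebra_simps add_divide_distrib diff_divide_distrib)
  also have "\<dots> = 1 / sqrt (pX P x * pY P y) * (?h $ (x, y) - ?c * marg_X ?h x / pX P x - ?c * marg_Y ?h y / pY P y)"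
  proof -
    have 1: "(\<Sum>x'\<in>UNIV. \<Sum>y'\<in>UNIV. ?h $ (x', y') * (of_bool (x = x') * of_bool (y = y'))) = ?h $ (x, y)"
    proof -
      have "(\<Sum>x'\<in>UNIV. \<Sum>y'\<in>UNIV. ?h $ (x', y') * (of_bool (x = x') * of_bool (y = y')))
        = (\<Sum>x'\<in>UNIV. if x = x' then ?h $ (x', y) else 0)"
        by (intro sum.cong refl) (simp add: of_bool_def if_distrib[of "(*) _"] cong: if_cong)
      then show ?thesis by simp
    qed
    have 2: "(\<Sum>x'\<in>UNIV. \<Sum>y'\<in>UNIV. ?h $ (x', y') * of_bool (x = x')) = marg_X ?h x"
    proof -
      have "(\<Sum>x'\<in>UNIV. \<Sum>y'\<in>UNIV. ?h $ (x', y') * of_bool (x = x'))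
        = (\<Sum>x'\<in>UNIV. if x = x' then marg_X ?h x' else 0)"
        by (intro sum.cong refl) (simp add: marg_X_def)
      then show ?thesis by simp
    qed
    have 3: "(\<Sum>x'\<in>UNIV. \<Sum>y'\<in>UNIV. ?h $ (x', y') * of_bool (y = y')) = marg_Y ?h y"
    proof (subst sum.swap)
      have "(\<Sum>y'\<in>UNIV. \<Sum>x'\<in>UNIV. ?h $ (x', y') * of_bool (y = y'))
        = (\<Sum>y'\<in>UNIV. if y = y' then marg_Y ?h y' else 0)"
        by (intro sum.cong refl) (simp add: marg_Y_def)
      then show "(\<Sum>y'\<in>UNIV. \<Sum>x'\<in>UNIV. ?h $ (x', y') * of_bool (y = y')) = marg_Y ?h y" by simp
    qed
    show ?thesis
      unfolding sum_distrib_left[symmetric] sum_subtractf sum_divide_distrib[symmetric] 1 2 3 ..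
  qed
  also have "\<dots> = dB (prob_vec P) ?h $ y $ x"
  proof -
    have "r - c * m / p - c * n / q = r - (m / p + n / q) * c" for r c m p n q :: real
      by (simp add: algebra_simps)
    then show ?thesis
      by (simp only: dB_def vec_lambda_beta marg_X_prob_vec marg_Y_prob_vec) (simp add: prob_vec_def mult_ac)
  qed
  finally show ?thesis .
qed

text \<open>Pairing a Kronecker product of \<open>\<phi> j\<close> and \<open>B *v \<phi> i\<close>
  with a flattened matrix \<open>H\<close> gives
  \<open>(B *v \<phi> i) \<bullet> (H *v \<phi> j)\<close>. The symmetrised sum is therefore an
  entry of the derivative of the Gram matrix in the basis \<phi>.\<close>

lemma theta_inner:
  fixes P :: "('x::finite \<times> 'y::finite) pmf"
  assumes "\<And>x. pX P x > 0" "\<And>y. pY P y > 0"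
  defines "B \<equiv> B_vec (prob_vec P)"
  shows "theta P \<phi> i j \<bullet> (L_matrix P *v v) = \<phi> i \<bullet> (dgram B (dB (prob_vec P) (weighted P v)) *v \<phi> j)"
proof -
  let ?H = "dB (prob_vec P) (weighted P v)"
  have "theta P \<phi> i j \<bullet> (L_matrix P *v v)
    = (\<Sum>x\<in>UNIV. \<Sum>y\<in>UNIV. (\<phi> j $ x * (B *v \<phi> i) $ y + \<phi> i $ x * (B *v \<phi> j) $ y) * ?H $ y $ x)"
    by (simp add: inner_vec_def sum_prod_UNIV L_matrix_mult theta_def kron_vec_def B_tilde_eq[OF assms(1,2)] B_def)
  also have "\<dots> = (\<Sum>y\<in>UNIV. \<Sum>x\<in>UNIV. (\<phi> j $ x * (B *v \<phi> i) $ y + \<phi> i $ x * (B *v \<phi> j) $ y) * ?H $ y $ x)"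
    by (rule sum.swap)
  also have "\<dots> = (\<Sum>y\<in>UNIV. (?H *v \<phi> i) $ y * (B *v \<phi> j) $ y + (B *v \<phi> i) $ y * (?H *v \<phi> j) $ y)"
    by (intro sum.cong refl)
      (simp add: matrix_vector_mult_def[of ?H] algebra_simps sum.distrib sum_distrib_left)
  also have "\<dots> = \<phi> i \<bullet> (dgram B ?H *v \<phi> j)"
    unfolding inner_dgram by (simp add: inner_vec_def sum.distrib)
  finally show ?thesis .
qed

subsection \<open>The error exponent\<close>

lemma right_singular_system_eigen_system:
  assumes "right_singular_system M \<sigma> \<phi>"
  shows "eigen_system (gram M) (\<lambda>i. (\<sigma> i)\<^sup>2) \<phi>"
  using assms unfolding right_singular_system_def eigen_system_def orthonormal_family_def gram_def
  by (auto intro!: power_mono)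

text \<open>This makes the loss a linear functional of the projection.\<close>

lemma frobenius_cols_squared: "(frobenius_cols M k \<phi>)\<^sup>2 = gram M \<bullet> proj k \<phi>"
proof -
  have "(frobenius_cols M k \<phi>)\<^sup>2 = (\<Sum>y\<in>UNIV. \<Sum>i\<in>{1..k}. ((M *v \<phi> i) $ y)\<^sup>2)"
    by (simp add: frobenius_cols_def frobenius_norm_def sum_nonneg)
  also have "\<dots> = gram M \<bullet> proj k \<phi>"
    unfolding inner_proj inner_gram
    by (subst sum.swap) (simp add: inner_vec_def power2_eq_square)
  finally show ?thesis .
qed

lemma norm_weighted_le: "norm (weighted P v) \<le> norm v"
proof (rule norm_le_componentwise_cart)
  fix a
  show "norm (weighted P v $ a) \<le> norm (v $ a)"
    using mult_right_mono[of "sqrt (pmf P a)" 1 "\<bar>v $ a\<bar>"] by (simp add: weighted_def abs_mult pmf_le_1)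
qed

lemma weighted_normalized_dev:
  assumes "set_pmf Q \<subseteq> set_pmf P"
  shows "weighted P (normalized_dev P Q) = prob_vec Q - prob_vec P"
proof -
  have "sqrt (pmf P a) * ((pmf Q a - pmf P a) / sqrt (pmf P a)) = pmf Q a - pmf P a" for a
    using assms by (cases "pmf P a = 0") (auto simp: set_pmf_iff)
  then show ?thesis by (simp add: vec_eq_iff weighted_def normalized_dev_def prob_vec_def)
qed

text \<open>The converse comparison to \<open>norm_weighted_le\<close>; it bounds the entropy of
  distributions whose normalised deviation is not small.\<close>

lemma normalized_dev_le:
  fixes P :: "'a::finite pmf"
  obtains m where "m > 0" "\<And>Q. set_pmf Q \<subseteq> set_pmf P \<Longrightarrow> m * norm (normalized_dev P Q) \<le> norm (prob_vec Q - prob_vec P)"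
proof -
  obtain m where m: "m > 0" and m_le: "\<And>a. a \<in> set_pmf P \<Longrightarrow> m \<le> sqrt (pmf P a)"
    using sqrt_pmf_bounded_below by blast
  have "m * norm (normalized_dev P Q) \<le> norm (prob_vec Q - prob_vec P)" if Q: "set_pmf Q \<subseteq> set_pmf P" for Q
  proof -
    have "norm (m *\<^sub>R normalized_dev P Q) \<le> norm (prob_vec Q - prob_vec P)"
    proof (rule norm_le_componentwise_cart)
      fix a
      show "norm ((m *\<^sub>R normalized_dev P Q) $ a) \<le> norm ((prob_vec Q - prob_vec P) $ a)"
      proof (cases "a \<in> set_pmf P")
        case True
        then have "sqrt (pmf P a) > 0" by (simp add: pmf_positive)
        moreover have "m * \<bar>pmf Q a - pmf P a\<bar> \<le> sqrt (pmf P a) * \<bar>pmf Q a - pmf P a\<bar>"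
          by (intro mult_right_mono m_le True) simp
        ultimately show ?thesis using m
          by (simp add: normalized_dev_def prob_vec_def abs_mult pos_divide_le_eq mult.commute)
      next
        case False
        then show ?thesis using Q by (auto simp: normalized_dev_def prob_vec_def set_pmf_iff)
      qed
    qed
    then show ?thesis using m by simp
  qed
  with m that show ?thesis by blast
qed

text \<open>The conditions under which a direction is realised by a distribution: preserved mass, no
  mass off the support, and nonnegative weights.\<close>

lemma perturbed_pmf:
  fixes P :: "'a::finite pmf" and v :: "real^'a"
  assumes orth: "(\<Sum>a\<in>UNIV. sqrt (pmf P a) * v $ a) = 0"
    and supp: "\<And>a. pmf P a = 0 \<Longrightarrow> v $ a = 0"
    and small: "\<And>a. a \<in> set_pmf P \<Longrightarrow> \<bar>v $ a\<bar> \<le> sqrt (pmf P a)"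
  obtains Q where "set_pmf Q \<subseteq> set_pmf P" "normalized_dev P Q = v"
proof -
  define f where "f a = pmf P a + sqrt (pmf P a) * v $ a" for a
  have f0: "f a \<ge> 0" for a
  proof (cases "a \<in> set_pmf P")
    case True
    have "sqrt (pmf P a) * (sqrt (pmf P a) + v $ a) \<ge> 0"
      using small[OF True] by (intro mult_nonneg_nonneg) auto
    then show ?thesis by (simp add: f_def distrib_left)
  qed (simp add: f_def set_pmf_iff)
  have f1: "(\<Sum>a\<in>UNIV. f a) = 1"
    using orth by (simp add: f_def sum.distrib sum_pmf_eq_1)
  have "(\<integral>\<^sup>+ a. ennreal (f a) \<partial>count_space UNIV) = 1"
    using f0 f1 by (simp add: nn_integral_count_space_finite sum_ennreal)
  then have pm: "pmf (embed_pmf f) a = f a" for a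
    using f0 by (intro pmf_embed_pmf) auto
  show ?thesis
  proof (rule that[of "embed_pmf f"])
    show "set_pmf (embed_pmf f) \<subseteq> set_pmf P"
      by (auto simp: set_pmf_iff pm f_def)
    show "normalized_dev P (embed_pmf f) = v"
      using supp by (auto simp: vec_eq_iff normalized_dev_def pm f_def)
  qed
qed

locale estimation =
  fixes P :: "('x::finite \<times> 'y::finite) pmf"
    and \<sigma> :: "nat \<Rightarrow> real"
    and \<phi> :: "nat \<Rightarrow> real^'x"
    and k :: nat
    and c :: "('x \<times> 'y) pmf \<Rightarrow> real^'x^'y"
    and V :: "real^'x^'y \<Rightarrow> nat \<Rightarrow> real^'x"
  assumes marginal_X: "\<And>x. pX P x > 0"
    and marginal_Y: "\<And>y. pY P y > 0"
    and svd: "right_singular_system (B_tilde P) \<sigma> \<phi>"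
    and k: "1 \<le> k" "k \<le> CARD('x) - 1"
    and gap: "\<sigma> k > \<sigma> (k + 1)"
    and V: "\<And>M. top_right_singular_vectors k M (V M)"
begin

definition "p = prob_vec P"
definition "B = B_vec p"
definition "A = gram B"
definition "\<kappa> i = (\<sigma> i)\<^sup>2" for i
definition "loss Q = (frobenius_cols (B_tilde P) k \<phi>)\<^sup>2 - (frobenius_cols (B_tilde P) k (V (B_hat c Q)))\<^sup>2" for Q
definition "Alin h = dgram B (dB p h)" for h

lemma B_tilde: "B_tilde P = B"
  by (simp add: B_def p_def B_tilde_eq marginal_X marginal_Y)

lemma k_less: "k < CARD('x)" using k by linarith

lemma eig: "eigen_system A \<kappa> \<phi>"
  using right_singular_system_eigen_system[OF svd] unfolding A_def B_tilde \<kappa>_def[abs_def] .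

lemma \<kappa>_gap: "\<kappa> (k + 1) < \<kappa> k"
proof -
  have "0 \<le> \<sigma> (k + 1)" using svd k_less by (simp add: right_singular_system_def)
  then show ?thesis using gap by (simp add: \<kappa>_def power_strict_mono)
qed

lemma \<kappa>_less: "i \<in> {1..k} \<Longrightarrow> j \<in> {k+1..CARD('x)} \<Longrightarrow> \<kappa> j < \<kappa> i"
proof -
  assume "i \<in> {1..k}" "j \<in> {k+1..CARD('x)}"
  then have "\<kappa> k \<le> \<kappa> i" "\<kappa> j \<le> \<kappa> (k + 1)"
    using eig k k_less by (auto simp: eigen_system_def)
  then show ?thesis using \<kappa>_gap by simp
qed

text \<open>Extends the selected vectors to a full eigenbasis; only their projection is
  retained.\<close>

lemma V_system:
  obtains \<mu> \<psi> where "eigen_system (gram M) \<mu> \<psi>" "proj k (V M) = proj k \<psi>"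
proof -
  obtain \<tau> \<psi> where "right_singular_system M \<tau> \<psi>" "\<forall>i\<in>{1..k}. V M i = \<psi> i"
    using V[of M] by (auto simp: top_right_singular_vectors_def)
  then show ?thesis
    using that[OF right_singular_system_eigen_system[of M \<tau> \<psi>]] by (simp add: proj_def)
qed

lemma loss_eq: "loss Q = A \<bullet> (proj k \<phi> - proj k (V (B_hat c Q)))"
  by (simp add: loss_def frobenius_cols_squared B_tilde A_def inner_diff_right)

section \<open>Continuity of the loss near the true distribution\<close>

definition pos :: "(real^('x \<times> 'y)) set" where
  "pos = {z. (\<forall>x. 0 < marg_X z x) \<and> (\<forall>y. 0 < marg_Y z y)}"

lemma open_pos: "open pos"
proof -
  have "pos = (\<Inter>x\<in>UNIV. {z. 0 < marg_X z x}) \<inter> (\<Inter>y\<in>UNIV. {z. 0 < marg_Y z y})"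
    by (auto simp: pos_def)
  also have "open \<dots>"
    unfolding marg_X_def marg_Y_def
    by (intro open_Int open_INT ballI finite_code open_Collect_less continuous_intros) auto
  finally show ?thesis .
qed

lemma p_pos: "p \<in> pos"
  by (simp add: pos_def p_def marg_X_prob_vec marg_Y_prob_vec marginal_X marginal_Y)

text \<open>On the open set \<open>pos\<close> the empirical matrix is a differentiable function of
  the distribution, independent of the convention \<open>c\<close>.\<close>

lemma B_hat_pos: "prob_vec Q \<in> pos \<Longrightarrow> B_hat c Q = B_vec (prob_vec Q)"
  by (rule B_hat_eq) (simp_all add: pos_def marg_X_prob_vec marg_Y_prob_vec)

lemma has_derivative_gram_B:
  "z \<in> pos \<Longrightarrow> ((\<lambda>z. gram (B_vec z)) has_derivative (\<lambda>h. dgram (B_vec z) (dB z h))) (at z)"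
  by (intro has_derivative_gram has_derivative_B_vec) (auto simp: pos_def)

lemma isCont_gram_B: "z \<in> pos \<Longrightarrow> isCont (\<lambda>z. gram (B_vec z)) z"
  using has_derivative_gram_B has_derivative_continuous by blast

lemma tendsto_gram_B:
  assumes "z \<in> pos"
  shows "((\<lambda>z. gram (B_vec z)) \<longlongrightarrow> gram (B_vec z)) (nhds z)"
  using isCont_gram_B[OF assms] unfolding isCont_def
  by (rule iffD1[OF tendsto_at_iff_tendsto_nhds[of "\<lambda>z. gram (B_vec z)"]])

text \<open>The gap survives near \<open>P\<close> by eigenvalue perturbation. Hence
  \<open>davis_kahan\<close> can be applied at \<open>Q\<close> itself, and the projection, with it
  the loss, is continuous at each such \<open>Q\<close>.\<close>

lemma loss_open:
  obtains \<rho> where "\<rho> > 0"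
    "\<And>Q \<epsilon>. loss Q > \<epsilon> \<Longrightarrow> norm (prob_vec Q - p) < \<rho> \<Longrightarrow>
      \<exists>\<delta>>0. \<forall>R. (\<forall>a. \<bar>pmf R a - pmf Q a\<bar> < \<delta>) \<longrightarrow> loss R > \<epsilon>"
proof -
  define g where "g = \<kappa> k - \<kappa> (k + 1)"
  define d where "d = real CARD('x)"
  have g: "g > 0" and d: "d > 0" using \<kappa>_gap by (simp_all add: g_def d_def)
  \<comment> \<open>With the factor \<open>2 * d\<close> of \<open>eigenvalue_dist_le\<close> every
    eigenvalue moves by less than \<open>g / 4\<close>, so more than half of the gap
    remains.\<close>
  have "\<forall>\<^sub>F z in nhds p. dist (gram (B_vec z)) A < g / (8 * d)"
    unfolding A_def B_def using g d by (intro tendstoD[OF tendsto_gram_B[OF p_pos]]) auto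
  moreover have "\<forall>\<^sub>F z in nhds p. z \<in> pos"
    using open_pos p_pos by (rule eventually_nhds_in_open)
  ultimately have "\<forall>\<^sub>F z in nhds p. z \<in> pos \<and> dist (gram (B_vec z)) A < g / (8 * d)"
    by eventually_elim simp
  then obtain \<rho> where \<rho>: "\<rho> > 0" "\<And>z. dist z p < \<rho> \<Longrightarrow> z \<in> pos \<and> dist (gram (B_vec z)) A < g / (8 * d)"
    unfolding eventually_nhds_metric by blast
  show ?thesis
  proof (rule that[OF \<rho>(1)])
    fix Q \<epsilon> assume loss: "loss Q > \<epsilon>" and n: "norm (prob_vec Q - p) < \<rho>"
    let ?z = "prob_vec Q" and ?A1 = "gram (B_vec (prob_vec Q))"
    have z: "?z \<in> pos" "dist ?A1 A < g / (8 * d)" using \<rho>(2)[of ?z] n by (auto simp: dist_norm)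
    obtain \<mu> \<psi> where e1: "eigen_system ?A1 \<mu> \<psi>" and p1: "proj k (V (B_hat c Q)) = proj k \<psi>"
      using V_system[of "B_hat c Q"] by (metis B_hat_pos[OF z(1)])
    have weyl: "\<bar>\<mu> m - \<kappa> m\<bar> < g / 4" if "m \<in> {1..CARD('x)}" for m
    proof -
      have "\<bar>\<mu> m - \<kappa> m\<bar> \<le> 2 * d * norm (?A1 - A)"
        using eigenvalue_dist_le[OF eig e1 that] by (simp add: d_def)
      also have "\<dots> < 2 * d * (g / (8 * d))"
        using z(2) d by (intro mult_strict_left_mono) (auto simp: dist_norm)
      also have "\<dots> = g / 4" using d by simp
      finally show ?thesis .
    qed
    have gap1: "\<mu> (k + 1) < \<mu> k"
    proof -
      have "\<bar>\<mu> k - \<kappa> k\<bar> < g / 4" "\<bar>\<mu> (k + 1) - \<kappa> (k + 1)\<bar> < g / 4"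
        using weyl[of k] weyl[of "k + 1"] k k_less by simp_all
      then show ?thesis using g unfolding g_def abs_less_iff by auto
    qed
    \<comment> \<open>The factor by which the loss changes with the Gram matrix, from
      \<open>davis_kahan\<close> at \<open>Q\<close>; the summand 1 makes positivity
      immediate.\<close>
    define C where "C = (norm A + 1) * (2 / (\<mu> k - \<mu> (k + 1)))"
    have C: "C > 0"
      unfolding C_def using gap1 by (intro mult_pos_pos divide_pos_pos add_nonneg_pos) auto
    have "\<forall>\<^sub>F w in nhds ?z. dist (gram (B_vec w)) ?A1 < (loss Q - \<epsilon>) / C"
      using loss C by (intro tendstoD[OF tendsto_gram_B[OF z(1)]]) auto
    moreover have "\<forall>\<^sub>F w in nhds ?z. w \<in> pos"
      using open_pos z(1) by (rule eventually_nhds_in_open)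
    ultimately have "\<forall>\<^sub>F w in nhds ?z. w \<in> pos \<and> dist (gram (B_vec w)) ?A1 < (loss Q - \<epsilon>) / C"
      by eventually_elim simp
    then obtain r where r: "r > 0" "\<And>w. dist w ?z < r \<Longrightarrow> w \<in> pos \<and> dist (gram (B_vec w)) ?A1 < (loss Q - \<epsilon>) / C"
      unfolding eventually_nhds_metric by blast
    show "\<exists>\<delta>>0. \<forall>R. (\<forall>a. \<bar>pmf R a - pmf Q a\<bar> < \<delta>) \<longrightarrow> loss R > \<epsilon>"
    proof (intro exI conjI allI impI)
      show "r / CARD('x \<times> 'y) > 0" using r by simp
      fix R assume R: "\<forall>a. \<bar>pmf R a - pmf Q a\<bar> < r / CARD('x \<times> 'y)"
      have "norm (prob_vec R - ?z) \<le> (\<Sum>a\<in>UNIV. \<bar>(prob_vec R - ?z) $ a\<bar>)"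
        by (rule norm_le_l1_cart)
      also have "\<dots> < (\<Sum>a\<in>(UNIV :: ('x \<times> 'y) set). r / CARD('x \<times> 'y))"
        using R by (intro sum_strict_mono) (auto simp: prob_vec_def)
      also have "\<dots> = r" by simp
      finally have "dist (prob_vec R) ?z < r" by (simp add: dist_norm)
      from r(2)[OF this] have w: "prob_vec R \<in> pos" "norm (gram (B_vec (prob_vec R)) - ?A1) < (loss Q - \<epsilon>) / C"
        by (auto simp: dist_norm)
      obtain \<nu> \<xi> where e2: "eigen_system (gram (B_vec (prob_vec R))) \<nu> \<xi>" and p2: "proj k (V (B_hat c R)) = proj k \<xi>"
        using V_system[of "B_hat c R"] by (metis B_hat_pos[OF w(1)])
      have "loss Q - loss R = A \<bullet> (proj k \<xi> - proj k \<psi>)"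
        by (simp add: loss_eq p1 p2 inner_diff_right)
      also have "\<dots> \<le> norm A * norm (proj k \<psi> - proj k \<xi>)"
        using norm_cauchy_schwarz[of A "proj k \<xi> - proj k \<psi>"] by (simp add: norm_minus_commute)
      also have "\<dots> \<le> (norm A + 1) * (2 / (\<mu> k - \<mu> (k + 1)) * norm (gram (B_vec (prob_vec R)) - ?A1))"
        using k k_less gap1 by (intro mult_mono davis_kahan[OF e1 e2]) auto
      also have "\<dots> = C * norm (gram (B_vec (prob_vec R)) - ?A1)" by (simp add: C_def)
      also have "\<dots> < C * ((loss Q - \<epsilon>) / C)"
        using w C by (intro mult_strict_left_mono)
      also have "\<dots> = loss Q - \<epsilon>" using C by simp
      finally show "loss R > \<epsilon>" by simp
    qed
  qed
qed

section \<open>The quadratic form of \<open>G\<close> and the expansion of the loss\<close>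

definition G :: "real^('x \<times> 'y)^('x \<times> 'y)" where "G = G_matrix P \<sigma> \<phi> k"
definition \<alpha> :: real where "\<alpha> = alpha P \<sigma> \<phi> k"

text \<open>On the diagonal this is the leading term of \<open>loss_expansion\<close> with the
  change of the Gram matrix replaced by its linearisation \<open>Alin\<close>.\<close>

lemma G_mult: "u \<bullet> (G *v v) = (\<Sum>i\<in>{1..k}. \<Sum>j\<in>{k+1..CARD('x)}.
    (\<phi> i \<bullet> (Alin (weighted P u) *v \<phi> j)) * (\<phi> i \<bullet> (Alin (weighted P v) *v \<phi> j)) / (\<kappa> i - \<kappa> j))"
proof -
  let ?S = "\<Sum>i\<in>{1..k}. \<Sum>j\<in>{k+1..CARD('x)}. (1 / (\<kappa> i - \<kappa> j)) *\<^sub>R outer (theta P \<phi> i j) (theta P \<phi> i j)"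
  have "G = transpose (L_matrix P) ** ?S ** L_matrix P"
    by (simp add: G_def G_matrix_def \<kappa>_def outer_def)
  then have "u \<bullet> (G *v v) = (L_matrix P *v u) \<bullet> (?S *v (L_matrix P *v v))"
    by (simp add: matrix_vector_mul_assoc[symmetric] inner_transpose del: transpose_matrix_vector)
  also have "\<dots> = (\<Sum>i\<in>{1..k}. \<Sum>j\<in>{k+1..CARD('x)}.
      (theta P \<phi> i j \<bullet> (L_matrix P *v u)) * (theta P \<phi> i j \<bullet> (L_matrix P *v v)) / (\<kappa> i - \<kappa> j))"
    by (simp add: sum_mult_vec scaleR_matrix_vector_assoc[symmetric] outer_mult_vec inner_sum_right
      inner_commute[of "L_matrix P *v u"] mult_ac del: One_nat_def)
  also have "\<dots> = (\<Sum>i\<in>{1..k}. \<Sum>j\<in>{k+1..CARD('x)}.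
    (\<phi> i \<bullet> (Alin (weighted P u) *v \<phi> j)) * (\<phi> i \<bullet> (Alin (weighted P v) *v \<phi> j)) / (\<kappa> i - \<kappa> j))"
    by (simp add: theta_inner marginal_X marginal_Y Alin_def B_def p_def)
  finally show ?thesis .
qed

lemma G_sym: "u \<bullet> (G *v v) = v \<bullet> (G *v u)"
  unfolding G_mult by (simp add: mult_ac)

lemma G_psd: "0 \<le> v \<bullet> (G *v v)"
  unfolding G_mult by (intro sum_nonneg divide_nonneg_nonneg) (use \<kappa>_less in \<open>auto simp: less_imp_le\<close>)

lemma G_kernel:
  assumes "\<And>i j. i \<in> {1..k} \<Longrightarrow> j \<in> {k+1..CARD('x)} \<Longrightarrow> \<phi> i \<bullet> (Alin (weighted P w) *v \<phi> j) = 0"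
  shows "G *v w = 0"
proof -
  have "(G *v w) \<bullet> (G *v w) = 0"
    unfolding G_mult using assms by (intro sum.neutral ballI) simp
  then show ?thesis by simp
qed

lemma Alin_bounded_linear: "bounded_linear Alin"
  using has_derivative_bounded_linear[OF has_derivative_gram_B[OF p_pos]]
  by (simp add: Alin_def[abs_def] B_def)

lemma inner_phi_le:
  assumes "i \<in> {1..CARD('x)}" "j \<in> {1..CARD('x)}"
  shows "\<bar>\<phi> i \<bullet> (M *v \<phi> j)\<bar> \<le> norm M"
proof -
  have n: "norm (\<phi> a) = 1" if "a \<in> {1..CARD('x)}" for a
    using eig that by (simp add: eigen_system_def orthonormal_family_def norm_eq_sqrt_inner)
  have "\<bar>\<phi> i \<bullet> (M *v \<phi> j)\<bar> \<le> norm (M *v \<phi> j)"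
    using Cauchy_Schwarz_ineq2[of "\<phi> i" "M *v \<phi> j"] n[OF assms(1)] by simp
  also have "\<dots> \<le> norm M" using norm_mult_vec_le[of M "\<phi> j"] n[OF assms(2)] by simp
  finally show ?thesis .
qed

text \<open>Two errors share \<eta> equally: the cubic remainder of \<open>loss_expansion\<close>,
  and the linearisation of the Gram matrix inside the quadratic term.\<close>

lemma loss_quadratic:
  assumes \<eta>: "\<eta> > 0"
  obtains \<rho> where "\<rho> > 0"
    "\<And>Q. set_pmf Q \<subseteq> set_pmf P \<Longrightarrow> norm (normalized_dev P Q) < \<rho> \<Longrightarrow>
      \<bar>loss Q - normalized_dev P Q \<bullet> (G *v normalized_dev P Q)\<bar> \<le> \<eta> * (norm (normalized_dev P Q))\<^sup>2"
proof -
  obtain C where C: "C > 0" "\<And>h. norm (Alin h) \<le> norm h * C"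
    using bounded_linear.pos_bounded[OF Alin_bounded_linear] by blast
  define g where "g = \<kappa> k - \<kappa> (k + 1)"
  define N where "N = real k * real CARD('x)"
  define K where "K = k * CARD('x) * (4 / g * (2 + 4 / g) / g)
    + 2 * CARD('x) * (\<Sum>a\<in>{1..CARD('x)}. \<bar>\<kappa> a\<bar>) * (2 / g) ^ 4"
  have g: "g > 0" using \<kappa>_gap by (simp add: g_def)
  have N: "N > 0" using k by (simp add: N_def)
  have K: "K \<ge> 0" unfolding K_def using g by (intro add_nonneg_nonneg mult_nonneg_nonneg sum_nonneg) auto
  \<comment> \<open>\<open>N\<close> bounds the number of index pairs, and \<open>2 * C + 1\<close>
    bounds the sum of an entry and its linearisation per unit of \<open>norm h\<close>. The cap 1
    yields \<open>norm E \<le> (C + 1) * norm h\<close>.\<close>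
  define \<eta>1 where "\<eta>1 = min 1 (\<eta> * g / (2 * N * (2 * C + 1)))"
  have \<eta>1: "\<eta>1 > 0" "\<eta>1 \<le> 1" using \<eta> g N C by (auto simp: \<eta>1_def)
  have \<eta>1': "N * (\<eta>1 * (2 * C + 1) / g) \<le> \<eta> / 2"
  proof -
    have "\<eta>1 \<le> \<eta> * g / (2 * N * (2 * C + 1))" by (simp add: \<eta>1_def)
    then have "\<eta>1 * (2 * N * (2 * C + 1)) \<le> \<eta> * g"
      using N C by (simp add: pos_le_divide_eq)
    then show ?thesis using g by (simp add: field_simps)
  qed
  obtain d1 where d1: "d1 > 0" "\<And>z. norm (z - p) < d1 \<Longrightarrow>
      norm (gram (B_vec z) - A - Alin (z - p)) \<le> \<eta>1 * norm (z - p)"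
    using has_derivative_gram_B[OF p_pos] \<eta>1(1)
    unfolding has_derivative_at_alt A_def B_def[symmetric] Alin_def by blast
  obtain d2 where d2: "d2 > 0" "\<And>z. norm (z - p) < d2 \<Longrightarrow> z \<in> pos"
    using open_pos p_pos by (metis dist_norm open_dist)
  \<comment> \<open>In order: validity of the linearisation, positive marginals,
    \<open>norm E \<le> 1\<close> as \<open>loss_expansion\<close> requires, and a cubic remainder
    of at most \<open>\<eta> / 2\<close> times the squared norm.\<close>
  define \<rho> where "\<rho> = min (min d1 d2) (min (1 / (C + 1)) (\<eta> / (2 * (K + 1) * (C + 1) ^ 3)))"
  have \<rho>: "\<rho> > 0" using d1 d2 C K \<eta> by (auto simp: \<rho>_def intro!: divide_pos_pos mult_pos_pos)
  have \<rho>1: "(C + 1) * \<rho> \<le> 1"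
  proof -
    have "\<rho> \<le> 1 / (C + 1)" by (simp add: \<rho>_def)
    then show ?thesis using C by (simp add: field_simps)
  qed
  have \<rho>2: "K * (C + 1) ^ 3 * \<rho> \<le> \<eta> / 2"
  proof -
    have "\<rho> \<le> \<eta> / (2 * (K + 1) * (C + 1) ^ 3)" by (simp add: \<rho>_def)
    then have "\<rho> * (2 * (K + 1) * (C + 1) ^ 3) \<le> \<eta>"
      using K C by (simp add: pos_le_divide_eq)
    moreover have "K * (C + 1) ^ 3 * \<rho> \<le> (K + 1) * (C + 1) ^ 3 * \<rho>"
      using C \<rho> by (intro mult_right_mono) auto
    moreover have "\<rho> * (2 * (K + 1) * (C + 1) ^ 3) = 2 * ((K + 1) * (C + 1) ^ 3 * \<rho>)"
      by (simp only: mult_ac)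
    ultimately show ?thesis by linarith
  qed
  show ?thesis
  proof (rule that[OF \<rho>])
    fix Q assume sub: "set_pmf Q \<subseteq> set_pmf P" and nv: "norm (normalized_dev P Q) < \<rho>"
    define v where "v = normalized_dev P Q"
    define h where "h = prob_vec Q - p"
    have wv: "weighted P v = h" unfolding v_def h_def p_def by (rule weighted_normalized_dev[OF sub])
    have hv: "norm h \<le> norm v" unfolding wv[symmetric] by (rule norm_weighted_le)
    then have h: "norm h < \<rho>" using nv by (simp add: v_def)
    define E where "E = gram (B_vec (prob_vec Q)) - A"
    have rem: "norm (E - Alin h) \<le> \<eta>1 * norm h"
      unfolding E_def h_def using h by (intro d1) (simp add: h_def \<rho>_def)
    have z: "prob_vec Q \<in> pos" using h by (intro d2) (simp add: h_def \<rho>_def)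
    have E1: "norm E \<le> (C + 1) * norm h"
    proof -
      have "norm E \<le> norm (E - Alin h) + norm (Alin h)"
        using norm_triangle_ineq[of "E - Alin h" "Alin h"] by simp
      also have "\<dots> \<le> 1 * norm h + norm h * C"
        using rem \<eta>1(2) C(2)[of h] mult_right_mono[OF \<eta>1(2), of "norm h"] by simp
      finally show ?thesis by (simp add: algebra_simps)
    qed
    have E2: "norm E \<le> 1"
    proof -
      have "(C + 1) * norm h \<le> (C + 1) * \<rho>" using C h by (intro mult_left_mono) auto
      then show ?thesis using E1 \<rho>1 by linarith
    qed
    obtain \<mu> \<psi> where e1: "eigen_system (gram (B_vec (prob_vec Q))) \<mu> \<psi>" and p1: "proj k (V (B_hat c Q)) = proj k \<psi>"
      using V_system[of "B_hat c Q"] by (metis B_hat_pos[OF z])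
    let ?x = "\<lambda>i j. \<phi> i \<bullet> (E *v \<phi> j)" and ?y = "\<lambda>i j. \<phi> i \<bullet> (Alin h *v \<phi> j)"
    have 1: "\<bar>loss Q - (\<Sum>i\<in>{1..k}. \<Sum>j\<in>{k+1..CARD('x)}. (?x i j)\<^sup>2 / (\<kappa> i - \<kappa> j))\<bar> \<le> K * norm E ^ 3"
      unfolding loss_eq p1 K_def g_def E_def
      by (rule loss_expansion[OF eig e1 k_less k(1) \<kappa>_gap E2[unfolded E_def]])
    have 2: "\<bar>(?x i j)\<^sup>2 / (\<kappa> i - \<kappa> j) - (?y i j)\<^sup>2 / (\<kappa> i - \<kappa> j)\<bar> \<le> \<eta>1 * (2 * C + 1) / g * (norm h)\<^sup>2"
      if i: "i \<in> {1..k}" and j: "j \<in> {k+1..CARD('x)}" for i j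
    proof -
      have ij: "i \<in> {1..CARD('x)}" "j \<in> {1..CARD('x)}" using i j k_less by auto
      have gij: "g \<le> \<kappa> i - \<kappa> j"
      proof -
        have "\<kappa> k \<le> \<kappa> i" "\<kappa> j \<le> \<kappa> (k + 1)"
          using eig k k_less i j by (auto simp: eigen_system_def)
        then show ?thesis by (simp add: g_def)
      qed
      have "?x i j - ?y i j = \<phi> i \<bullet> ((E - Alin h) *v \<phi> j)"
        by (simp add: matrix_vector_mult_diff_rdistrib inner_diff_right)
      then have a: "\<bar>?x i j - ?y i j\<bar> \<le> \<eta>1 * norm h"
        using inner_phi_le[OF ij, of "E - Alin h"] rem by simp
      have b: "\<bar>?x i j + ?y i j\<bar> \<le> (2 * C + 1) * norm h"
        using inner_phi_le[OF ij, of E] inner_phi_le[OF ij, of "Alin h"] E1 C(2)[of h]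
        by (simp add: algebra_simps)
      have "\<bar>(?x i j)\<^sup>2 - (?y i j)\<^sup>2\<bar> = \<bar>?x i j - ?y i j\<bar> * \<bar>?x i j + ?y i j\<bar>"
        by (simp add: power2_eq_square abs_mult[symmetric] algebra_simps)
      also have "\<dots> \<le> (\<eta>1 * norm h) * ((2 * C + 1) * norm h)"
        using a b \<eta>1 by (intro mult_mono) auto
      finally have c: "\<bar>(?x i j)\<^sup>2 - (?y i j)\<^sup>2\<bar> \<le> \<eta>1 * (2 * C + 1) * (norm h)\<^sup>2"
        by (simp only: power2_eq_square mult_ac)
      have "\<bar>(?x i j)\<^sup>2 / (\<kappa> i - \<kappa> j) - (?y i j)\<^sup>2 / (\<kappa> i - \<kappa> j)\<bar> = \<bar>(?x i j)\<^sup>2 - (?y i j)\<^sup>2\<bar> / (\<kappa> i - \<kappa> j)"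
        using gij g by (simp add: diff_divide_distrib[symmetric])
      also have "\<dots> \<le> (\<eta>1 * (2 * C + 1) * (norm h)\<^sup>2) / g"
        using c gij g by (intro frac_le) auto
      finally show ?thesis by simp
    qed
    have 3: "v \<bullet> (G *v v) = (\<Sum>i\<in>{1..k}. \<Sum>j\<in>{k+1..CARD('x)}. (?y i j)\<^sup>2 / (\<kappa> i - \<kappa> j))"
      unfolding G_mult wv by (simp add: power2_eq_square)
    have "\<bar>(\<Sum>i\<in>{1..k}. \<Sum>j\<in>{k+1..CARD('x)}. (?x i j)\<^sup>2 / (\<kappa> i - \<kappa> j)) - v \<bullet> (G *v v)\<bar>
      \<le> (\<Sum>i\<in>{1..k}. \<Sum>j\<in>{k+1..CARD('x)}. \<eta>1 * (2 * C + 1) / g * (norm h)\<^sup>2)"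
      unfolding 3 sum_subtractf[symmetric] by (intro order_trans[OF sum_abs] sum_mono 2)
    also have "\<dots> = real k * real (CARD('x) - k) * (\<eta>1 * (2 * C + 1) / g * (norm h)\<^sup>2)" by simp
    also have "\<dots> \<le> N * (\<eta>1 * (2 * C + 1) / g * (norm h)\<^sup>2)"
      unfolding N_def using \<eta>1 C g by (intro mult_right_mono mult_left_mono) auto
    also have "\<dots> = N * (\<eta>1 * (2 * C + 1) / g) * (norm h)\<^sup>2" by simp
    also have "\<dots> \<le> \<eta> / 2 * (norm v)\<^sup>2"
      using \<eta>1' hv \<eta> by (intro mult_mono power_mono) auto
    finally have 4: "\<bar>(\<Sum>i\<in>{1..k}. \<Sum>j\<in>{k+1..CARD('x)}. (?x i j)\<^sup>2 / (\<kappa> i - \<kappa> j)) - v \<bullet> (G *v v)\<bar> \<le> \<eta> / 2 * (norm v)\<^sup>2" .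
    have "K * norm E ^ 3 \<le> K * ((C + 1) * norm h) ^ 3"
      using K E1 by (intro mult_left_mono power_mono) auto
    also have "\<dots> = K * (C + 1) ^ 3 * norm h * (norm h)\<^sup>2"
      by (simp add: power_mult_distrib power2_eq_square power3_eq_cube)
    also have "\<dots> \<le> K * (C + 1) ^ 3 * \<rho> * (norm v)\<^sup>2"
      using K C h hv \<rho> by (intro mult_mono power_mono) auto
    also have "\<dots> \<le> \<eta> / 2 * (norm v)\<^sup>2" using \<rho>2 by (intro mult_right_mono) auto
    finally have "\<bar>loss Q - v \<bullet> (G *v v)\<bar> \<le> \<eta> / 2 * (norm v)\<^sup>2 + \<eta> / 2 * (norm v)\<^sup>2"
      using 1 4 by linarith
    then show "\<bar>loss Q - normalized_dev P Q \<bullet> (G *v normalized_dev P Q)\<bar> \<le> \<eta> * (norm (normalized_dev P Q))\<^sup>2"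
      by (simp add: v_def)
  qed
qed

section \<open>The kernel of \<open>G\<close> and its nonvanishing\<close>

lemma B_nth: "B $ y $ x = (pmf P (x, y) - pX P x * pY P y) / sqrt (pX P x * pY P y)"
  unfolding B_tilde[symmetric] by (simp add: B_tilde_def)

lemma sum_X: "(\<Sum>x\<in>UNIV. pX P x) = 1" and sum_Y: "(\<Sum>y\<in>UNIV. pY P y) = 1"
  by (simp_all only: sum_pmf_eq_1[OF finite subset_UNIV])

lemma sum_P_X: "(\<Sum>y\<in>UNIV. pmf P (x, y)) = pX P x"
  using marg_X_prob_vec[of P x] by (simp add: marg_X_def prob_vec_def)

lemma sum_P_Y: "(\<Sum>x\<in>UNIV. pmf P (x, y)) = pY P y"
  using marg_Y_prob_vec[of P y] by (simp add: marg_Y_def prob_vec_def)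

definition root_X :: "real^'x" where "root_X = (\<chi> x. sqrt (pX P x))"
definition root_Y :: "real^'y" where "root_Y = (\<chi> y. sqrt (pY P y))"

text \<open>Subtracting the product of the marginals removes the trivial singular pair, leaving the
  roots of the marginals as right and left null vectors.\<close>

lemma B_root_X: "B *v root_X = 0"
proof -
  have "(B *v root_X) $ y = 0" for y
  proof -
    have "B $ y $ x * root_X $ x = (pmf P (x, y) - pX P x * pY P y) / sqrt (pY P y)" for x
      using marginal_X[of x] marginal_Y[of y] by (simp add: B_nth root_X_def real_sqrt_mult)
    then have "(B *v root_X) $ y = (\<Sum>x\<in>UNIV. pmf P (x, y) - pX P x * pY P y) / sqrt (pY P y)"
      by (simp add: matrix_vector_mult_def sum_divide_distrib)
    also have "(\<Sum>x\<in>UNIV. pmf P (x, y) - pX P x * pY P y) = 0"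
      by (simp add: sum_subtractf sum_distrib_right[symmetric] sum_X sum_P_Y)
    finally show ?thesis by simp
  qed
  then show ?thesis by (simp add: vec_eq_iff)
qed

lemma root_Y_B: "root_Y \<bullet> (B *v v) = 0"
proof -
  have "(\<Sum>y\<in>UNIV. root_Y $ y * B $ y $ x) = 0" for x
  proof -
    have "root_Y $ y * B $ y $ x = (pmf P (x, y) - pX P x * pY P y) / sqrt (pX P x)" for y
      using marginal_X[of x] marginal_Y[of y] by (simp add: B_nth root_Y_def real_sqrt_mult)
    then have "(\<Sum>y\<in>UNIV. root_Y $ y * B $ y $ x) = (\<Sum>y\<in>UNIV. pmf P (x, y) - pX P x * pY P y) / sqrt (pX P x)"
      by (simp add: sum_divide_distrib)
    also have "(\<Sum>y\<in>UNIV. pmf P (x, y) - pX P x * pY P y) = 0"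
      by (simp add: sum_subtractf sum_distrib_left[symmetric] sum_Y sum_P_X)
    finally show ?thesis by simp
  qed
  moreover have "root_Y \<bullet> (B *v v) = (\<Sum>x\<in>UNIV. (\<Sum>y\<in>UNIV. root_Y $ y * B $ y $ x) * v $ x)"
    unfolding inner_vec_def matrix_vector_mult_def sum_distrib_right
    by (subst sum.swap) (simp add: sum_distrib_left mult_ac)
  ultimately show ?thesis by simp
qed

text \<open>This direction is displacement along \<open>p\<close> itself, a pure scaling. The first
  term of \<open>B_vec\<close> is invariant under it, so the derivative is a rank-one matrix with
  range spanned by \<open>root_Y\<close>, orthogonal to the range of \<open>B\<close>.\<close>

lemma G_root: "G *v (\<chi> a. sqrt (pmf P a)) = 0"
proof (rule G_kernel)
  fix i j
  have w: "weighted P (\<chi> a. sqrt (pmf P a)) = p"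
    by (simp add: weighted_def p_def prob_vec_def)
  have "dB p p $ y $ x = - (root_Y $ y * root_X $ x)" for y x
  proof -
    have ab: "pX P x > 0" "pY P y > 0" using marginal_X marginal_Y by auto
    have "dB p p $ y $ x = - (pX P x * pY P y) / sqrt (pX P x * pY P y)"
      using ab by (simp add: dB_def p_def marg_X_prob_vec marg_Y_prob_vec add_divide_distrib)
    also have "\<dots> = - sqrt (pX P x * pY P y)"
      using ab by (simp only: divide_minus_left real_div_sqrt mult_nonneg_nonneg less_imp_le)
    finally show ?thesis by (simp add: root_X_def root_Y_def real_sqrt_mult)
  qed
  then have "dB p p = outer (- root_Y) root_X" by (simp add: vec_eq_iff outer_def)
  then have "dB p p *v u = - (root_X \<bullet> u) *\<^sub>R root_Y" for u
    by (simp add: outer_mult_vec)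
  then show "\<phi> i \<bullet> (Alin (weighted P (\<chi> a. sqrt (pmf P a))) *v \<phi> j) = 0"
    unfolding w Alin_def inner_dgram by (simp add: root_Y_B inner_commute[of _ root_Y])
qed

lemma G_axis:
  assumes "pmf P a = 0"
  shows "G *v axis a 1 = 0"
proof (rule G_kernel)
  fix i j
  have "weighted P (axis a 1) = 0" using assms by (auto simp: vec_eq_iff weighted_def axis_def)
  then show "\<phi> i \<bullet> (Alin (weighted P (axis a 1)) *v \<phi> j) = 0"
    using bounded_linear.linear[OF Alin_bounded_linear] by (simp add: linear_0)
qed

lemma \<kappa>_pos: "i \<in> {1..k} \<Longrightarrow> \<kappa> i > 0"
proof -
  assume "i \<in> {1..k}"
  then have "\<kappa> (k + 1) < \<kappa> i" using k_less by (intro \<kappa>_less) auto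
  moreover have "0 \<le> \<kappa> (k + 1)" by (simp add: \<kappa>_def)
  ultimately show ?thesis by linarith
qed

text \<open>\<open>root_X\<close> has eigenvalue 0, the top block positive eigenvalues, and
  eigenvectors of distinct eigenvalues are orthogonal.\<close>

lemma phi_root_X:
  assumes "i \<in> {1..k}"
  shows "\<phi> i \<bullet> root_X = 0"
proof -
  have i: "i \<in> {1..CARD('x)}" using assms k_less by auto
  have "\<kappa> i * (\<phi> i \<bullet> root_X) = (A *v \<phi> i) \<bullet> root_X"
    using eig i by (simp add: eigen_system_def)
  also have "\<dots> = root_X \<bullet> (A *v \<phi> i)" by (rule inner_commute)
  also have "\<dots> = 0" by (simp add: A_def inner_gram B_root_X)
  finally show ?thesis using \<kappa>_pos[OF assms] by simp
qed

text \<open>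
  The square roots of the marginal of \<open>Q\<close> form a null vector of \<open>B_vec (prob_vec Q)\<close>. The direction \<open>w\<close>
  below is the one in which this null vector has first variation \<open>\<phi> 1 / 2\<close>, so that \<open>\<phi> 1\<close> must tilt at
  first order in order to stay orthogonal to it.
\<close>
lemma quadratic_form_nonzero: "\<exists>w. w \<bullet> (G *v w) > 0"
proof (rule ccontr)
  assume neg: "\<not> ?thesis"
  define w :: "real^('x \<times> 'y)" where "w = (\<chi> a. sqrt (pmf P a) * (\<phi> 1 $ fst a / sqrt (pX P (fst a))))"
  define h where "h = weighted P w"
  define H where "H = dB p h"
  have one: "1 \<in> {1..k}" using k by simp
  have h: "h $ (x, y) = pmf P (x, y) * (\<phi> 1 $ x / sqrt (pX P x))" for x y
    by (simp add: h_def weighted_def w_def mult.assoc[symmetric])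
  have hX: "marg_X h x / pX P x = \<phi> 1 $ x / sqrt (pX P x)" for x
  proof -
    have "marg_X h x = pX P x * (\<phi> 1 $ x / sqrt (pX P x))"
      unfolding marg_X_def h sum_distrib_right[symmetric] sum_P_X ..
    then show ?thesis using marginal_X[of x] by simp
  qed
  define t where "t y = marg_Y h y" for y
  have t: "(\<Sum>x\<in>UNIV. pmf P (x, y) * (\<phi> 1 $ x / sqrt (pX P x))) = t y" for y
    by (simp add: t_def marg_Y_def h)
  \<comment> \<open>Equivalently, the displacement \<open>h\<close> has total mass zero.\<close>
  have orth: "(\<Sum>x\<in>UNIV. \<phi> 1 $ x * sqrt (pX P x)) = 0"
    using phi_root_X[OF one] by (simp add: inner_vec_def root_X_def)
  have B1: "(B *v \<phi> 1) $ y = t y / sqrt (pY P y)" for y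
  proof -
    have "B $ y $ x * \<phi> 1 $ x = (pmf P (x, y) * (\<phi> 1 $ x / sqrt (pX P x)) - pY P y * (\<phi> 1 $ x * sqrt (pX P x))) / sqrt (pY P y)" for x
    proof -
      obtain r where r: "r > 0" "pX P x = r\<^sup>2" using marginal_X[of x] real_sqrt_pow2[of "pX P x"] by (metis less_imp_le real_sqrt_gt_0_iff)
      show ?thesis using r marginal_Y[of y]
        by (simp add: B_nth real_sqrt_mult field_simps power2_eq_square)
    qed
    then have "(B *v \<phi> 1) $ y = (t y - pY P y * (\<Sum>x\<in>UNIV. \<phi> 1 $ x * sqrt (pX P x))) / sqrt (pY P y)"
      unfolding t[symmetric] by (simp add: matrix_vector_mult_def sum_divide_distrib[symmetric] sum_subtractf sum_distrib_left)
    then show ?thesis by (simp only: orth mult_zero_right diff_zero)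
  qed
  \<comment> \<open>The first variation along \<open>h\<close> of the null vector relation: the root
    of the marginal varies by \<open>\<phi> 1 / 2\<close>, so \<open>H *v root_X\<close> must cancel
    half of \<open>B *v \<phi> 1\<close>.\<close>
  have Hu: "(H *v root_X) $ y = - 1 / 2 * (B *v \<phi> 1) $ y" for y
  proof -
    have b: "pY P y > 0" by (rule marginal_Y)
    have "H $ y $ x * root_X $ x = (pmf P (x, y) * (\<phi> 1 $ x / sqrt (pX P x))
      - 1 / 2 * (pmf P (x, y) * (\<phi> 1 $ x / sqrt (pX P x))) - 1 / 2 * pY P y * (\<phi> 1 $ x * sqrt (pX P x))
      - 1 / 2 * (t y / pY P y) * (pmf P (x, y) + pX P x * pY P y)) / sqrt (pY P y)" for x
    proof -
      obtain r where r: "r > 0" "pX P x = r\<^sup>2" using marginal_X[of x] real_sqrt_pow2[of "pX P x"] by (metis less_imp_le real_sqrt_gt_0_iff)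
      have "H $ y $ x * root_X $ x = (h $ (x, y) - 1 / 2 * (\<phi> 1 $ x / sqrt (pX P x) + t y / pY P y)
         * (pmf P (x, y) + pX P x * pY P y)) / sqrt (pY P y)"
        using marginal_X[of x] unfolding hX[symmetric] t_def
        by (simp add: H_def dB_def p_def marg_X_prob_vec marg_Y_prob_vec root_X_def real_sqrt_mult) (simp add: prob_vec_def)
      then show ?thesis unfolding h using r b
        by (simp add: real_sqrt_mult field_simps power2_eq_square)
    qed
    then have "(H *v root_X) $ y = (t y - 1 / 2 * t y - 1 / 2 * pY P y * (\<Sum>x\<in>UNIV. \<phi> 1 $ x * sqrt (pX P x))
      - 1 / 2 * (t y / pY P y) * (\<Sum>x\<in>UNIV. pmf P (x, y) + pX P x * pY P y)) / sqrt (pY P y)"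
      unfolding t[symmetric]
      by (simp only: matrix_vector_mult_def vec_lambda_beta sum_divide_distrib[symmetric] sum_subtractf sum_distrib_left)
    also have "(\<Sum>x\<in>UNIV. pmf P (x, y) + pX P x * pY P y) = 2 * pY P y"
      by (simp add: sum.distrib sum_P_Y sum_distrib_right[symmetric] sum_X)
    finally show ?thesis unfolding orth B1 using b by (simp add: field_simps)
  qed
  then have Hu': "H *v root_X = (- 1 / 2) *\<^sub>R (B *v \<phi> 1)" by (simp add: vec_eq_iff)
  have "\<phi> 1 \<bullet> (Alin h *v root_X) = - 1 / 2 * ((B *v \<phi> 1) \<bullet> (B *v \<phi> 1))"
    unfolding Alin_def inner_dgram H_def[symmetric] Hu' B_root_X by simp
  also have "(B *v \<phi> 1) \<bullet> (B *v \<phi> 1) = \<phi> 1 \<bullet> (A *v \<phi> 1)" by (simp add: A_def inner_gram)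
  also have "\<dots> = \<kappa> 1"
    using eig by (simp add: eigen_system_def orthonormal_family_def Suc_le_eq)
  finally have nz: "\<phi> 1 \<bullet> (Alin h *v root_X) \<noteq> 0" using \<kappa>_pos[OF one] by simp
  \<comment> \<open>A vanishing form is a vanishing sum of nonnegative terms, so each entry between
    \<open>\<phi> 1\<close> and the lower block is zero.\<close>
  have z: "\<phi> 1 \<bullet> (Alin h *v \<phi> j) = 0" if j: "j \<in> {k+1..CARD('x)}" for j
  proof -
    have nonneg: "(\<phi> i \<bullet> (Alin h *v \<phi> j)) * (\<phi> i \<bullet> (Alin h *v \<phi> j)) / (\<kappa> i - \<kappa> j) \<ge> 0"
      if "i \<in> {1..k}" "j \<in> {k+1..CARD('x)}" for i j
      using \<kappa>_less[OF that] by simp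
    have "\<not> 0 < w \<bullet> (G *v w)" using neg by blast
    then have "w \<bullet> (G *v w) = 0" using G_psd[of w] by linarith
    then have "\<forall>i\<in>{1..k}. (\<Sum>j\<in>{k+1..CARD('x)}. (\<phi> i \<bullet> (Alin h *v \<phi> j)) * (\<phi> i \<bullet> (Alin h *v \<phi> j)) / (\<kappa> i - \<kappa> j)) = 0"
      unfolding G_mult h_def[symmetric] by (subst (asm) sum_nonneg_eq_0_iff) (auto intro!: sum_nonneg nonneg)
    then have "(\<Sum>j\<in>{k+1..CARD('x)}. (\<phi> 1 \<bullet> (Alin h *v \<phi> j)) * (\<phi> 1 \<bullet> (Alin h *v \<phi> j)) / (\<kappa> 1 - \<kappa> j)) = 0"
      using one by blast
    then have "(\<phi> 1 \<bullet> (Alin h *v \<phi> j)) * (\<phi> 1 \<bullet> (Alin h *v \<phi> j)) / (\<kappa> 1 - \<kappa> j) = 0"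
      using j nonneg[OF one] by (subst (asm) sum_nonneg_eq_0_iff) auto
    then show ?thesis using \<kappa>_less[OF one j] by simp
  qed
  have "orthonormal_family \<phi>" using eig by (simp add: eigen_system_def)
  \<comment> \<open>By \<open>phi_root_X\<close> this expansion has only lower-block terms, exactly
    those annihilated by \<open>z\<close>.\<close>
  then have "root_X = (\<Sum>a\<in>{1..CARD('x)}. (\<phi> a \<bullet> root_X) *\<^sub>R \<phi> a)"
    by (simp only: orthonormal_expand)
  then have "\<phi> 1 \<bullet> (Alin h *v root_X) = \<phi> 1 \<bullet> (Alin h *v (\<Sum>a\<in>{1..CARD('x)}. (\<phi> a \<bullet> root_X) *\<^sub>R \<phi> a))"
    by (rule arg_cong)
  also have "\<dots> = (\<Sum>a\<in>{1..CARD('x)}. (\<phi> a \<bullet> root_X) * (\<phi> 1 \<bullet> (Alin h *v \<phi> a)))"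
    by (simp add: linear_sum matrix_vector_mult_scaleR inner_sum_right del: One_nat_def)
  also have "\<dots> = 0"
  proof (rule sum.neutral, rule ballI)
    fix a assume "a \<in> {1..CARD('x)}"
    then show "(\<phi> a \<bullet> root_X) * (\<phi> 1 \<bullet> (Alin h *v \<phi> a)) = 0"
      using phi_root_X[of a] z[of a] by (cases "a \<le> k") auto
  qed
  finally show False using nz by simp
qed

section \<open>The extremal direction and the asymptotics of the rate\<close>

lemma top_direction:
  obtains v\<^sub>0 where "norm v\<^sub>0 = 1" "v\<^sub>0 \<bullet> (G *v v\<^sub>0) = \<alpha>" "\<And>v. v \<bullet> (G *v v) \<le> \<alpha> * (norm v)\<^sup>2" "\<alpha> > 0"
    "(\<Sum>a\<in>UNIV. sqrt (pmf P a) * v\<^sub>0 $ a) = 0" "\<And>a. pmf P a = 0 \<Longrightarrow> v\<^sub>0 $ a = 0"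
proof -
  obtain v\<^sub>0 where v\<^sub>0: "norm v\<^sub>0 = 1" "G *v v\<^sub>0 = \<alpha> *\<^sub>R v\<^sub>0" "\<And>v. v \<bullet> (G *v v) \<le> \<alpha> * (norm v)\<^sup>2"
    using psd_top_eigenvector[OF G_sym G_psd] unfolding \<alpha>_def alpha_def G_def by blast
  have "\<alpha> > 0"
  proof (rule ccontr)
    assume "\<not> \<alpha> > 0"
    obtain w where "w \<bullet> (G *v w) > 0" using quadratic_form_nonzero by blast
    moreover have "\<alpha> * (norm w)\<^sup>2 \<le> 0" using \<open>\<not> \<alpha> > 0\<close> by (simp add: mult_le_0_iff)
    ultimately show False using v\<^sub>0(3)[of w] by simp
  qed
  have ker: "w \<bullet> v\<^sub>0 = 0" if "G *v w = 0" for w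
  proof -
    have "\<alpha> * (w \<bullet> v\<^sub>0) = w \<bullet> (G *v v\<^sub>0)" by (simp add: v\<^sub>0(2))
    also have "\<dots> = 0" using G_sym[of w v\<^sub>0] that by simp
    finally show ?thesis using \<open>\<alpha> > 0\<close> by simp
  qed
  show ?thesis
  proof (rule that[OF v\<^sub>0(1) _ v\<^sub>0(3) \<open>\<alpha> > 0\<close>])
    show "v\<^sub>0 \<bullet> (G *v v\<^sub>0) = \<alpha>" using v\<^sub>0 by (simp add: norm_eq_1)
    show "(\<Sum>a\<in>UNIV. sqrt (pmf P a) * v\<^sub>0 $ a) = 0"
      using ker[OF G_root] by (simp add: inner_vec_def)
    show "v\<^sub>0 $ a = 0" if "pmf P a = 0" for a
      using ker[OF G_axis[OF that]] by (simp add: inner_axis')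
  qed
qed

lemma \<alpha>_pos: "\<alpha> > 0" by (rule top_direction)

text \<open>Moving a distance \<open>t\<close> along the top eigenvector yields loss about
  \<open>\<alpha> * t\<^sup>2\<close> at cost about \<open>t\<^sup>2 / 2\<close>; the slack
  \<open>x\<close> absorbs both second-order errors.\<close>

lemma rate_upper:
  assumes r: "1 / (2 * \<alpha>) < r"
  shows "\<forall>\<^sub>F \<epsilon> in at_right 0. \<exists>Q. loss Q > \<epsilon> \<and> set_pmf Q \<subseteq> set_pmf P \<and> rel_entropy Q P \<le> r * \<epsilon>"
proof -
  obtain v\<^sub>0 where v\<^sub>0: "norm v\<^sub>0 = 1" "v\<^sub>0 \<bullet> (G *v v\<^sub>0) = \<alpha>"
    and "\<And>v. v \<bullet> (G *v v) \<le> \<alpha> * (norm v)\<^sup>2" "\<alpha> > 0"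
    and v\<^sub>0': "(\<Sum>a\<in>UNIV. sqrt (pmf P a) * v\<^sub>0 $ a) = 0" "\<And>a. pmf P a = 0 \<Longrightarrow> v\<^sub>0 $ a = 0"
    by (fact top_direction)
  have "((\<lambda>x. (1 / 2 + x) * ((1 + x) / (\<alpha> - x))) \<longlongrightarrow> (1 / 2 + 0) * ((1 + 0) / (\<alpha> - 0))) (at_right 0)"
    using \<alpha>_pos by (intro tendsto_intros) auto
  then have "\<forall>\<^sub>F x in at_right 0. (1 / 2 + x) * ((1 + x) / (\<alpha> - x)) < r"
    by (rule order_tendstoD) (use r in simp)
  moreover have "\<forall>\<^sub>F x in at_right 0. x \<in> {0<..<\<alpha>}"
    using \<alpha>_pos by (rule eventually_at_right_real)
  ultimately have "\<forall>\<^sub>F x in at_right 0. 0 < x \<and> x < \<alpha> \<and> (1 / 2 + x) * ((1 + x) / (\<alpha> - x)) < r"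
    by eventually_elim simp
  then obtain x where x: "0 < x" "x < \<alpha>" "(1 / 2 + x) * ((1 + x) / (\<alpha> - x)) < r"
    using eventually_happens'[OF trivial_limit_at_right_real] by blast
  obtain \<rho>1 where \<rho>1: "\<rho>1 > 0" "\<And>Q. set_pmf Q \<subseteq> set_pmf P \<Longrightarrow> norm (normalized_dev P Q) < \<rho>1 \<Longrightarrow>
      \<bar>rel_entropy Q P - (norm (normalized_dev P Q))\<^sup>2 / 2\<bar> \<le> x * (norm (normalized_dev P Q))\<^sup>2"
    using rel_entropy_local[OF x(1)] by blast
  obtain \<rho>2 where \<rho>2: "\<rho>2 > 0" "\<And>Q. set_pmf Q \<subseteq> set_pmf P \<Longrightarrow> norm (normalized_dev P Q) < \<rho>2 \<Longrightarrow>
      \<bar>loss Q - normalized_dev P Q \<bullet> (G *v normalized_dev P Q)\<bar> \<le> x * (norm (normalized_dev P Q))\<^sup>2"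
    using loss_quadratic[OF x(1)] by blast
  obtain m where m: "m > 0" and m_le: "\<And>a. a \<in> set_pmf P \<Longrightarrow> m \<le> sqrt (pmf P a)"
    using sqrt_pmf_bounded_below by blast
  \<comment> \<open>The bound by \<open>m\<close> keeps the perturbed weights nonnegative, the other
    two keep the expansions valid.\<close>
  define \<rho> where "\<rho> = min m (min \<rho>1 \<rho>2)"
  have \<rho>: "\<rho> > 0" using m \<rho>1 \<rho>2 by (simp add: \<rho>_def)
  \<comment> \<open>With \<open>t\<^sup>2 = \<epsilon> * s\<close> the guaranteed loss is
    \<open>\<epsilon> * (1 + x)\<close>, strictly above \<epsilon> as the event demands.\<close>
  define s where "s = (1 + x) / (\<alpha> - x)"
  have s: "s > 0" "s * (\<alpha> - x) = 1 + x" using x by (auto simp: s_def)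
  have "\<forall>\<^sub>F \<epsilon> in at_right 0. \<epsilon> \<in> {0<..<\<rho>\<^sup>2 / s}"
    using \<rho> s by (intro eventually_at_right_real) simp
  then show ?thesis
  proof eventually_elim
    case (elim \<epsilon>)
    then have \<epsilon>: "\<epsilon> > 0" "\<epsilon> * s < \<rho>\<^sup>2" using s by (auto simp: pos_less_divide_eq)
    define t where "t = sqrt (\<epsilon> * s)"
    have t: "t > 0" "t\<^sup>2 = \<epsilon> * s" "t < \<rho>"
      using \<epsilon> s \<rho> by (auto simp: t_def intro: real_less_lsqrt)
    obtain Q where Q: "set_pmf Q \<subseteq> set_pmf P" "normalized_dev P Q = t *\<^sub>R v\<^sub>0"
    proof (rule perturbed_pmf[of P "t *\<^sub>R v\<^sub>0"])
      show "(\<Sum>a\<in>UNIV. sqrt (pmf P a) * (t *\<^sub>R v\<^sub>0) $ a) = 0"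
        using v\<^sub>0'(1) by (simp add: mult.left_commute sum_distrib_left[symmetric])
      show "(t *\<^sub>R v\<^sub>0) $ a = 0" if "pmf P a = 0" for a using v\<^sub>0'(2)[OF that] by simp
      show "\<bar>(t *\<^sub>R v\<^sub>0) $ a\<bar> \<le> sqrt (pmf P a)" if "a \<in> set_pmf P" for a
      proof -
        have "\<bar>(t *\<^sub>R v\<^sub>0) $ a\<bar> \<le> norm (t *\<^sub>R v\<^sub>0)" by (rule component_le_norm_cart)
        also have "\<dots> = t" using t v\<^sub>0 by simp
        also have "\<dots> \<le> m" using t by (simp add: \<rho>_def)
        finally show ?thesis using m_le[OF that] by simp
      qed
    qed
    have nv: "norm (normalized_dev P Q) = t" using Q v\<^sub>0 t by simp
    have q: "normalized_dev P Q \<bullet> (G *v normalized_dev P Q) = t\<^sup>2 * \<alpha>"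
      by (simp add: Q(2) matrix_vector_mult_scaleR v\<^sub>0(2) power2_eq_square)
    have "\<bar>loss Q - t\<^sup>2 * \<alpha>\<bar> \<le> x * t\<^sup>2"
      using \<rho>2(2)[OF Q(1)] t(3) unfolding nv q by (simp add: \<rho>_def)
    then have "loss Q \<ge> t\<^sup>2 * \<alpha> - x * t\<^sup>2" by linarith
    also have "t\<^sup>2 * \<alpha> - x * t\<^sup>2 = \<epsilon> * (s * (\<alpha> - x))" by (simp add: t(2) algebra_simps)
    also have "\<dots> = \<epsilon> + \<epsilon> * x" unfolding s(2) by (simp add: distrib_left)
    finally have "\<epsilon> + \<epsilon> * x \<le> loss Q" .
    moreover have "\<epsilon> * x > 0" using \<epsilon> x by simp
    ultimately have 1: "loss Q > \<epsilon>" by linarith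
    have "\<bar>rel_entropy Q P - t\<^sup>2 / 2\<bar> \<le> x * t\<^sup>2"
      using \<rho>1(2)[OF Q(1)] t(3) unfolding nv by (simp add: \<rho>_def)
    then have "rel_entropy Q P \<le> (1 / 2 + x) * t\<^sup>2" by (simp add: algebra_simps)
    also have "\<dots> = (1 / 2 + x) * s * \<epsilon>" by (simp add: t(2))
    also have "\<dots> \<le> r * \<epsilon>" using x(3) \<epsilon> unfolding s_def[symmetric] by (intro mult_right_mono) auto
    finally show ?case using 1 Q by blast
  qed
qed

text \<open>Near \<open>P\<close>, loss above \<epsilon> forces a squared deviation of at least
  \<open>\<epsilon> / (\<alpha> + x)\<close>, hence the entropy. Away from \<open>P\<close> the
  entropy has a positive lower bound, which beats \<open>r * \<epsilon>\<close> for small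
  \<epsilon>.\<close>

lemma rate_lower:
  assumes r: "r < 1 / (2 * \<alpha>)"
  shows "\<forall>\<^sub>F \<epsilon> in at_right 0. \<forall>Q. loss Q > \<epsilon> \<longrightarrow> set_pmf Q \<subseteq> set_pmf P \<longrightarrow> r * \<epsilon> \<le> rel_entropy Q P"
proof -
  have quad_le: "v \<bullet> (G *v v) \<le> \<alpha> * (norm v)\<^sup>2" for v by (rule top_direction)
  have "((\<lambda>x. (1 / 2 - x) / (\<alpha> + x)) \<longlongrightarrow> (1 / 2 - 0) / (\<alpha> + 0)) (at_right 0)"
    using \<alpha>_pos by (intro tendsto_intros) auto
  then have "\<forall>\<^sub>F x in at_right 0. r < (1 / 2 - x) / (\<alpha> + x)"
    by (rule order_tendstoD) (use r in simp)
  moreover have "\<forall>\<^sub>F x in at_right 0. x \<in> {0<..<(1 / 2 :: real)}"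
    by (rule eventually_at_right_real) simp
  ultimately have "\<forall>\<^sub>F x in at_right 0. 0 < x \<and> x < 1 / 2 \<and> r < (1 / 2 - x) / (\<alpha> + x)"
    by eventually_elim simp
  then obtain x where x: "0 < x" "x < 1 / 2" "r < (1 / 2 - x) / (\<alpha> + x)"
    using eventually_happens'[OF trivial_limit_at_right_real] by blast
  obtain \<rho>1 where \<rho>1: "\<rho>1 > 0" "\<And>Q. set_pmf Q \<subseteq> set_pmf P \<Longrightarrow> norm (normalized_dev P Q) < \<rho>1 \<Longrightarrow>
      \<bar>rel_entropy Q P - (norm (normalized_dev P Q))\<^sup>2 / 2\<bar> \<le> x * (norm (normalized_dev P Q))\<^sup>2"
    using rel_entropy_local[OF x(1)] by blast
  obtain \<rho>2 where \<rho>2: "\<rho>2 > 0" "\<And>Q. set_pmf Q \<subseteq> set_pmf P \<Longrightarrow> norm (normalized_dev P Q) < \<rho>2 \<Longrightarrow>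
      \<bar>loss Q - normalized_dev P Q \<bullet> (G *v normalized_dev P Q)\<bar> \<le> x * (norm (normalized_dev P Q))\<^sup>2"
    using loss_quadratic[OF x(1)] by blast
  obtain m where m: "m > 0" "\<And>Q. set_pmf Q \<subseteq> set_pmf P \<Longrightarrow> m * norm (normalized_dev P Q) \<le> norm (prob_vec Q - prob_vec P)"
    using normalized_dev_le by blast
  define \<rho> where "\<rho> = min \<rho>1 \<rho>2"
  have \<rho>: "\<rho> > 0" using \<rho>1 \<rho>2 by (simp add: \<rho>_def)
  \<comment> \<open>The denominator \<open>\<bar>r\<bar> + 1\<close> is positive and dominates
    \<open>r\<close>, which may be negative or zero.\<close>
  have "\<forall>\<^sub>F \<epsilon> in at_right 0. \<epsilon> \<in> {0<..<(m * \<rho>)\<^sup>2 / 4 / (\<bar>r\<bar> + 1)}"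
    using \<rho> m by (intro eventually_at_right_real) auto
  then show ?thesis
  proof eventually_elim
    case (elim \<epsilon>)
    then have "\<epsilon> < (m * \<rho>)\<^sup>2 / 4 / (\<bar>r\<bar> + 1)" and \<epsilon>0: "\<epsilon> > 0"
      unfolding greaterThanLessThan_iff by blast+
    moreover have "\<bar>r\<bar> + 1 > 0" by simp
    ultimately have \<epsilon>: "\<epsilon> > 0" "\<epsilon> * (\<bar>r\<bar> + 1) < (m * \<rho>)\<^sup>2 / 4"
      by (simp_all only: pos_less_divide_eq)
    show ?case
    proof (intro allI impI)
      fix Q assume loss: "loss Q > \<epsilon>" and Q: "set_pmf Q \<subseteq> set_pmf P"
      define v where "v = normalized_dev P Q"
      show "r * \<epsilon> \<le> rel_entropy Q P"
      proof (cases "norm v < \<rho>")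
        case True
        have "\<bar>loss Q - v \<bullet> (G *v v)\<bar> \<le> x * (norm v)\<^sup>2"
          using \<rho>2(2)[OF Q] True by (simp add: \<rho>_def v_def)
        then have "\<epsilon> \<le> (\<alpha> + x) * (norm v)\<^sup>2"
          using quad_le[of v] loss by (simp add: algebra_simps)
        then have "\<epsilon> / (\<alpha> + x) \<le> (norm v)\<^sup>2" using \<alpha>_pos x by (simp add: pos_divide_le_eq mult.commute)
        then have "(1 / 2 - x) * (\<epsilon> / (\<alpha> + x)) \<le> (1 / 2 - x) * (norm v)\<^sup>2"
          using x by (intro mult_left_mono) auto
        moreover have "\<bar>rel_entropy Q P - (norm v)\<^sup>2 / 2\<bar> \<le> x * (norm v)\<^sup>2"
          using \<rho>1(2)[OF Q] True by (simp add: \<rho>_def v_def)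
        then have "(1 / 2 - x) * (norm v)\<^sup>2 \<le> rel_entropy Q P" by (simp add: algebra_simps)
        moreover have "r * \<epsilon> \<le> (1 / 2 - x) / (\<alpha> + x) * \<epsilon>"
          using x \<epsilon> by (intro mult_right_mono) auto
        ultimately show ?thesis by simp
      next
        case False
        have "m * \<rho> \<le> m * norm v" using False m by (intro mult_left_mono) auto
        also have "\<dots> \<le> norm (prob_vec Q - prob_vec P)" unfolding v_def by (rule m(2)[OF Q])
        finally have "(m * \<rho>)\<^sup>2 \<le> (norm (prob_vec Q - prob_vec P))\<^sup>2"
          using m \<rho> by (intro power_mono) auto
        moreover have "r * \<epsilon> \<le> \<epsilon> * (\<bar>r\<bar> + 1)"
          using \<epsilon> mult_right_mono[of r "\<bar>r\<bar> + 1" \<epsilon>] by (simp add: mult.commute)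
        ultimately show ?thesis using rel_entropy_ge_dist[OF Q] \<epsilon> by linarith
      qed
    qed
  qed
qed

definition rate :: "real \<Rightarrow> real" where
  "rate \<epsilon> = (INF Q\<in>{Q. loss Q > \<epsilon> \<and> set_pmf Q \<subseteq> set_pmf P}. rel_entropy Q P)"

lemma rate_tendsto: "((\<lambda>\<epsilon>. rate \<epsilon> / \<epsilon>) \<longlongrightarrow> 1 / (2 * \<alpha>)) (at_right 0)"
proof -
  have bdd: "bdd_below ((\<lambda>Q. rel_entropy Q P) ` {Q. loss Q > \<epsilon> \<and> set_pmf Q \<subseteq> set_pmf P})" for \<epsilon>
  proof (rule bdd_belowI2[of _ 0])
    fix Q assume "Q \<in> {Q. loss Q > \<epsilon> \<and> set_pmf Q \<subseteq> set_pmf P}"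
    then have "(norm (prob_vec Q - prob_vec P))\<^sup>2 / 4 \<le> rel_entropy Q P"
      by (intro rel_entropy_ge_dist) simp
    then show "0 \<le> rel_entropy Q P" by (rule order_trans[rotated]) simp
  qed
  have eps: "\<forall>\<^sub>F \<epsilon> in at_right (0::real). \<epsilon> > 0" by (rule eventually_at_right_less)
  \<comment> \<open>Nonemptiness is recorded too, because a real infimum can be bounded below
    termwise only over a nonempty set.\<close>
  have up: "\<forall>\<^sub>F \<epsilon> in at_right 0. {Q. loss Q > \<epsilon> \<and> set_pmf Q \<subseteq> set_pmf P} \<noteq> {} \<and> rate \<epsilon> \<le> r * \<epsilon>" if "1 / (2 * \<alpha>) < r" for r
    using rate_upper[OF that]
  proof eventually_elim
    case (elim \<epsilon>)
    then obtain Q where Q: "Q \<in> {Q. loss Q > \<epsilon> \<and> set_pmf Q \<subseteq> set_pmf P}" "rel_entropy Q P \<le> r * \<epsilon>" by auto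
    have "rate \<epsilon> \<le> rel_entropy Q P" unfolding rate_def by (intro cINF_lower bdd Q)
    with Q show ?case by auto
  qed
  show ?thesis
  proof (rule order_tendstoI)
    fix r assume "r < 1 / (2 * \<alpha>)"
    then obtain r' where r': "r < r'" "r' < 1 / (2 * \<alpha>)" using dense by blast
    have "\<forall>\<^sub>F \<epsilon> in at_right 0. {Q. loss Q > \<epsilon> \<and> set_pmf Q \<subseteq> set_pmf P} \<noteq> {} \<and> rate \<epsilon> \<le> (1 / (2 * \<alpha>) + 1) * \<epsilon>"
      by (rule up) simp
    then show "\<forall>\<^sub>F \<epsilon> in at_right 0. r < rate \<epsilon> / \<epsilon>"
      using rate_lower[OF r'(2)] eps
    proof eventually_elim
      case (elim \<epsilon>)
      then have "r' * \<epsilon> \<le> rate \<epsilon>" unfolding rate_def by (intro cINF_greatest) auto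
      then have "r' \<le> rate \<epsilon> / \<epsilon>" using elim by (simp add: pos_le_divide_eq)
      then show ?case using r' by simp
    qed
  next
    fix r assume "1 / (2 * \<alpha>) < r"
    then obtain r' where r': "1 / (2 * \<alpha>) < r'" "r' < r" using dense by blast
    show "\<forall>\<^sub>F \<epsilon> in at_right 0. rate \<epsilon> / \<epsilon> < r"
      using up[OF r'(1)] eps
    proof eventually_elim
      case (elim \<epsilon>)
      then have "rate \<epsilon> / \<epsilon> \<le> r'" by (simp add: pos_divide_le_eq)
      then show ?case using r' by simp
    qed
  qed
qed

text \<open>\<open>rate_upper\<close> supplies, for small \<epsilon>, a point of the event with
  entropy below the threshold of \<open>sanov_limit\<close>; any \<open>r\<close> above
  \<open>1 / (2 * \<alpha>)\<close> would do.\<close>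

lemma inner_limit:
  "\<forall>\<^sub>F \<epsilon> in at_right 0. (\<lambda>n. ln_prob (loss_prob P \<phi> k c V n \<epsilon>) / ereal (real n)) \<longlonglongrightarrow> ereal (- rate \<epsilon>)"
proof -
  obtain \<rho> where \<rho>: "\<rho> > 0" "\<And>Q \<epsilon>. loss Q > \<epsilon> \<Longrightarrow> norm (prob_vec Q - p) < \<rho> \<Longrightarrow>
      \<exists>\<delta>>0. \<forall>R. (\<forall>a. \<bar>pmf R a - pmf Q a\<bar> < \<delta>) \<longrightarrow> loss R > \<epsilon>"
    using loss_open by blast
  define r where "r = 1 / (2 * \<alpha>) + 1"
  have r: "r > 0" using \<alpha>_pos by (simp add: r_def add_pos_pos)
  have "\<forall>\<^sub>F \<epsilon> in at_right 0. \<epsilon> \<in> {0<..<\<rho>\<^sup>2 / 4 / r}"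
    using \<rho> r by (intro eventually_at_right_real) simp
  moreover have "\<forall>\<^sub>F \<epsilon> in at_right 0. \<exists>Q. loss Q > \<epsilon> \<and> set_pmf Q \<subseteq> set_pmf P \<and> rel_entropy Q P \<le> r * \<epsilon>"
    by (rule rate_upper) (simp add: r_def)
  ultimately show ?thesis
  proof eventually_elim
    case (elim \<epsilon>)
    then obtain Q where Q: "loss Q > \<epsilon>" "set_pmf Q \<subseteq> set_pmf P" "rel_entropy Q P \<le> r * \<epsilon>" by blast
    have "r * \<epsilon> < \<rho>\<^sup>2 / 4" using elim r by (simp add: pos_less_divide_eq mult.commute)
    then have "rel_entropy Q P < \<rho>\<^sup>2 / 4" using Q by linarith
    from sanov_limit[of \<rho> "\<lambda>Q. loss Q > \<epsilon>", OF \<rho>(1) \<rho>(2)[unfolded p_def] Q(1,2) this]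
    show ?case by (simp only: loss_prob_def loss_def rate_def)
  qed
qed

lemma error_exponent: "has_error_exponent (loss_prob P \<phi> k c V) (1 / (2 * ereal (alpha P \<sigma> \<phi> k)))"
  unfolding has_error_exponent_def
proof (intro exI conjI)
  show "\<forall>\<^sub>F \<epsilon> in at_right 0. (\<lambda>n. ln_prob (loss_prob P \<phi> k c V n \<epsilon>) / ereal (real n)) \<longlonglongrightarrow> ereal (- rate \<epsilon>)"
    by (rule inner_limit)
  have lim: "((\<lambda>\<epsilon>. ereal (rate \<epsilon> / \<epsilon>)) \<longlongrightarrow> ereal (1 / (2 * \<alpha>))) (at_right 0)"
    using rate_tendsto by simp
  \<comment> \<open>Positivity of \<alpha> makes the extended quotient a real number.\<close>
  have eq: "1 / (2 * ereal (alpha P \<sigma> \<phi> k)) = ereal (1 / (2 * \<alpha>))"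
    using \<alpha>_pos by (simp add: \<alpha>_def one_ereal_def numeral_eq_ereal)
  show "((\<lambda>\<epsilon>. - (ereal (- rate \<epsilon>) / ereal \<epsilon>)) \<longlongrightarrow> 1 / (2 * ereal (alpha P \<sigma> \<phi> k))) (at_right 0)"
    unfolding eq
  proof (rule Lim_transform_eventually[OF lim])
    show "\<forall>\<^sub>F \<epsilon> in at_right 0. ereal (rate \<epsilon> / \<epsilon>) = - (ereal (- rate \<epsilon>) / ereal \<epsilon>)"
      using eventually_at_right_less[of "0::real"] by eventually_elim simp
  qed
qed

end

theorem theorem1:
  fixes P :: "('x::finite \<times> 'y::finite) pmf"
    and \<sigma> :: "nat \<Rightarrow> real"
    and \<phi> :: "nat \<Rightarrow> real^'x"
    and k :: nat
    and c :: "('x \<times> 'y) pmf \<Rightarrow> real^'x^'y"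
    and V :: "real^'x^'y \<Rightarrow> nat \<Rightarrow> real^'x"
  assumes marginal_X: "\<And>x. pX P x > 0"
    and marginal_Y: "\<And>y. pY P y > 0"
    and svd: "right_singular_system (B_tilde P) \<sigma> \<phi>"
    and k: "1 \<le> k" "k \<le> CARD('x) - 1"
    and gap: "\<sigma> k > \<sigma> (k + 1)"
    and V: "\<And>M. top_right_singular_vectors k M (V M)"
  shows "has_error_exponent (loss_prob P \<phi> k c V) (1 / (2 * ereal (alpha P \<sigma> \<phi> k)))"
proof -
  interpret estimation P \<sigma> \<phi> k c V
    by unfold_locales (fact marginal_X marginal_Y svd k gap V)+
  show ?thesis by (rule error_exponent)
qed

end
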